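(* Let $1<p<\infty$, $p'=\frac{p}{p-1}$, and $\omega\in\widehat{\mathcal{D}}$. Then the following statements are equivalent: (i) $T(D^p_\omega,H^\infty)$ consists of constant functions only (equivalently, $T_c(D^p_\omega,H^\infty)$ consists of constant functions only); (ii) $\displaystyle\int_0^1\frac{(1-r)^{p'}}{\widehat\omega(r)^{p'-1}}\,dr=\infty$; (iii) $\displaystyle\sum_{k=0}^\infty\frac{1}{(k+1)^{2+p'}\omega_k^{p'-1}}=\infty$; (iv) for any $y>p'$ and $0<p^*<\infty$, setting $x=p(y-1)$ (so that $x>y>p'$), the identity map $I:D^{p^*}_{\widehat\omega_{[x]}}\to D^{p^*/p}_y$ is not bounded.
   Context: $\mathbb{D}$ is the open unit disc, $\mathcal{H}(\mathbb{D})$ the analytic functions on it, $dA(z)=\frac{dx\,dy}{\pi}$. A radial weight is a non-negative $\omega\in L^1([0,1))$ extended by $\omega(z)=\omega(|z|)$; always assume $\widehat\omega(r)=\int_r^1\omega(s)\,ds>0$ for all $0\le r<1$, and $\widehat\omega(z)=\widehat\omega(|z|)$. $\omega\in\widehat{\mathcal{D}}$ means there is $C\ge1$ with $\widehat\omega(r)\le C\widehat\omega(\frac{1+r}{2})$ for all $0\le r<1$. Moments: $\omega_x=\int_0^1 r^x\omega(r)\,dr$. For a radial weight $\nu$ and $0<q<\infty$, $D^q_\nu$ consists of $f\in\mathcal H(\mathbb D)$ with $\|f\|_{D^q_\nu}^q=\int_{\mathbb D}|f'|^q\nu\,dA+|f(0)|^q<\infty$; for $-1<\alpha<\infty$, $D^q_\alpha$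 denotes $D^q_\nu$ with $\nu(z)=(\alpha+1)(1-|z|^2)^\alpha$. For a function $\nu$ on $\mathbb D$ and $\beta\in\mathbb R$, $\nu_{[\beta]}(z)=\nu(z)(1-|z|)^\beta$; thus $\widehat\omega_{[x]}(z)=\widehat\omega(z)(1-|z|)^x$. For $g\in\mathcal H(\mathbb D)$, $T_g(f)(z)=\int_0^z f(\zeta)g'(\zeta)\,d\zeta$. $T(X,H^\infty)$ (resp. $T_c(X,H^\infty)$) is the set of $g\in\mathcal H(\mathbb D)$ such that $T_g:X\to H^\infty$ is bounded (resp. compact). *)

theory Defs
  imports "HOL-Complex_Analysis.Complex_Analysis"
begin

text \<open>Radial weights are given by their profile on [0,1); the weight on the disc is
  z \<mapsto> \<omega>(|z|).\<close>

definition omega_hat :: "(real \<Rightarrow> real) \<Rightarrow> real \<Rightarrow> real" where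
  "omega_hat \<omega> r = (LINT s:{r..<1}|lborel. \<omega> s)"

definition radial_weight :: "(real \<Rightarrow> real) \<Rightarrow> bool" where
  "radial_weight \<omega> \<longleftrightarrow>
     (\<forall>r\<in>{0..<1}. 0 \<le> \<omega> r) \<and> set_integrable lborel {0..<1} \<omega> \<and>
     (\<forall>r\<in>{0..<1}. 0 < omega_hat \<omega> r)"

definition D_hat :: "(real \<Rightarrow> real) \<Rightarrow> bool" where
  "D_hat \<omega> \<longleftrightarrow> (\<exists>C\<ge>1. \<forall>r\<in>{0..<1}. omega_hat \<omega> r \<le> C * omega_hat \<omega> ((1 + r) / 2))"

definition moment :: "(real \<Rightarrow> real) \<Rightarrow> real \<Rightarrow> real" where
  "moment \<omega> x = (LINT s:{0..<1}|lborel. s powr x * \<omega> s)"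

text \<open>The quantity ||f||^q of D^q_\<nu> (dA = dx dy / pi), with \<nu> a function on the disc.\<close>
definition D_normpow :: "real \<Rightarrow> (complex \<Rightarrow> real) \<Rightarrow> (complex \<Rightarrow> complex) \<Rightarrow> ennreal" where
  "D_normpow q \<nu> f =
     (\<integral>\<^sup>+ z. ennreal (norm (deriv f z) powr q * \<nu> z / pi) * indicator (ball 0 1) z \<partial>lborel)
     + ennreal (norm (f 0) powr q)"

definition in_D :: "real \<Rightarrow> (complex \<Rightarrow> real) \<Rightarrow> (complex \<Rightarrow> complex) \<Rightarrow> bool" where
  "in_D q \<nu> f \<longleftrightarrow> f holomorphic_on ball 0 1 \<and> D_normpow q \<nu> f < \<infinity>"

definition D_norm :: "real \<Rightarrow> (complex \<Rightarrow> real) \<Rightarrow> (complex \<Rightarrow> complex) \<Rightarrow> real" where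
  "D_norm q \<nu> f = enn2real (D_normpow q \<nu> f) powr (1 / q)"

definition std_weight :: "real \<Rightarrow> complex \<Rightarrow> real" where
  "std_weight \<alpha> z = (\<alpha> + 1) * (1 - norm z ^ 2) powr \<alpha>"

definition T_op :: "(complex \<Rightarrow> complex) \<Rightarrow> (complex \<Rightarrow> complex) \<Rightarrow> complex \<Rightarrow> complex" where
  "T_op g f z = contour_integral (linepath 0 z) (\<lambda>\<zeta>. f \<zeta> * deriv g \<zeta>)"

definition T_bounded_Hinf :: "real \<Rightarrow> (complex \<Rightarrow> real) \<Rightarrow> (complex \<Rightarrow> complex) \<Rightarrow> bool" where
  "T_bounded_Hinf q \<nu> g \<longleftrightarrow>
     (\<exists>C. \<forall>f. in_D q \<nu> f \<longrightarrow> (\<forall>z\<in>ball 0 1. norm (T_op g f z) \<le> C * D_norm q \<nu> f))"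

definition T_compact_Hinf :: "real \<Rightarrow> (complex \<Rightarrow> real) \<Rightarrow> (complex \<Rightarrow> complex) \<Rightarrow> bool" where
  "T_compact_Hinf q \<nu> g \<longleftrightarrow> T_bounded_Hinf q \<nu> g \<and>
     (\<forall>F::nat \<Rightarrow> complex \<Rightarrow> complex. (\<forall>n. in_D q \<nu> (F n) \<and> D_norm q \<nu> (F n) \<le> 1) \<longrightarrow>
        (\<exists>r h. strict_mono r \<and>
           uniform_limit (ball 0 1) (\<lambda>n. T_op g (F (r n))) h sequentially))"

definition T_set :: "real \<Rightarrow> (complex \<Rightarrow> real) \<Rightarrow> (complex \<Rightarrow> complex) set" where
  "T_set q \<nu> = {g. g holomorphic_on ball 0 1 \<and> T_bounded_Hinf q \<nu> g}"

definition Tc_set :: "real \<Rightarrow> (complex \<Rightarrow> real) \<Rightarrow> (complex \<Rightarrow> complex) set" where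
  "Tc_set q \<nu> = {g. g holomorphic_on ball 0 1 \<and> T_compact_Hinf q \<nu> g}"

definition const_on_disc :: "(complex \<Rightarrow> complex) set" where
  "const_on_disc = {g. g holomorphic_on ball 0 1 \<and> (\<exists>c. \<forall>z\<in>ball 0 1. g z = c)}"

definition id_bounded :: "real \<Rightarrow> (complex \<Rightarrow> real) \<Rightarrow> real \<Rightarrow> (complex \<Rightarrow> real) \<Rightarrow> bool" where
  "id_bounded q1 \<nu>1 q2 \<nu>2 \<longleftrightarrow>
     (\<exists>C. \<forall>f. in_D q1 \<nu>1 f \<longrightarrow> in_D q2 \<nu>2 f \<and> D_norm q2 \<nu>2 f \<le> C * D_norm q1 \<nu>1 f)"

end

theory Submission
  imports Defs
begin

text \<open>
  Write \<open>w n\<close> for the tail of \<open>\<omega>\<close> at \<open>1 - 2\<^sup>-\<^sup>n\<close> and \<open>t n = 2\<^bsup>-n(q+1)\<^esup> / (w n)\<^bsup>q-1\<^esup>\<close>, where \<open>q\<close> is the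
  conjugate exponent of \<open>p\<close>. All conditions are equivalent to the divergence of \<open>\<Sum> t n\<close>.
  For the integral and the moment series this is a dyadic decomposition.

  Embedding: if the sum converges, Hoelder's inequality gives boundedness. If it diverges, the
  lacunary polynomials \<open>\<Sum>n\<le>N. a n z\<^bsup>2^n\<^esup>\<close> whose coefficients give equality in Hoelder's inequality
  are almost constant on dyadic annuli, and boundedness would give
  \<open>S N \<lesssim> (S N)\<^bsup>1/p\<^esup>\<close> for the partial sums \<open>S N\<close> of \<open>\<Sum> t n\<close>. Since an exponent can be replaced by
  its multiples (apply the embedding to powers), the target exponent may be taken \<open>\<ge> 1\<close>.

  Volterra operators, divergent sum: averaging over rotations reduces a nonconstant symbol to a
  monomial, so that \<open>f \<mapsto> \<integral> f(s) s\<^sup>m ds\<close> would be bounded on the space; testing with sums of bumps at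
  the boundary point 1, one for each dyadic scale, contradicts this in the same way.

  Volterra operators, convergent sum: for the symbol \<open>z\<close> one has to bound \<open>\<integral> (1 - s) |f'(s)| ds\<close>.
  Cauchy's formula averaged against \<open>\<omega>\<close> bounds \<open>|f'(s)|\<close> by a Poisson-type average, and Young's
  inequality with off-diagonal decay yields \<open>\<eta> \<parallel>f\<parallel>\<^sup>p + \<eta>\<^bsup>1-q\<^esup> \<Sum> t n\<close>. The same bound for the tails
  of the sum gives compactness via Montel's theorem.
\<close>

subsection \<open>Rotations and radial integration in the plane\<close>

text \<open>Upper doubling gives no lower bound for \<open>\<omega>\<close> on a particular annulus,
  where it may vanish, so mean values over small discs do not bound a function by its norm; only
  whole tails of the weight are usable. Hence Cauchy's formula is averaged over all circles beyond a
  radius, and a point near the boundary then enters the estimates of all coarser scales. The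
  off-diagonal factor makes the total of these contributions finite: for each point
  \<open>offdiag\<close> is summable over the scales, while its power \<open>1 - q\<close>, which
  Young's inequality puts on the dual side, grows slowly enough for the kernel to absorb it.

  In both test constructions scale n contributes about \<open>t n\<close> to the norm integral and
  also to the quantity to be bounded; p > 1 then turns the resulting inequality into a bound for the
  partial sums. Upper doubling keeps the growth of the coefficients at most geometric, which the
  decay of each building block away from its own scale can beat. For the embedding it is enough that
  the test function is large in the mean on circles. The Volterra operator integrates along one
  radius, where the blocks must add up without cancellation; hence bumps at 1.\<close>

lemma lborel_eq_distr_Complex:
  "(lborel :: complex measure) = distr (lborel :: (real^2) measure) borel (\<lambda>v. Complex (v$1) (v$2))"
proof (rule lborel_eqI)
  have m: "(\<lambda>v::real^2. Complex (v$1) (v$2)) \<in> borel_measurable borel"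
    by (intro borel_measurable_continuous_onI) (simp add: Complex_eq continuous_intros)
  fix l u :: complex assume lu: "\<And>b. b \<in> Basis \<Longrightarrow> l \<bullet> b \<le> u \<bullet> b"
  have le: "Re l \<le> Re u" "Im l \<le> Im u"
    using lu[of 1] lu[of \<i>] by (auto simp: Basis_complex_def)
  define l' u' where "l' = (vector [Re l, Im l] :: real^2)" and "u' = (vector [Re u, Im u] :: real^2)"
  have pre: "(\<lambda>v::real^2. Complex (v$1) (v$2)) -` box l u = box l' u'"
    by (auto simp: l'_def u'_def mem_box_cart forall_2 in_box_complex_iff)
  have B2: "(Basis :: (real^2) set) = {axis 1 1, axis 2 1}"
    by (auto simp: Basis_vec_def UNIV_2)
  have "emeasure (distr (lborel :: (real^2) measure) borel (\<lambda>v. Complex (v$1) (v$2))) (box l u)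
      = emeasure lborel (box l' u')"
    using m by (subst emeasure_distr) (simp_all add: pre)
  also have "\<dots> = ennreal (\<Prod>b\<in>Basis. (u' - l') \<bullet> b)"
    using le by (subst emeasure_lborel_box) (auto simp: B2 l'_def u'_def inner_axis)
  also have "(\<Prod>b\<in>Basis. (u' - l') \<bullet> b) = (\<Prod>b\<in>Basis. (u - l) \<bullet> b)"
    by (simp add: B2 l'_def u'_def inner_axis Basis_complex_def axis_eq_axis)
  finally show "emeasure (distr (lborel :: (real^2) measure) borel (\<lambda>v. Complex (v$1) (v$2))) (box l u)
      = ennreal (\<Prod>b\<in>Basis. (u - l) \<bullet> b)" .
qed simp

text \<open>Orthogonal maps of the real plane preserve Lebesgue measure. Boxes are carried to
  \<open>real^2\<close> by \<open>V\<close>, where multiplication by a unimodular number becomes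
  such a map, and a measure is determined by its values on boxes.\<close>

lemma lborel_distr_rotation:
  fixes c :: complex
  assumes c: "norm c = 1"
  shows "distr lborel borel ((*) c) = lborel"
proof (rule lborel_eqI[symmetric])
  define V where "V = (\<lambda>v::real^2. Complex (v$1) (v$2))"
  \<comment> \<open>This is multiplication by \<open>cnj c\<close>, the inverse of \<open>c\<close>;
    the preimage of a box under multiplication by \<open>c\<close> thus becomes an image under
    \<open>R'\<close>, the form in which invariance is available.\<close>
  define R' where "R' = (\<lambda>v::real^2. (vector [Re (cnj c * V v), Im (cnj c * V v)] :: real^2))"
  have c1: "c * cnj c = 1"
    using c by (simp add: complex_norm_square[symmetric])
  have c2: "Re c * Re c + Im c * Im c = 1"
    using c cmod_power2[of c] by (simp add: power2_eq_square)
  have mV: "V \<in> borel_measurable borel"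
    unfolding V_def by (intro borel_measurable_continuous_onI) (simp add: Complex_eq continuous_intros)
  have VR: "V (R' v) = cnj c * V v" for v
    by (simp add: V_def R'_def complex_eq_iff)
  have lin: "linear R'"
    by (rule linearI) (auto simp: R'_def V_def vec_eq_iff forall_2 algebra_simps)
  have orth: "orthogonal_transformation R'"
    unfolding orthogonal_transformation_def
  proof (intro conjI allI lin)
    fix v w
    have "R' v \<bullet> R' w = (Re c * Re c + Im c * Im c) * (v \<bullet> w)"
      by (simp add: R'_def V_def inner_vec_def sum_2 algebra_simps)
    then show "R' v \<bullet> R' w = v \<bullet> w" by (simp add: c2)
  qed
  fix l u :: complex assume lu: "\<And>b. b \<in> Basis \<Longrightarrow> l \<bullet> b \<le> u \<bullet> b"
  define X where "X = V -` box l u"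
  have Vinj: "V v = V w \<Longrightarrow> v = w" for v w
    by (auto simp: V_def vec_eq_iff forall_2)
  have Vsurj: "\<exists>v. V v = z" for z
    by (rule exI[of _ "vector [Re z, Im z]"]) (simp add: V_def)
  have pre: "V -` ((*) c -` box l u) = R' ` X"
  proof (intro set_eqI iffI)
    fix v assume v: "v \<in> V -` ((*) c -` box l u)"
    obtain w where w: "V w = c * V v" using Vsurj by blast
    have "V (R' w) = V v"
      using c1 by (simp add: VR w mult.assoc[symmetric] mult.commute[of "cnj c"])
    then have "v = R' w" using Vinj by metis
    with w v show "v \<in> R' ` X" by (auto simp: X_def)
  next
    fix v assume "v \<in> R' ` X"
    then show "v \<in> V -` ((*) c -` box l u)"
      using c1 by (auto simp: X_def VR mult.assoc[symmetric])
  qed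
  have Xb: "X \<in> sets borel"
    using measurable_sets[OF mV, of "box l u"] by (simp add: X_def)
  have eX: "emeasure lborel X = emeasure lborel (box l u)"
  proof -
    have "emeasure lborel (box l u) = emeasure (distr (lborel :: (real^2) measure) borel V) (box l u)"
      unfolding V_def by (simp only: lborel_eq_distr_Complex[symmetric])
    then show ?thesis using mV by (simp add: emeasure_distr X_def)
  qed
  have fin: "emeasure lborel X < \<infinity>"
    using emeasure_lborel_box_finite[of l u] by (simp only: eX)
  have XL: "X \<in> lmeasurable"
    using Xb fin by (auto simp: fmeasurable_def)
  have mc: "(*) c \<in> borel_measurable lborel" by simp
  have preb: "(*) c -` box l u \<in> sets borel"
    using measurable_sets[OF mc, of "box l u"] by simp
  have Rb: "R' ` X \<in> sets borel"
    using measurable_sets[OF mV, of "(*) c -` box l u"] preb by (simp add: pre)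
  have "emeasure (distr lborel borel ((*) c)) (box l u) = emeasure lborel ((*) c -` box l u)"
    by (subst emeasure_distr) auto
  also have "\<dots> = emeasure lborel (R' ` X)"
  proof -
    have "emeasure lborel ((*) c -` box l u)
        = emeasure (distr (lborel :: (real^2) measure) borel V) ((*) c -` box l u)"
      unfolding V_def by (simp only: lborel_eq_distr_Complex[symmetric])
    then show ?thesis using mV preb by (simp add: emeasure_distr pre)
  qed
  also have "\<dots> = emeasure lebesgue (R' ` X)" using Rb by simp
  also have "\<dots> = ennreal (measure lebesgue (R' ` X))"
    using measurable_orthogonal_image[OF orth XL] by (simp add: emeasure_eq_measure2)
  also have "\<dots> = ennreal (measure lebesgue X)"
    by (simp add: measure_orthogonal_image[OF orth XL])
  also have "\<dots> = emeasure lebesgue X" using XL by (simp add: emeasure_eq_measure2)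
  also have "\<dots> = emeasure lborel (box l u)" using Xb eX by simp
  finally show "emeasure (distr lborel borel ((*) c)) (box l u) = ennreal (\<Prod>b\<in>Basis. (u - l) \<bullet> b)"
    using lu by simp
qed simp

lemma nn_integral_rotation:
  fixes c :: complex and f :: "complex \<Rightarrow> ennreal"
  assumes "norm c = 1" and [measurable]: "f \<in> borel_measurable borel"
  shows "(\<integral>\<^sup>+ z. f (c * z) \<partial>lborel) = (\<integral>\<^sup>+ z. f z \<partial>lborel)"
proof -
  have "(\<integral>\<^sup>+ z. f z \<partial>lborel) = (\<integral>\<^sup>+ z. f z \<partial>distr lborel borel ((*) c))"
    by (simp only: lborel_distr_rotation[OF assms(1)])
  also have "\<dots> = (\<integral>\<^sup>+ z. f (c * z) \<partial>lborel)"
    by (rule nn_integral_distr) auto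
  finally show ?thesis ..
qed

text \<open>Every rotation leaves the integral of \<open>R z * B z\<close> unchanged, hence so does
  the mean over all rotations after exchanging the integrals. This passes between bounds on circular
  means and area integrals against a radial weight.\<close>

lemma nn_integral_rotation_mean:
  fixes R :: "complex \<Rightarrow> ennreal" and B :: "complex \<Rightarrow> ennreal"
  assumes [measurable]: "R \<in> borel_measurable borel" "B \<in> borel_measurable borel"
    and rad: "\<And>c z. norm c = 1 \<Longrightarrow> R (c * z) = R z"
  shows "(\<integral>\<^sup>+ z. R z * B z \<partial>lborel) =
    (\<integral>\<^sup>+ z. R z * (\<integral>\<^sup>+ t. B (exp (2 * of_real pi * \<i> * of_real t) * z) * indicator {0..1} t \<partial>lborel) \<partial>lborel)"
proof -
  define e where "e = (\<lambda>t::real. exp (2 * complex_of_real pi * \<i> * of_real t))"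
  have [measurable]: "e \<in> borel_measurable borel"
    unfolding e_def by (intro borel_measurable_continuous_onI continuous_intros)
  have ne: "norm (e t) = 1" for t by (simp add: e_def norm_exp_eq_Re)
  have "(\<integral>\<^sup>+ z. R z * (\<integral>\<^sup>+ t. B (e t * z) * indicator {0..1} t \<partial>lborel) \<partial>lborel)
     = (\<integral>\<^sup>+ z. \<integral>\<^sup>+ t. R z * B (e t * z) * indicator {0..1} t \<partial>lborel \<partial>lborel)"
    by (simp add: nn_integral_cmult[symmetric] mult.assoc)
  also have "\<dots> = (\<integral>\<^sup>+ t. \<integral>\<^sup>+ z. R z * B (e t * z) * indicator {0..1} t \<partial>lborel \<partial>lborel)"
    by (rule lborel_pair.Fubini') measurable
  also have "\<dots> = (\<integral>\<^sup>+ t. (\<integral>\<^sup>+ z. R z * B z \<partial>lborel) * indicator {0..1} (t::real) \<partial>lborel)"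
  proof (rule nn_integral_cong)
    fix t :: real
    have "(\<integral>\<^sup>+ z. R z * B (e t * z) * indicator {0..1} t \<partial>lborel)
        = (\<integral>\<^sup>+ z. R (e t * z) * B (e t * z) \<partial>lborel) * indicator {0..1} t"
      by (simp add: nn_integral_multc rad[OF ne])
    also have "(\<integral>\<^sup>+ z. R (e t * z) * B (e t * z) \<partial>lborel) = (\<integral>\<^sup>+ z. R z * B z \<partial>lborel)"
      by (rule nn_integral_rotation[OF ne]) measurable
    finally show "(\<integral>\<^sup>+ z. R z * B (e t * z) * indicator {0..1} t \<partial>lborel)
        = (\<integral>\<^sup>+ z. R z * B z \<partial>lborel) * indicator {0..1} t" .
  qed
  also have "\<dots> = (\<integral>\<^sup>+ z. R z * B z \<partial>lborel)"
    by (simp add: nn_integral_cmult)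
  finally show ?thesis by (simp add: e_def)
qed

lemma emeasure_lborel_complex_annulus:
  assumes "0 \<le> a" "a \<le> b"
  shows "emeasure lborel {z::complex. a \<le> norm z \<and> norm z < b} = ennreal (pi * (b\<^sup>2 - a\<^sup>2))"
proof -
  have "{z::complex. a \<le> norm z \<and> norm z < b} = ball 0 b - ball 0 a" by auto
  moreover have "ball 0 a \<subseteq> ball (0::complex) b" using assms by auto
  ultimately show ?thesis using assms
    by (simp add: emeasure_Diff emeasure_ball unit_ball_vol_2 ennreal_minus right_diff_distrib)
qed

text \<open>Polar coordinates for radial functions without a change of variables: the image of area
  measure under the norm and the measure with density 2 pi r agree on every half-line
  \<open>{x<..}\<close>, by the area of an annulus, and finite values there determine a
  measure.\<close>

lemma nn_integral_radial:
  fixes f :: "real \<Rightarrow> ennreal"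
  assumes [measurable]: "f \<in> borel_measurable borel"
  shows "(\<integral>\<^sup>+ z. f (norm z) * indicator (ball 0 1) (z::complex) \<partial>lborel)
       = (\<integral>\<^sup>+ r. f r * ennreal (2 * pi * r) * indicator {0..<1} r \<partial>lborel)"
proof -
  define M where "M = distr (density lborel (indicator (ball (0::complex) 1))) borel norm"
  define N where "N = density lborel (\<lambda>r. ennreal (2 * pi * r) * indicator {0..<1::real} r)"
  have M: "emeasure M {x<..} = ennreal (if x < 0 then pi else if x < 1 then pi * (1 - x\<^sup>2) else 0)" for x
  proof -
    have "emeasure M {x<..} = emeasure lborel {z::complex. x < norm z \<and> norm z < 1}"
    proof -
      have "emeasure M {x<..} = emeasure (density lborel (indicator (ball (0::complex) 1))) {z. x < norm z}"
        unfolding M_def by (subst emeasure_distr) (auto simp: vimage_def)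
      also have "\<dots> = (\<integral>\<^sup>+ z. indicator {z::complex. x < norm z \<and> norm z < 1} z \<partial>lborel)"
      proof (subst emeasure_density)
        show "indicator (ball (0::complex) 1) \<in> borel_measurable lborel"
          by (intro borel_measurable_indicator) auto
        show "{z::complex. x < norm z} \<in> sets lborel" by simp
        show "(\<integral>\<^sup>+ z. indicator (ball 0 1) z * indicator {z::complex. x < norm z} z \<partial>lborel)
            = (\<integral>\<^sup>+ z. indicator {z::complex. x < norm z \<and> norm z < 1} z \<partial>lborel)"
          by (rule nn_integral_cong) (auto split: split_indicator)
      qed
      also have "\<dots> = emeasure lborel {z::complex. x < norm z \<and> norm z < 1}" by simp
      finally show ?thesis .
    qed
    also have "\<dots> = ennreal (if x < 0 then pi else if x < 1 then pi * (1 - x\<^sup>2) else 0)"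
    proof -
      consider "x < 0" | "0 \<le> x" "x < 1" | "1 \<le> x" by linarith
      then show ?thesis
      proof cases
        case 1
        have "{z::complex. x < norm z \<and> norm z < 1} = ball 0 1"
          using 1 norm_ge_zero less_le_trans by fastforce
        then show ?thesis using 1 by (simp add: emeasure_ball unit_ball_vol_2)
      next
        case 2
        have "{z::complex. x < norm z \<and> norm z < 1} = ball 0 1 - cball 0 x" by auto
        moreover have "cball 0 x \<subseteq> ball (0::complex) 1" using 2 by auto
        ultimately show ?thesis using 2
          by (simp add: emeasure_Diff emeasure_ball emeasure_cball unit_ball_vol_2 ennreal_minus right_diff_distrib)
      next
        case 3
        then have "{z::complex. x < norm z \<and> norm z < 1} = {}" by auto
        with 3 show ?thesis by (simp only:) simp
      qed
    qed
    finally show ?thesis .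
  qed
  have N: "emeasure N {x<..} = ennreal (if x < 0 then pi else if x < 1 then pi * (1 - x\<^sup>2) else 0)" for x
  proof -
    have I: "(\<integral>\<^sup>+ r. ennreal (2 * pi * r) * indicator {a..1} r \<partial>lborel) = ennreal (pi * (1 - a\<^sup>2))"
      if "0 \<le> a" "a \<le> 1" for a :: real
    proof -
      have "(\<integral>\<^sup>+ r. ennreal (2 * pi * r) * indicator {a..1} r \<partial>lborel) = ennreal (pi * 1\<^sup>2 - pi * a\<^sup>2)"
      proof (rule nn_integral_FTC_Icc[where F = "\<lambda>r. pi * r\<^sup>2"])
        show "((\<lambda>r. pi * r\<^sup>2) has_real_derivative 2 * pi * r) (at r)" if "r \<in> {a..1}" for r
          by (auto intro!: derivative_eq_intros)
        show "0 \<le> 2 * pi * r" if "r \<in> {a..1}" for r using that \<open>0 \<le> a\<close> by simp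
      qed (use that in auto)
      then show ?thesis by (simp add: right_diff_distrib)
    qed
    have "emeasure N {x<..} = (\<integral>\<^sup>+ r. ennreal (2 * pi * r) * indicator {0..<1} r * indicator {x<..} r \<partial>lborel)"
      unfolding N_def by (subst emeasure_density) auto
    \<comment> \<open>Clipping the endpoint treats all positions of \<open>x\<close> at once; the
      intervals differ only in the null points 1 and \<open>x\<close>.\<close>
    also have "\<dots> = (\<integral>\<^sup>+ r. ennreal (2 * pi * r) * indicator {min 1 (max 0 x)..1} r \<partial>lborel)"
      by (rule nn_integral_cong_AE, rule AE_mp[OF AE_lborel_singleton[of 1] AE_mp[OF AE_lborel_singleton[of x]]])
         (auto simp: indicator_def)
    also have "\<dots> = ennreal (pi * (1 - (min 1 (max 0 x))\<^sup>2))"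
      by (rule I) auto
    also have "\<dots> = ennreal (if x < 0 then pi else if x < 1 then pi * (1 - x\<^sup>2) else 0)"
      by (auto simp: min_def max_def)
    finally show ?thesis .
  qed
  have MN: "M = N"
  proof (rule measure_eqI_lessThan)
    show "sets M = sets borel" "sets N = sets borel" by (simp_all add: M_def N_def)
  qed (simp_all add: M N)
  have "(\<integral>\<^sup>+ z. f (norm z) * indicator (ball 0 1) (z::complex) \<partial>lborel) = (\<integral>\<^sup>+ r. f r \<partial>M)"
  proof -
    have [measurable]: "(indicator (ball (0::complex) 1) :: complex \<Rightarrow> ennreal) \<in> borel_measurable borel"
      by (intro borel_measurable_indicator) auto
    show ?thesis
      unfolding M_def by (subst nn_integral_distr) (simp_all add: nn_integral_density mult.commute)
  qed
  also have "\<dots> = (\<integral>\<^sup>+ r. f r * ennreal (2 * pi * r) * indicator {0..<1} r \<partial>lborel)"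
    unfolding MN N_def by (subst nn_integral_density) (auto intro!: nn_integral_cong simp: mult_ac)
  finally show ?thesis .
qed

lemma norm_integral_le_nn_integral:
  fixes k :: "real \<Rightarrow> complex"
  assumes "continuous_on {a..b} k"
  shows "ennreal (norm (integral {a..b} k)) \<le> (\<integral>\<^sup>+ t. ennreal (norm (k t)) * indicator {a..b} t \<partial>lborel)"
proof -
  have si: "set_integrable lborel {a..b} k"
    by (rule borel_integrable_atLeastAtMost'[OF assms])
  then have "integral {a..b} k = (LINT t:{a..b}|lborel. k t)"
    by (rule set_borel_integral_eq_integral(2)[symmetric])
  then have "ennreal (norm (integral {a..b} k)) = ennreal (norm (LINT t|lborel. indicator {a..b} t *\<^sub>R k t))"
    by (simp add: set_lebesgue_integral_def)
  also have "\<dots> \<le> (\<integral>\<^sup>+ t. ennreal (norm (indicator {a..b} t *\<^sub>R k t)) \<partial>lborel)"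
    by (rule integral_norm_bound_ennreal) (use si in \<open>simp add: set_integrable_def\<close>)
  also have "\<dots> = (\<integral>\<^sup>+ t. ennreal (norm (k t)) * indicator {a..b} t \<partial>lborel)"
    by (rule nn_integral_cong) (auto split: split_indicator)
  finally show ?thesis .
qed

lemma sets_norm_ge [measurable]: "{z::complex. r \<le> norm z} \<in> sets borel"
  by measurable

lemma sets_ball_complex [measurable]: "ball (c::complex) \<delta> \<in> sets borel"
  by simp

text \<open>Cauchy's formula at \<open>s\<close> on the circle through \<open>z\<close>,
  parametrized so that it starts at \<open>z\<close>. The integrand is then a function of the
  rotated point, the shape that \<open>nn_integral_rotation_mean\<close> needs. Substituting
  \<open>c * u\<close> moves the starting point to the positive axis, where
  \<open>circlepath\<close> starts.\<close>

lemma cauchy_rotation_mean: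
  fixes F :: "complex \<Rightarrow> complex"
  assumes F: "F holomorphic_on ball 0 1" and s: "norm s < norm z" and z: "norm z < 1"
  shows "ennreal (norm (F s)) \<le> (\<integral>\<^sup>+ t. ennreal (norm (F (exp (2 * of_real pi * \<i> * of_real t) * z)) * norm z
      / norm (exp (2 * of_real pi * \<i> * of_real t) * z - s)) * indicator {0..1} t \<partial>lborel)"
proof -
  define \<rho> where "\<rho> = norm z"
  define c where "c = z / of_real \<rho>"
  define e where "e = (\<lambda>t::real. exp (2 * complex_of_real pi * \<i> * of_real t))"
  have \<rho>: "0 < \<rho>" "\<rho> < 1" using s z norm_ge_zero[of s] unfolding \<rho>_def by linarith+
  have nc: "norm c = 1" using \<rho> by (simp add: c_def norm_divide \<rho>_def)
  then have c0: "c \<noteq> 0" by auto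
  have zc: "z = c * of_real \<rho>" using \<rho> by (simp add: c_def)
  define G where "G = (\<lambda>u. F (c * u))"
  have G: "G holomorphic_on ball 0 1"
    unfolding G_def
    by (rule holomorphic_on_compose_gen[of "\<lambda>u. c * u" _ F "ball 0 1", unfolded o_def])
       (use F nc in \<open>auto intro!: holomorphic_intros simp: norm_mult\<close>)
  have sub: "cball 0 \<rho> \<subseteq> ball (0::complex) 1" using \<rho> by auto
  have G1: "continuous_on (cball 0 \<rho>) G"
    by (rule continuous_on_subset[OF holomorphic_on_imp_continuous_on[OF G] sub])
  have G2: "G holomorphic_on ball 0 \<rho>"
    by (rule holomorphic_on_subset[OF G]) (use \<rho> in auto)
  define w where "w = s / c"
  have nw: "norm w < \<rho>" using s nc by (simp add: w_def norm_divide \<rho>_def)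
  have "((\<lambda>u. G u / (u - w)) has_contour_integral (2 * of_real pi * \<i> * G w)) (circlepath 0 \<rho>)"
    by (rule Cauchy_integral_circlepath[OF G1 G2]) (use nw in \<open>simp add: dist_norm\<close>)
  moreover define k where "k = (\<lambda>t. G (\<rho> * e t) / (\<rho> * e t - w) * (2 * of_real pi * \<i> * \<rho> * e t))"
  moreover have circ: "circlepath 0 \<rho> t = \<rho> * e t" for t by (simp add: circlepath e_def)
  ultimately have hi: "(k has_integral (2 * of_real pi * \<i> * G w)) {0..1}"
    unfolding has_contour_integral_def
    by (elim has_integral_eq[rotated]) (simp add: vector_derivative_circlepath01 circ k_def e_def)
  have Gw: "G w = F s" using c0 by (simp add: G_def w_def)
  have ne: "norm (e t) = 1" for t by (simp add: e_def norm_exp_eq_Re)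
  have ce: "continuous_on A e" for A unfolding e_def by (intro continuous_intros)
  have nz: "\<rho> * e t - w \<noteq> 0" for t
    using ne[of t] nw \<rho> by (metis eq_iff_diff_eq_0 norm_mult norm_of_real abs_of_pos mult.right_neutral less_irrefl)
  have ck: "continuous_on {0..1} k"
    unfolding k_def
    by (intro continuous_intros ce continuous_on_compose2[OF G1])
       (use nz ne \<rho> in \<open>auto simp: norm_mult\<close>)
  have "2 * pi * norm (F s) = norm (integral {0..1} k)"
    using integral_unique[OF hi] by (simp add: norm_mult Gw)
  then have "ennreal (2 * pi * norm (F s)) \<le> (\<integral>\<^sup>+ t. ennreal (norm (k t)) * indicator {0..1} t \<partial>lborel)"
    using norm_integral_le_nn_integral[OF ck] by simp
  also have "\<dots> = (\<integral>\<^sup>+ t. ennreal (2 * pi) * (ennreal (norm (F (e t * z)) * norm z / norm (e t * z - s)) * indicator {0..1} t) \<partial>lborel)"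
  proof (rule nn_integral_cong)
    fix t
    have "e t * z - s = c * (\<rho> * e t - w)" using c0 by (simp add: zc w_def algebra_simps)
    then have "norm (e t * z - s) = norm (\<rho> * e t - w)" by (simp add: norm_mult nc)
    moreover have "G (\<rho> * e t) = F (e t * z)" by (simp add: G_def zc mult_ac)
    ultimately have "norm (k t) = 2 * pi * (norm (F (e t * z)) * norm z / norm (e t * z - s))"
      by (simp add: k_def norm_mult norm_divide ne \<rho>_def)
    then have "ennreal (norm (k t)) = ennreal (2 * pi) * ennreal (norm (F (e t * z)) * norm z / norm (e t * z - s))"
      by (simp only: ennreal_mult'[symmetric] pi_ge_zero mult_nonneg_nonneg zero_le_numeral)
    then show "ennreal (norm (k t)) * indicator {0..1} t
       = ennreal (2 * pi) * (ennreal (norm (F (e t * z)) * norm z / norm (e t * z - s)) * indicator {0..1} t)"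
      by (simp only: mult.assoc)
  qed
  also have "\<dots> = ennreal (2 * pi) * (\<integral>\<^sup>+ t. ennreal (norm (F (e t * z)) * norm z / norm (e t * z - s)) * indicator {0..1} t \<partial>lborel)"
  proof (rule nn_integral_cmult)
    have "continuous_on {0..1} (\<lambda>t. norm (F (e t * z)) * norm z / norm (e t * z - s))"
    proof (intro continuous_intros ce continuous_on_compose2[OF holomorphic_on_imp_continuous_on[OF F]])
      show "(\<lambda>t. e t * z) ` {0..1} \<subseteq> ball 0 1" using z by (auto simp: norm_mult ne)
      show "\<forall>t\<in>{0..1}. norm (e t * z - s) \<noteq> 0"
        using s ne by (metis eq_iff_diff_eq_0 norm_eq_zero norm_mult mult.left_neutral less_irrefl)
    qed
    then have "(\<lambda>t. indicator {0..1} t *\<^sub>R (norm (F (e t * z)) * norm z / norm (e t * z - s))) \<in> borel_measurable borel"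
      by (intro borel_measurable_continuous_on_indicator) auto
    then have m: "(\<lambda>t. ennreal (indicator {0..1} t *\<^sub>R (norm (F (e t * z)) * norm z / norm (e t * z - s)))) \<in> borel_measurable borel"
      by measurable
    have eq: "(\<lambda>t. ennreal (indicator {0..1} t *\<^sub>R (norm (F (e t * z)) * norm z / norm (e t * z - s))))
      = (\<lambda>t. ennreal (norm (F (e t * z)) * norm z / norm (e t * z - s)) * indicator {0..1} t)"
      by (auto simp: fun_eq_iff split: split_indicator)
    show "(\<lambda>t. ennreal (norm (F (e t * z)) * norm z / norm (e t * z - s)) * indicator {0..1} t) \<in> borel_measurable lborel"
      using m unfolding eq by (simp only: measurable_lborel2)
  qed
  finally have "ennreal (2 * pi) * ennreal (norm (F s)) \<le> ennreal (2 * pi) *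
      (\<integral>\<^sup>+ t. ennreal (norm (F (e t * z)) * norm z / norm (e t * z - s)) * indicator {0..1} t \<partial>lborel)"
    by (simp only: ennreal_mult'[symmetric] pi_ge_zero mult_nonneg_nonneg zero_le_numeral)
  moreover have "ennreal (2 * pi) \<noteq> 0" "ennreal (2 * pi) \<noteq> top" by (auto simp: ennreal_eq_0_iff not_le)
  ultimately show ?thesis unfolding e_def using ennreal_mult_le_mult_iff by blast
qed

subsection \<open>Upper doubling weights\<close>

locale upper_doubling_weight =
  fixes \<omega> :: "real \<Rightarrow> real" and C :: real
  assumes weight: "radial_weight \<omega>" and C_ge_1: "1 \<le> C"
    and doubling: "\<And>r. 0 \<le> r \<Longrightarrow> r < 1 \<Longrightarrow> omega_hat \<omega> r \<le> C * omega_hat \<omega> ((1 + r) / 2)"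
begin

definition w :: "nat \<Rightarrow> real" where
  "w n = omega_hat \<omega> (1 - (1/2)^n)"

text \<open>Cut off at the unit circle because \<open>\<omega>\<close> is constrained, and known to
  be measurable, on [0,1) only; the cut-off also makes the values of \<open>deriv f\<close> outside
  the disc irrelevant.\<close>

definition W :: "complex \<Rightarrow> ennreal" where
  "W z = ennreal (\<omega> (norm z)) * indicator (ball 0 1) z"

lemma omega_nonneg: "0 \<le> r \<Longrightarrow> r < 1 \<Longrightarrow> 0 \<le> \<omega> r"
  using weight by (simp add: radial_weight_def)

lemma omega_hat_pos: "0 \<le> r \<Longrightarrow> r < 1 \<Longrightarrow> 0 < omega_hat \<omega> r"
  using weight by (simp add: radial_weight_def)

lemma omega_measurable [measurable]: "(\<lambda>r. indicator {0..<1} r * \<omega> r) \<in> borel_measurable borel"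
  using weight by (auto simp: radial_weight_def set_integrable_def dest: borel_measurable_integrable)

lemma omega_indicator_measurable:
  assumes "0 \<le> r"
  shows "(\<lambda>s. ennreal (\<omega> s) * indicator {r..<1} s) \<in> borel_measurable borel"
proof -
  have "(\<lambda>s. ennreal (indicator {0..<1} s * \<omega> s) * indicator {r..<1} s) \<in> borel_measurable borel"
    by measurable
  moreover have "(\<lambda>s. ennreal (indicator {0..<1} s * \<omega> s) * indicator {r..<1} s) = (\<lambda>s. ennreal (\<omega> s) * indicator {r..<1} s)"
    using assms by (auto simp: fun_eq_iff split: split_indicator)
  ultimately show ?thesis by simp
qed

lemma ennreal_omega_hat:
  assumes "0 \<le> r"
  shows "ennreal (omega_hat \<omega> r) = (\<integral>\<^sup>+ s. ennreal (\<omega> s) * indicator {r..<1} s \<partial>lborel)"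
proof -
  have "set_integrable lborel {r..<1} \<omega>"
    by (rule set_integrable_subset[of _ "{0..<1}"]) (use weight assms in \<open>auto simp: radial_weight_def\<close>)
  then have "(\<integral>\<^sup>+ s. ennreal (indicator {r..<1} s * \<omega> s) \<partial>lborel) = ennreal (\<integral> s. indicator {r..<1} s * \<omega> s \<partial>lborel)"
    by (intro nn_integral_eq_integral)
       (use assms omega_nonneg in \<open>auto simp: set_integrable_def split: split_indicator\<close>)
  moreover have "(\<lambda>s. ennreal (indicator {r..<1} s * \<omega> s)) = (\<lambda>s. ennreal (\<omega> s) * indicator {r..<1} s)"
    by (auto simp: fun_eq_iff split: split_indicator)
  ultimately show ?thesis by (simp add: omega_hat_def set_lebesgue_integral_def)
qed

lemma omega_hat_nonneg: "0 \<le> omega_hat \<omega> r" if "0 \<le> r"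
  using omega_hat_pos[of r] that
  by (cases "r < 1") (auto simp: omega_hat_def set_lebesgue_integral_def)

lemma omega_hat_antimono:
  assumes "0 \<le> r" "r \<le> s"
  shows "omega_hat \<omega> s \<le> omega_hat \<omega> r"
proof -
  have "ennreal (omega_hat \<omega> s) \<le> ennreal (omega_hat \<omega> r)"
    using assms by (subst (1 2) ennreal_omega_hat)
      (auto intro!: nn_integral_mono split: split_indicator)
  then show ?thesis using omega_hat_nonneg[of r] assms by (simp add: ennreal_le_iff)
qed

lemma w_pos: "0 < w n"
  unfolding w_def by (rule omega_hat_pos) (auto simp: power_le_one)

lemma w_antimono: "m \<le> n \<Longrightarrow> w n \<le> w m"
  unfolding w_def by (rule omega_hat_antimono) (auto simp: power_le_one power_decreasing)

lemma w_doubling: "w n \<le> C * w (Suc n)"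
  using doubling[of "1 - (1/2)^n"] by (simp add: w_def power_le_one field_simps)

lemma w_le_power: "w n \<le> C ^ i * w (n + i)"
proof (induction i)
  case (Suc i)
  have "C ^ i * w (n + i) \<le> C ^ i * (C * w (Suc (n + i)))"
    using C_ge_1 by (intro mult_left_mono w_doubling) auto
  with Suc show ?case by (simp add: mult_ac)
qed simp

lemma W_measurable [measurable]: "W \<in> borel_measurable borel"
proof -
  have "(\<lambda>z::complex. ennreal (indicator {0..<1} (norm z) * \<omega> (norm z))) \<in> borel_measurable borel"
    using measurable_compose[OF borel_measurable_norm omega_measurable] by measurable
  moreover have "W = (\<lambda>z::complex. ennreal (indicator {0..<1} (norm z) * \<omega> (norm z)))"
    by (auto simp: W_def fun_eq_iff split: split_indicator)
  ultimately show ?thesis by simp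
qed

lemma W_mult_powr_measurable:
  assumes "h holomorphic_on ball 0 1"
  shows "(\<lambda>z. W z * ennreal (norm (h z) powr a)) \<in> borel_measurable borel"
proof -
  have [measurable]: "(\<lambda>z. indicator (ball 0 1) z *\<^sub>R h z) \<in> borel_measurable borel"
    by (intro borel_measurable_continuous_on_indicator holomorphic_on_imp_continuous_on assms) auto
  have "(\<lambda>z. W z * ennreal (norm (indicator (ball 0 1) z *\<^sub>R h z) powr a)) \<in> borel_measurable borel"
    by measurable
  moreover have "(\<lambda>z. W z * ennreal (norm (indicator (ball 0 1) z *\<^sub>R h z) powr a)) = (\<lambda>z. W z * ennreal (norm (h z) powr a))"
    by (auto simp: fun_eq_iff W_def split: split_indicator)
  ultimately show ?thesis by simp
qed

lemma W_rotation: "norm c = 1 \<Longrightarrow> W (c * z) = W z"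
  by (simp add: W_def norm_mult indicator_def)

lemma W_annulus_eq:
  assumes "0 \<le> r"
  shows "(\<integral>\<^sup>+ z. W z * indicator {z. r \<le> norm z} z \<partial>lborel)
     = (\<integral>\<^sup>+ s. ennreal (\<omega> s) * ennreal (2 * pi * s) * indicator {r..<1} s \<partial>lborel)"
proof -
  define f where "f = (\<lambda>s. ennreal (indicator {0..<1} s * \<omega> s) * indicator {r..} s)"
  have [measurable]: "f \<in> borel_measurable borel" unfolding f_def by measurable
  have "(\<integral>\<^sup>+ z. W z * indicator {z. r \<le> norm z} z \<partial>lborel)
     = (\<integral>\<^sup>+ z. f (norm z) * indicator (ball 0 1) (z::complex) \<partial>lborel)"
    by (rule nn_integral_cong) (auto simp: f_def W_def split: split_indicator)
  also have "\<dots> = (\<integral>\<^sup>+ s. f s * ennreal (2 * pi * s) * indicator {0..<1} s \<partial>lborel)"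
    by (rule nn_integral_radial) measurable
  also have "\<dots> = (\<integral>\<^sup>+ s. ennreal (\<omega> s) * ennreal (2 * pi * s) * indicator {r..<1} s \<partial>lborel)"
    using assms by (intro nn_integral_cong) (auto simp: f_def split: split_indicator)
  finally show ?thesis .
qed

lemma W_annulus_le:
  assumes "0 \<le> r"
  shows "(\<integral>\<^sup>+ z. W z * indicator {z. r \<le> norm z} z \<partial>lborel) \<le> ennreal (2 * pi * omega_hat \<omega> r)"
proof -
  note [measurable] = omega_indicator_measurable[OF assms]
  have "(\<integral>\<^sup>+ z. W z * indicator {z. r \<le> norm z} z \<partial>lborel)
      \<le> (\<integral>\<^sup>+ s. ennreal (2 * pi) * (ennreal (\<omega> s) * indicator {r..<1} s) \<partial>lborel)"
    unfolding W_annulus_eq[OF assms]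
  proof (rule nn_integral_mono)
    fix s
    show "ennreal (\<omega> s) * ennreal (2 * pi * s) * indicator {r..<1} s \<le> ennreal (2 * pi) * (ennreal (\<omega> s) * indicator {r..<1} s)"
      using assms by (auto simp: mult.commute intro!: mult_left_mono ennreal_leI split: split_indicator)
  qed
  also have "\<dots> = ennreal (2 * pi) * ennreal (omega_hat \<omega> r)"
    by (subst nn_integral_cmult) (auto simp: ennreal_omega_hat[OF assms])
  finally show ?thesis by (simp add: ennreal_mult')
qed

lemma W_annulus_ge:
  assumes "1/2 \<le> r"
  shows "ennreal (pi * omega_hat \<omega> r) \<le> (\<integral>\<^sup>+ z. W z * indicator {z. r \<le> norm z} z \<partial>lborel)"
proof -
  have r0: "0 \<le> r" using assms by simp
  note [measurable] = omega_indicator_measurable[OF r0]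
  have "ennreal (pi * omega_hat \<omega> r) = ennreal pi * ennreal (omega_hat \<omega> r)" by (simp add: ennreal_mult')
  also have "\<dots> = (\<integral>\<^sup>+ s. ennreal pi * (ennreal (\<omega> s) * indicator {r..<1} s) \<partial>lborel)"
    by (subst nn_integral_cmult) (auto simp: ennreal_omega_hat[OF r0])
  also have "\<dots> \<le> (\<integral>\<^sup>+ z. W z * indicator {z. r \<le> norm z} z \<partial>lborel)"
    unfolding W_annulus_eq[OF r0]
  proof (rule nn_integral_mono)
    fix s
    have "pi \<le> 2 * pi * s" if "r \<le> s"
    proof -
      have "1 \<le> 2 * s" using that assms by linarith
      from mult_left_mono[OF this, of pi] show ?thesis by (simp add: mult_ac)
    qed
    then show "ennreal pi * (ennreal (\<omega> s) * indicator {r..<1} s) \<le> ennreal (\<omega> s) * ennreal (2 * pi * s) * indicator {r..<1} s"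
      by (auto simp: mult.commute[of "ennreal pi"] intro!: mult_left_mono ennreal_leI split: split_indicator)
  qed
  finally show ?thesis .
qed

text \<open>About \<open>1 / \<delta>\<close> rotated copies of \<open>ball 1 \<delta>\<close>, centred at the points of the circle
  with imaginary part \<open>2 k \<delta>\<close>, are disjoint and fit into the annulus.\<close>

lemma W_ball_le:
  assumes \<delta>: "0 < \<delta>" and r: "0 \<le> r"
  shows "(\<integral>\<^sup>+ z. W z * indicator (ball 1 \<delta>) z * indicator {z. r \<le> norm z} z \<partial>lborel)
    \<le> ennreal (4 * pi * \<delta> * omega_hat \<omega> r)"
proof -
  define I where "I = (\<integral>\<^sup>+ z. W z * indicator (ball 1 \<delta>) z * indicator {z. r \<le> norm z} z \<partial>lborel)"
  \<comment> \<open>The largest k with 2 k \<open>\<delta>\<close> <= 1, so that all centres lie on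
    the circle. It is 0 for \<open>\<delta>\<close> > 1/2, when one ball is simply compared with the
    whole annulus.\<close>
  define K where "K = nat \<lfloor>1 / (2 * \<delta>)\<rfloor>"
  define \<zeta> where "\<zeta> = (\<lambda>k::nat. Complex (sqrt (1 - (2 * k * \<delta>)\<^sup>2)) (2 * k * \<delta>))"
  have K: "2 * k * \<delta> \<le> 1" if "k \<le> K" for k :: nat
  proof -
    have "real k \<le> 1 / (2 * \<delta>)" using that \<delta> unfolding K_def by (simp add: le_nat_floor le_nat_iff le_floor_iff)
    then show ?thesis using \<delta> by (simp add: field_simps)
  qed
  have nz: "norm (\<zeta> k) = 1" if "k \<le> K" for k
    using K[OF that] \<delta> by (simp add: \<zeta>_def cmod_def power_le_one)
  have disj: "disjoint_family_on (\<lambda>k. ball (\<zeta> k) \<delta>) {..K}"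
    unfolding disjoint_family_on_def
  proof (intro ballI impI)
    fix k l :: nat assume "k \<noteq> l"
    then have "1 \<le> \<bar>real k - real l\<bar>" by linarith
    then have "2 * \<delta> \<le> 2 * \<delta> * \<bar>real k - real l\<bar>" using \<delta> by simp
    also have "\<dots> = \<bar>Im (\<zeta> k - \<zeta> l)\<bar>" using \<delta>
      by (simp add: \<zeta>_def abs_mult[symmetric] algebra_simps abs_if)
    also have "\<dots> \<le> norm (\<zeta> k - \<zeta> l)" by (rule abs_Im_le_cmod)
    finally have "2 * \<delta> \<le> dist (\<zeta> k) (\<zeta> l)" by (simp add: dist_norm)
    then show "ball (\<zeta> k) \<delta> \<inter> ball (\<zeta> l) \<delta> = {}" by (intro disjoint_ballI) simp
  qed
  have eq: "(\<integral>\<^sup>+ z. W z * indicator (ball (\<zeta> k) \<delta>) z * indicator {z. r \<le> norm z} z \<partial>lborel) = I" if "k \<le> K" for k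
  proof -
    have "norm (\<zeta> k - \<zeta> k * z) = norm (1 - z)" for z
    proof -
      have "\<zeta> k - \<zeta> k * z = \<zeta> k * (1 - z)" by (simp add: algebra_simps)
      then show ?thesis by (simp only: norm_mult nz[OF that] mult_1)
    qed
    then have "I = (\<integral>\<^sup>+ z. W (\<zeta> k * z) * indicator (ball (\<zeta> k) \<delta>) (\<zeta> k * z) * indicator {z. r \<le> norm z} (\<zeta> k * z) \<partial>lborel)"
      unfolding I_def
      by (intro nn_integral_cong) (simp add: W_rotation nz that indicator_def dist_norm norm_mult)
    also have "\<dots> = (\<integral>\<^sup>+ z. W z * indicator (ball (\<zeta> k) \<delta>) z * indicator {z. r \<le> norm z} z \<partial>lborel)"
      by (rule nn_integral_rotation[OF nz[OF that], of "\<lambda>z. W z * indicator (ball (\<zeta> k) \<delta>) z * indicator {z. r \<le> norm z} z"])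
         measurable
    finally show ?thesis ..
  qed
  have "of_nat (Suc K) * I = (\<Sum>k\<le>K. \<integral>\<^sup>+ z. W z * indicator (ball (\<zeta> k) \<delta>) z * indicator {z. r \<le> norm z} z \<partial>lborel)"
    by (simp add: eq)
  also have "\<dots> = (\<integral>\<^sup>+ z. (\<Sum>k\<le>K. W z * indicator (ball (\<zeta> k) \<delta>) z * indicator {z. r \<le> norm z} z) \<partial>lborel)"
    by (rule nn_integral_sum[symmetric]) measurable
  also have "\<dots> \<le> (\<integral>\<^sup>+ z. W z * indicator {z. r \<le> norm z} z \<partial>lborel)"
  proof (rule nn_integral_mono)
    fix z
    have "(\<Sum>k\<le>K. W z * indicator (ball (\<zeta> k) \<delta>) z * indicator {z. r \<le> norm z} z)
      = W z * indicator {z. r \<le> norm z} z * (\<Sum>k\<le>K. indicator (ball (\<zeta> k) \<delta>) z)"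
      by (simp only: sum_distrib_left mult_ac)
    also have "(\<Sum>k\<le>K. indicator (ball (\<zeta> k) \<delta>) z :: ennreal) = indicator (\<Union>k\<le>K. ball (\<zeta> k) \<delta>) z"
      by (rule indicator_UN_disjoint[symmetric, OF _ disj]) simp
    also have "W z * indicator {z. r \<le> norm z} z * indicator (\<Union>k\<le>K. ball (\<zeta> k) \<delta>) z \<le> W z * indicator {z. r \<le> norm z} z * 1"
      by (intro mult_left_mono) (auto split: split_indicator)
    finally show "(\<Sum>k\<le>K. W z * indicator (ball (\<zeta> k) \<delta>) z * indicator {z. r \<le> norm z} z) \<le> W z * indicator {z. r \<le> norm z} z"
      by simp
  qed
  also have "\<dots> \<le> ennreal (2 * pi * omega_hat \<omega> r)" by (rule W_annulus_le[OF r])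
  finally have *: "of_nat (Suc K) * I \<le> ennreal (2 * pi * omega_hat \<omega> r)" .
  have "1 / (2 * \<delta>) \<le> real (Suc K)" unfolding K_def by linarith
  then have "1 \<le> 2 * \<delta> * real (Suc K)" using \<delta> by (simp add: field_simps)
  then have "ennreal 1 \<le> ennreal (2 * \<delta>) * of_nat (Suc K)"
    using \<delta> by (subst ennreal_of_nat_eq_real_of_nat, subst ennreal_mult[symmetric]) (auto intro: ennreal_leI)
  then have "I \<le> ennreal (2 * \<delta>) * of_nat (Suc K) * I"
    by (metis ennreal_1 mult_right_mono mult_1 zero_le)
  also have "\<dots> \<le> ennreal (2 * \<delta>) * ennreal (2 * pi * omega_hat \<omega> r)"
    using mult_left_mono[OF *, of "ennreal (2 * \<delta>)"] by (simp add: mult.assoc)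
  also have "\<dots> = ennreal (4 * pi * \<delta> * omega_hat \<omega> r)"
    using \<delta> by (subst ennreal_mult'[symmetric]) (auto simp: mult_ac)
  finally show ?thesis by (simp add: I_def)
qed

text \<open>Cauchy's formula on every circle of radius \<open>\<rho> \<ge> r\<close>, averaged against the weight.\<close>

lemma norm_le_W_integral:
  assumes F: "F holomorphic_on ball 0 1" and s: "norm s < r" and r: "1/2 \<le> r"
  shows "ennreal (pi * omega_hat \<omega> r * norm (F s))
    \<le> (\<integral>\<^sup>+ z. W z * indicator {z. r \<le> norm z} z * ennreal (norm (F z) * norm z / norm (z - s)) \<partial>lborel)"
proof -
  define R where "R = (\<lambda>z. W z * indicator {z. r \<le> norm z} z)"
  define B where "B = (\<lambda>z. ennreal (norm (indicator (ball 0 1) z *\<^sub>R F z) * norm z / norm (z - s)))"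
  have [measurable]: "R \<in> borel_measurable borel" unfolding R_def by measurable
  have [measurable]: "(\<lambda>z. indicator (ball 0 1) z *\<^sub>R F z) \<in> borel_measurable borel"
    by (intro borel_measurable_continuous_on_indicator holomorphic_on_imp_continuous_on F) auto
  have [measurable]: "B \<in> borel_measurable borel" unfolding B_def by measurable
  have "ennreal (pi * omega_hat \<omega> r * norm (F s)) = ennreal (pi * omega_hat \<omega> r) * ennreal (norm (F s))"
    by (simp add: ennreal_mult'')
  also have "\<dots> \<le> (\<integral>\<^sup>+ z. R z \<partial>lborel) * ennreal (norm (F s))"
    unfolding R_def by (intro mult_right_mono W_annulus_ge r) auto
  also have "\<dots> = (\<integral>\<^sup>+ z. R z * ennreal (norm (F s)) \<partial>lborel)"
    by (simp add: nn_integral_multc)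
  also have "\<dots> \<le> (\<integral>\<^sup>+ z. R z * (\<integral>\<^sup>+ t. B (exp (2 * of_real pi * \<i> * of_real t) * z) * indicator {0..1} t \<partial>lborel) \<partial>lborel)"
    (is "(\<integral>\<^sup>+ z. ?f z \<partial>_) \<le> (\<integral>\<^sup>+ z. ?g z \<partial>_)")
  proof (rule nn_integral_mono)
    fix z
    show "?f z \<le> ?g z"
    proof (cases "r \<le> norm z \<and> norm z < 1")
      case True
      have "ennreal (norm (F s)) \<le> (\<integral>\<^sup>+ t. ennreal (norm (F (exp (2 * of_real pi * \<i> * of_real t) * z)) * norm z
      / norm (exp (2 * of_real pi * \<i> * of_real t) * z - s)) * indicator {0..1} t \<partial>lborel)"
        by (rule cauchy_rotation_mean[OF F]) (use s True in auto)
      also have "\<dots> = (\<integral>\<^sup>+ t. B (exp (2 * of_real pi * \<i> * of_real t) * z) * indicator {0..1} t \<partial>lborel)"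
        using True by (intro nn_integral_cong) (simp add: B_def norm_mult norm_exp_eq_Re)
      finally show ?thesis by (intro mult_left_mono) auto
    qed (auto simp: R_def W_def)
  qed
  also have "\<dots> = (\<integral>\<^sup>+ z. R z * B z \<partial>lborel)"
    by (rule nn_integral_rotation_mean[symmetric]) (auto simp: R_def W_rotation norm_mult indicator_def)
  also have "\<dots> = (\<integral>\<^sup>+ z. W z * indicator {z. r \<le> norm z} z * ennreal (norm (F z) * norm z / norm (z - s)) \<partial>lborel)"
    by (intro nn_integral_cong) (auto simp: R_def B_def W_def split: split_indicator)
  finally show ?thesis .
qed

end

subsection \<open>Dyadic form of the integral and moment conditions\<close>

lemma dyadic_block_exists:
  fixes \<delta> :: real
  assumes "0 < \<delta>" "\<delta> \<le> 1"
  obtains n where "(1/2)^Suc n < \<delta>" "\<delta> \<le> (1/2)^n"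
proof -
  define n where "n = (LEAST n. (1/2)^Suc n < \<delta>)"
  obtain m where m: "(1/2)^m < \<delta>" using real_arch_pow_inv[of \<delta> "1/2"] assms by auto
  have "(1/2)^Suc m < \<delta>" using m assms by (simp add: power_Suc)
  then have 1: "(1/2)^Suc n < \<delta>" unfolding n_def by (rule LeastI)
  have "\<delta> \<le> (1/2)^n"
  proof (cases n)
    case (Suc k)
    then show ?thesis using not_less_Least[of k "\<lambda>n. (1/2)^Suc n < \<delta>"] by (auto simp: n_def not_less)
  qed (use assms in simp)
  with 1 show ?thesis by (rule that)
qed

text \<open>Consecutive terms have ratio A exp(-c 2^l), at most 1/2 once c 2^l exceeds 2 A. It
  absorbs the geometric growth that iterated doubling produces.\<close>

lemma summable_power_mult_exp_neg:
  fixes A c :: real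
  assumes A: "0 < A" and c: "0 < c"
  shows "summable (\<lambda>l. A ^ l * exp (- (c * 2 ^ l)))"
proof -
  obtain N where N: "2 * A / c < 2 ^ N" using real_arch_pow[of 2 "2 * A / c"] by auto
  have "norm (A ^ Suc l * exp (- (c * 2 ^ Suc l))) \<le> 1/2 * norm (A ^ l * exp (- (c * 2 ^ l)))" if "N \<le> l" for l
  proof -
    have "2 * A / c < 2 ^ l" using N that
      by (meson less_le_trans one_le_numeral power_increasing)
    then have "2 * A < c * 2 ^ l" using c by (simp add: field_simps)
    also have "\<dots> \<le> exp (c * 2 ^ l)" using exp_ge_add_one_self[of "c * 2 ^ l"] by linarith
    finally have "A * exp (- (c * 2 ^ l)) \<le> 1/2" by (simp add: exp_minus field_simps)
    then have "(A ^ l * exp (- (c * 2 ^ l))) * (A * exp (- (c * 2 ^ l))) \<le> (A ^ l * exp (- (c * 2 ^ l))) * (1/2)"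
      using A by (intro mult_left_mono) auto
    moreover have "A ^ Suc l * exp (- (c * 2 ^ Suc l)) = (A ^ l * exp (- (c * 2 ^ l))) * (A * exp (- (c * 2 ^ l)))"
      by (simp add: exp_add[symmetric] mult_ac)
    ultimately show ?thesis using A by (simp add: abs_mult)
  qed
  then show ?thesis by (intro summable_ratio_test[of "1/2" N]) auto
qed

text \<open>The sequence starts at 1/4 and increases because (1 - x)^2 >= 1 - 2 x. It shows that a
  power of order 2^n is still not small at distance 2^-n from the boundary.\<close>

lemma one_minus_power_ge_quarter: "1/4 \<le> (1 - (1/2)^Suc n :: real) ^ (2 ^ Suc n)"
proof (induction n)
  case 0
  show ?case by (simp add: power2_eq_square)
next
  case (Suc n)
  define x :: real where "x = (1/2)^Suc (Suc n)"
  have x: "(1/2)^Suc n = 2 * x" "0 \<le> x" by (auto simp: x_def)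
  have "x \<le> 1/2"
  proof -
    have "(1/2::real)^Suc (Suc n) \<le> (1/2)^1" by (rule power_decreasing) auto
    then show ?thesis by (simp add: x_def)
  qed
  then have "(1 - 2 * x) ^ (2 ^ Suc n) \<le> ((1 - x)\<^sup>2) ^ (2 ^ Suc n)"
    by (intro power_mono) (auto simp: power2_eq_square algebra_simps)
  also have "\<dots> = (1 - x) ^ (2 ^ Suc (Suc n))"
    by (simp only: power_mult[symmetric] power_Suc mult.commute)
  finally show ?case using Suc unfolding x(1) x_def[symmetric] by linarith
qed

lemma disjoint_family_dyadic: "disjoint_family (\<lambda>n. {1 - (1/2)^n ..< 1 - (1/2)^Suc n :: real})"
proof -
  have "{1 - (1/2)^m ..< 1 - (1/2)^Suc m} \<inter> {1 - (1/2)^n ..< 1 - (1/2)^Suc n :: real} = {}" if "m < n" for m n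
  proof -
    have "(1/2)^n \<le> (1/2::real)^Suc m" using that by (intro power_decreasing) auto
    then show ?thesis by auto
  qed
  then show ?thesis unfolding disjoint_family_on_def
    by (metis Int_commute linorder_neqE_nat)
qed

lemma UN_dyadic: "(\<Union>n. {1 - (1/2)^n ..< 1 - (1/2)^Suc n}) = {0..<1::real}"
proof (intro set_eqI iffI)
  fix r :: real assume "r \<in> {0..<1}"
  then obtain n where "(1/2)^Suc n < 1 - r" "1 - r \<le> (1/2)^n"
    by (elim dyadic_block_exists[of "1 - r", rotated 2]) auto
  then have "r \<in> {1 - (1/2)^n ..< 1 - (1/2)^Suc n}" by auto
  then show "r \<in> (\<Union>n. {1 - (1/2)^n ..< 1 - (1/2)^Suc n})" by blast
next
  fix r :: real assume "r \<in> (\<Union>n. {1 - (1/2)^n ..< 1 - (1/2)^Suc n})"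
  then obtain n where n: "1 - (1/2)^n \<le> r" "r < 1 - (1/2)^Suc n" by auto
  have "(1/2::real)^n \<le> 1" "0 < (1/2::real)^Suc n" by (auto simp: power_le_one)
  then show "r \<in> {0..<1}" using n by auto
qed

lemma nn_integral_dyadic:
  assumes "(\<lambda>r. f r * indicator {0..<1::real} r) \<in> borel_measurable borel"
  shows "(\<integral>\<^sup>+ r. f r * indicator {0..<1} r \<partial>lborel)
     = (\<Sum>n. \<integral>\<^sup>+ r. f r * indicator {1 - (1/2)^n ..< 1 - (1/2)^Suc n} r \<partial>lborel)"
proof -
  have "(\<integral>\<^sup>+ r. f r * indicator {0..<1} r \<partial>lborel)
      = (\<integral>\<^sup>+ r. f r * indicator {0..<1} r * indicator (\<Union>n. {1 - (1/2)^n ..< 1 - (1/2)^Suc n}) r \<partial>lborel)"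
    unfolding UN_dyadic by (intro nn_integral_cong) (auto split: split_indicator)
  also have "\<dots> = (\<Sum>n. \<integral>\<^sup>+ r. f r * indicator {0..<1} r * indicator {1 - (1/2)^n ..< 1 - (1/2)^Suc n} r \<partial>lborel)"
    by (rule nn_integral_disjoint_family[OF _ _ disjoint_family_dyadic]) (use assms in auto)
  also have "\<dots> = (\<Sum>n. \<integral>\<^sup>+ r. f r * indicator {1 - (1/2)^n ..< 1 - (1/2)^Suc n} r \<partial>lborel)"
  proof (intro suminf_cong nn_integral_cong)
    fix n and r :: real
    have "r \<in> {1 - (1/2)^n ..< 1 - (1/2)^Suc n} \<Longrightarrow> r \<in> {0..<1}" using UN_dyadic by blast
    then show "f r * indicator {0..<1} r * indicator {1 - (1/2)^n ..< 1 - (1/2)^Suc n} r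
      = f r * indicator {1 - (1/2)^n ..< 1 - (1/2)^Suc n} r" by (simp add: indicator_def)
  qed
  finally show ?thesis .
qed

lemma suminf_ennreal_finite_iff:
  assumes "\<And>n. 0 \<le> f n"
  shows "(\<Sum>n. ennreal (f n)) = \<infinity> \<longleftrightarrow> \<not> summable f"
proof (cases "summable f")
  case True
  then show ?thesis using ennreal_suminf_neq_top[OF True assms] by simp
next
  case False
  then have "(\<Sum>n. ennreal (f n)) = top" using summable_suminf_not_top[of f] assms by metis
  with False show ?thesis by simp
qed

text \<open>Cauchy condensation with two-sided bounds on each block in place of monotonicity: block
  n has 2^n indices, which cancel the factor 2^-n.\<close>

lemma summable_dyadic_blocks_iff:
  fixes s t :: "nat \<Rightarrow> real"
  assumes s: "\<And>k. 0 \<le> s k" and t: "\<And>n. 0 \<le> t n" and a: "0 < a" and b: "0 < b"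
    and lower: "\<And>n k. 2 ^ n \<le> k + 1 \<Longrightarrow> k + 1 < 2 ^ Suc n \<Longrightarrow> a * ((1/2)^n * t n) \<le> s k"
    and upper: "\<And>n k. 2 ^ n \<le> k + 1 \<Longrightarrow> k + 1 < 2 ^ Suc n \<Longrightarrow> s k \<le> b * ((1/2)^n * t n)"
  shows "summable s \<longleftrightarrow> summable t"
proof -
  have split: "(\<Sum>k<2^N - 1. s k) = (\<Sum>n<N. \<Sum>k=2^n - 1..<2^Suc n - 1. s k)" for N
  proof (induction N)
    case (Suc N)
    have "(2::nat)^N - 1 \<le> 2^Suc N - 1" by (simp add: diff_le_mono)
    then have "(\<Sum>k<2^Suc N - 1. s k) = (\<Sum>k<2^N - 1. s k) + (\<Sum>k=2^N - 1..<2^Suc N - 1. s k)"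
      unfolding lessThan_atLeast0 by (intro sum.atLeastLessThan_concat[symmetric]) auto
    with Suc show ?case by simp
  qed simp
  have card: "real (card {2^n - 1..<2^Suc n - (1::nat)}) = 2^n" for n :: nat by simp
  have rng: "2 ^ n \<le> k + 1 \<and> k + 1 < 2 ^ Suc n" if "k \<in> {2^n - 1..<2^Suc n - (1::nat)}" for n k
    using that by auto
  have L: "a * t n \<le> (\<Sum>k=2^n - 1..<2^Suc n - 1. s k)" for n
  proof -
    have "real (card {2^n - 1..<2^Suc n - (1::nat)}) * (a * ((1/2)^n * t n)) \<le> (\<Sum>k=2^n - 1..<2^Suc n - 1. s k)"
      by (rule sum_bounded_below) (use rng lower in blast)
    then show ?thesis unfolding card by (simp add: power_divide)
  qed
  have U: "(\<Sum>k=2^n - 1..<2^Suc n - 1. s k) \<le> b * t n" for n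
  proof -
    have "(\<Sum>k=2^n - 1..<2^Suc n - 1. s k) \<le> real (card {2^n - 1..<2^Suc n - (1::nat)}) * (b * ((1/2)^n * t n))"
      by (rule sum_bounded_above) (use rng upper in blast)
    then show ?thesis unfolding card by (simp add: power_divide)
  qed
  show ?thesis
  proof
    assume S: "summable s"
    have "summable (\<lambda>n. a * t n)"
    proof (rule bounded_imp_summable)
      fix N
      have "(\<Sum>n\<le>N. a * t n) \<le> (\<Sum>n<Suc N. \<Sum>k=2^n - 1..<2^Suc n - 1. s k)"
        unfolding lessThan_Suc_atMost by (intro sum_mono L)
      also have "\<dots> = (\<Sum>k<2^Suc N - 1. s k)" by (rule split[symmetric])
      also have "\<dots> \<le> suminf s" by (rule sum_le_suminf[OF S]) (use s in auto)
      finally show "(\<Sum>n\<le>N. a * t n) \<le> suminf s" .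
    qed (use a t in simp)
    then show "summable t" using a by (simp add: summable_cmult_iff)
  next
    assume T: "summable t"
    show "summable s"
    proof (rule bounded_imp_summable)
      fix N
      have "N < 2 ^ N" by simp
      then have le: "N < 2 ^ Suc N - 1" unfolding power_Suc by linarith
      have "(\<Sum>k\<le>N. s k) \<le> (\<Sum>k<2^Suc N - 1. s k)"
        using s le by (intro sum_mono2) auto
      also have "\<dots> \<le> (\<Sum>n<Suc N. b * t n)" unfolding split by (intro sum_mono U)
      also have "\<dots> = b * (\<Sum>n<Suc N. t n)" by (simp only: sum_distrib_left)
      also have "\<dots> \<le> b * suminf t" using b t by (intro mult_left_mono sum_le_suminf[OF T]) auto
      finally show "(\<Sum>k\<le>N. s k) \<le> b * suminf t" .
    qed (rule s)
  qed
qed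

section \<open>Measurability of the tail function and dyadic size of the moments\<close>

context upper_doubling_weight
begin

text \<open>Monotone functions are Borel; \<open>max 0\<close> restricts to the half-line on which
  the tail is known to decrease.\<close>

lemma omega_hat_measurable: "(\<lambda>r. omega_hat \<omega> (max 0 r)) \<in> borel_measurable borel"
proof -
  have "(\<lambda>r. - omega_hat \<omega> (max 0 r)) \<in> borel_measurable borel"
    by (intro borel_measurable_mono monoI) (simp add: omega_hat_antimono)
  then have "(\<lambda>r. - (- omega_hat \<omega> (max 0 r))) \<in> borel_measurable borel" by measurable
  then show ?thesis by simp
qed

lemma omega_hat_norm_measurable [measurable]: "(\<lambda>z::complex. omega_hat \<omega> (norm z)) \<in> borel_measurable borel"
  using measurable_compose[OF borel_measurable_norm omega_hat_measurable] by simp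

lemma ennreal_moment:
  "ennreal (moment \<omega> (real k)) = (\<integral>\<^sup>+ s. ennreal (s ^ k * \<omega> s) * indicator {0..<1} s \<partial>lborel)"
proof -
  have m [measurable]: "(\<lambda>s. indicator {0..<1} s * \<omega> s) \<in> borel_measurable lborel" by simp
  have eq: "indicator {0..<1} s * (s powr real k * \<omega> s) = s powr real k * (indicator {0..<1} s * \<omega> s)" for s :: real
    by simp
  have si: "integrable lborel (\<lambda>s. indicator {0..<1} s * (s powr real k * \<omega> s))"
  proof (rule Bochner_Integration.integrable_bound)
    show "integrable lborel (\<lambda>s. indicator {0..<1} s * \<omega> s)"
      using weight by (simp add: radial_weight_def set_integrable_def)
    show "(\<lambda>s. indicator {0..<1} s * (s powr real k * \<omega> s)) \<in> borel_measurable lborel"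
      unfolding eq by measurable
    show "AE s in lborel. norm (indicator {0..<1} s * (s powr real k * \<omega> s)) \<le> norm (indicator {0..<1} s * \<omega> s)"
      by (intro AE_I2)
         (auto simp: abs_mult powr_le_one_le powr_le1 intro!: mult_left_le_one_le split: split_indicator)
  qed
  have "(\<integral>\<^sup>+ s. ennreal (indicator {0..<1} s * (s powr real k * \<omega> s)) \<partial>lborel) = ennreal (moment \<omega> (real k))"
    unfolding moment_def set_lebesgue_integral_def real_scaleR_def
    by (rule nn_integral_eq_integral[OF si])
       (auto intro!: AE_I2 simp: omega_nonneg split: split_indicator)
  \<comment> \<open>In HOL \<open>0 powr 0\<close> is 0 whereas \<open>0 ^ 0\<close> is 1, so for k
    = 0 the integrands differ at the single point 0.\<close>
  moreover have "(\<integral>\<^sup>+ s. ennreal (indicator {0..<1} s * (s powr real k * \<omega> s)) \<partial>lborel)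
     = (\<integral>\<^sup>+ s. ennreal (s ^ k * \<omega> s) * indicator {0..<1} s \<partial>lborel)"
    by (rule nn_integral_cong_AE, rule AE_mp[OF AE_lborel_singleton[of 0]])
       (auto intro!: AE_I2 simp: powr_realpow split: split_indicator)
  ultimately show ?thesis by simp
qed

text \<open>On the tail beyond 1 - 2^-(n+1) the factor s^k is still at least 1/4.\<close>

lemma moment_ge:
  assumes "k + 1 < 2 ^ Suc n"
  shows "w (Suc n) / 4 \<le> moment \<omega> (real k)"
proof -
  define r :: real where "r = 1 - (1/2)^Suc n"
  have r: "0 \<le> r" "r < 1" using power_le_one[of "1/2::real" "Suc n"] by (auto simp: r_def simp del: power_Suc)
  have "1/4 \<le> r ^ (2 ^ Suc n)" unfolding r_def by (rule one_minus_power_ge_quarter)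
  also have "\<dots> \<le> r ^ k" using assms r by (intro power_decreasing) auto
  finally have rk: "1/4 \<le> r ^ k" .
  have "ennreal (w (Suc n) / 4) = (\<integral>\<^sup>+ s. ennreal (1/4) * (ennreal (\<omega> s) * indicator {r..<1} s) \<partial>lborel)"
  proof -
    have "(\<lambda>s. ennreal (\<omega> s) * indicator {r..<1} s) \<in> borel_measurable lborel"
      using omega_indicator_measurable[OF r(1)] by simp
    then have "(\<integral>\<^sup>+ s. ennreal (1/4) * (ennreal (\<omega> s) * indicator {r..<1} s) \<partial>lborel) = ennreal (1/4) * ennreal (w (Suc n))"
      unfolding w_def r_def[symmetric] ennreal_omega_hat[OF r(1)] by (rule nn_integral_cmult)
    then show ?thesis using w_pos[of "Suc n"] by (simp add: ennreal_mult[symmetric] mult.commute del: ennreal_divide_numeral)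
  qed
  also have "\<dots> \<le> (\<integral>\<^sup>+ s. ennreal (s ^ k * \<omega> s) * indicator {0..<1} s \<partial>lborel)"
    (is "(\<integral>\<^sup>+ z. ?f z \<partial>_) \<le> (\<integral>\<^sup>+ z. ?g z \<partial>_)")
  proof (rule nn_integral_mono)
    fix s :: real
    show "?f s \<le> ?g s"
    proof (cases "r \<le> s \<and> s < 1")
      case True
      then have "1/4 \<le> s ^ k" using rk power_mono[of r s k] r by linarith
      then have "1/4 * \<omega> s \<le> s ^ k * \<omega> s" using True r omega_nonneg[of s] by (intro mult_right_mono) auto
      then show ?thesis using True r by (simp add: ennreal_mult'[symmetric] ennreal_leI del: ennreal_divide_numeral)
    qed auto
  qed
  also have "\<dots> = ennreal (moment \<omega> (real k))" by (rule ennreal_moment[symmetric])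
  finally have "ennreal (w (Suc n) / 4) \<le> ennreal (moment \<omega> (real k))" .
  then show ?thesis
    using w_pos[of "Suc n"] by (subst (asm) ennreal_le_iff2) auto
qed

text \<open>The tail beyond 1 - 2^-n contributes at most \<open>w n\<close>. On an earlier block i
  the factor s^k is at most a multiple of exp(-2^(n-i)/2), while doubling allows mass at most
  C^(n-i) \<open>w n\<close>; the exponential wins and the blocks sum to a multiple of
  \<open>w n\<close>.\<close>

lemma moment_le:
  obtains K where "0 < K" "\<And>n k. 2 ^ n \<le> k + 1 \<Longrightarrow> moment \<omega> (real k) \<le> K * w n"
proof -
  define E where "E = (\<Sum>l. C ^ l * exp (- (1/2 * 2 ^ l)))"
  have sE: "summable (\<lambda>l. C ^ l * exp (- (1/2 * 2 ^ l)))"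
    using C_ge_1 by (intro summable_power_mult_exp_neg) auto
  have E0: "0 \<le> E" unfolding E_def using C_ge_1 by (intro suminf_nonneg sE) auto
  have "moment \<omega> (real k) \<le> (1 + exp 1 * E) * w n" if kn: "2 ^ n \<le> k + 1" for n k
  proof -
    have key: "(1 - (1/2)^Suc i) ^ k * w i \<le> exp 1 * w n * (C ^ (n - i) * exp (- (1/2 * 2 ^ (n - i))))" if "i < n" for i
    proof -
      have "(1 - (1/2::real)^Suc i) ^ k \<le> exp (- ((1/2)^Suc i)) ^ k"
        using exp_ge_add_one_self[of "- ((1/2)^Suc i)"] power_le_one[of "1/2::real" "Suc i"]
        by (intro power_mono) (auto simp del: power_Suc)
      also have "\<dots> = exp (- (real k * (1/2)^Suc i))" by (simp add: exp_of_nat_mult[symmetric])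
      \<comment> \<open>The additional 1 in the exponent pays for having 2^n <= k + 1 instead of 2^n
        <= k.\<close>
      also have "\<dots> \<le> exp (1 - 1/2 * 2 ^ (n - i))"
      proof -
        have "real (2 ^ n) \<le> real (k + 1)" using kn by (simp only: of_nat_le_iff)
        then have "2 ^ n \<le> real k + 1" by simp
        then have "2 ^ n * (1/2)^Suc i \<le> (real k + 1) * (1/2)^Suc i" by (intro mult_right_mono) auto
        moreover have "2 ^ n * (1/2::real)^Suc i = 1/2 * 2 ^ (n - i)"
          using that by (simp add: power_divide power_diff)
        moreover have "(1/2::real)^Suc i \<le> 1" by (rule power_le_one) auto
        ultimately show ?thesis by (simp add: algebra_simps)
      qed
      also have "\<dots> = exp 1 * exp (- (1/2 * 2 ^ (n - i)))" by (simp add: exp_add[symmetric])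
      finally have "(1 - (1/2::real)^Suc i) ^ k \<le> exp 1 * exp (- (1/2 * 2 ^ (n - i)))" .
      moreover have "w i \<le> C ^ (n - i) * w n" using w_le_power[of i "n - i"] that by simp
      ultimately have "(1 - (1/2)^Suc i) ^ k * w i \<le> (exp 1 * exp (- (1/2 * 2 ^ (n - i)))) * (C ^ (n - i) * w n)"
        using w_pos[of i] by (intro mult_mono) auto
      then show ?thesis by (simp add: mult_ac)
    qed
    have meas: "(\<lambda>s. ennreal (\<omega> s) * indicator {1 - (1/2)^i..<1} s) \<in> borel_measurable lborel" for i :: nat
      using omega_indicator_measurable[of "1 - (1/2)^i"] by (simp add: power_le_one)
    have wi: "(\<integral>\<^sup>+ s. ennreal (\<omega> s) * indicator {1 - (1/2)^i..<1} s \<partial>lborel) = ennreal (w i)" for i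
      unfolding w_def by (rule ennreal_omega_hat[symmetric]) (simp add: power_le_one)
    have nn: "0 \<le> (1 - (1/2::real)^Suc i) ^ k" for i
      using power_le_one[of "1/2::real" "Suc i"] by (intro zero_le_power) (auto simp del: power_Suc)
    have nn2: "0 \<le> (\<Sum>i<n. (1 - (1/2)^Suc i) ^ k * w i)"
      using w_pos by (intro sum_nonneg mult_nonneg_nonneg nn) (auto simp: less_imp_le)
    \<comment> \<open>Block i is enlarged to the whole tail from its left end, whose mass is
      \<open>w i\<close>, while s^k is taken at the right end of the block.\<close>
    have "ennreal (moment \<omega> (real k)) \<le> (\<integral>\<^sup>+ s. ennreal (\<omega> s) * indicator {1 - (1/2)^n..<1} s
       + (\<Sum>i<n. ennreal ((1 - (1/2)^Suc i) ^ k) * (ennreal (\<omega> s) * indicator {1 - (1/2)^i..<1} s)) \<partial>lborel)"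
      unfolding ennreal_moment
    proof (rule nn_integral_mono)
      fix s :: real
      show "ennreal (s ^ k * \<omega> s) * indicator {0..<1} s \<le> ennreal (\<omega> s) * indicator {1 - (1/2)^n..<1} s
       + (\<Sum>i<n. ennreal ((1 - (1/2)^Suc i) ^ k) * (ennreal (\<omega> s) * indicator {1 - (1/2)^i..<1} s))"
      proof (cases "0 \<le> s \<and> s < 1")
        case s: True
        then have om: "0 \<le> \<omega> s" by (simp add: omega_nonneg)
        show ?thesis
        proof (cases "1 - (1/2)^n \<le> s")
          case True
          have "s ^ k * \<omega> s \<le> \<omega> s" using s om by (intro mult_left_le_one_le) (auto simp: power_le_one)
          then show ?thesis using s True by (simp add: add_increasing2 ennreal_leI)
        next
          case False
          obtain i where i: "(1/2)^Suc i < 1 - s" "1 - s \<le> (1/2)^i"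
            using dyadic_block_exists[of "1 - s"] s by auto
          have "i < n"
          proof (rule ccontr)
            assume "\<not> i < n"
            then have "(1/2::real)^i \<le> (1/2)^n" by (intro power_decreasing) auto
            then show False using i False by linarith
          qed
          have "s ^ k * \<omega> s \<le> (1 - (1/2)^Suc i) ^ k * \<omega> s"
            using i s om by (intro mult_right_mono power_mono) auto
          then have "ennreal (s ^ k * \<omega> s) \<le> ennreal ((1 - (1/2)^Suc i) ^ k) * (ennreal (\<omega> s) * indicator {1 - (1/2)^i..<1} s)"
            using i s by (simp add: ennreal_mult'[symmetric] ennreal_leI power_le_one)
          also have "\<dots> \<le> (\<Sum>i<n. ennreal ((1 - (1/2)^Suc i) ^ k) * (ennreal (\<omega> s) * indicator {1 - (1/2)^i..<1} s))"
            using \<open>i < n\<close> by (intro member_le_sum) auto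
          finally show ?thesis using s by (simp add: add_increasing)
        qed
      qed auto
    qed
    also have "\<dots> = ennreal (w n) + (\<Sum>i<n. ennreal ((1 - (1/2)^Suc i) ^ k) * ennreal (w i))"
      using meas by (subst nn_integral_add) (auto simp: nn_integral_sum nn_integral_cmult wi)
    also have "\<dots> = ennreal (w n + (\<Sum>i<n. (1 - (1/2)^Suc i) ^ k * w i))"
    proof -
      have "(\<Sum>i<n. ennreal ((1 - (1/2)^Suc i) ^ k) * ennreal (w i)) = (\<Sum>i<n. ennreal ((1 - (1/2)^Suc i) ^ k * w i))"
        using w_pos by (intro sum.cong refl ennreal_mult[symmetric] nn) (auto simp: less_imp_le)
      also have "\<dots> = ennreal (\<Sum>i<n. (1 - (1/2)^Suc i) ^ k * w i)"
        using w_pos by (intro sum_ennreal mult_nonneg_nonneg nn) (auto simp: less_imp_le)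
      finally show ?thesis
        using w_pos[of n] nn2 by (simp add: ennreal_plus del: power_Suc)
    qed
    finally have "moment \<omega> (real k) \<le> w n + (\<Sum>i<n. (1 - (1/2)^Suc i) ^ k * w i)"
      using w_pos[of n] nn2 by (subst (asm) ennreal_le_iff) (auto simp del: power_Suc)
    also have "(\<Sum>i<n. (1 - (1/2)^Suc i) ^ k * w i) \<le> (\<Sum>i<n. exp 1 * w n * (C ^ (n - i) * exp (- (1/2 * 2 ^ (n - i)))))"
      by (intro sum_mono key) auto
    also have "\<dots> = exp 1 * w n * (\<Sum>i<n. C ^ (n - i) * exp (- (1/2 * 2 ^ (n - i))))"
      by (simp only: sum_distrib_left)
    also have "(\<Sum>i<n. C ^ (n - i) * exp (- (1/2 * 2 ^ (n - i)))) = (\<Sum>l\<in>{1..n}. C ^ l * exp (- (1/2 * 2 ^ l)))"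
      by (rule sum.reindex_bij_witness[of _ "\<lambda>l. n - l" "\<lambda>i. n - i"]) auto
    also have "exp 1 * w n * \<dots> \<le> exp 1 * w n * E"
      unfolding E_def using C_ge_1 w_pos[of n] by (intro mult_left_mono sum_le_suminf sE) auto
    finally show ?thesis by (simp add: algebra_simps)
  qed
  then show ?thesis using E0 by (intro that[of "1 + exp 1 * E"]) (auto intro: add_pos_nonneg)
qed

end

locale upper_doubling_exponent = upper_doubling_weight +
  fixes p q :: real
  assumes p_gt_1: "1 < p" and q_eq: "q = p / (p - 1)"
begin

text \<open>The size of the contribution of block n to the integral condition: q powers of 2^-n from
  the factor (1 - r)^q and one from the length of the block.\<close>

definition t :: "nat \<Rightarrow> real" where
  "t n = ((1/2)^n) powr (q + 1) / w n powr (q - 1)"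

lemma q_gt_1: "1 < q"
  using p_gt_1 by (simp add: q_eq)

lemma q_minus_1: "q - 1 = 1 / (p - 1)"
  using p_gt_1 by (simp add: q_eq field_simps)

lemma q_div_p: "q / p = q - 1"
  using p_gt_1 by (simp add: q_eq field_simps)

lemma p_mult_q_minus_1: "p * (q - 1) = q"
  using p_gt_1 by (simp add: q_eq field_simps)

lemma conjugate: "1 / p + 1 / q = 1"
  using p_gt_1 by (simp add: q_eq field_simps)

lemma t_pos: "0 < t n"
  using w_pos[of n] by (simp add: t_def)

lemma w_Suc_powr: "a \<ge> 0 \<Longrightarrow> 1 / w (Suc n) powr a \<le> C powr a / w n powr a"
proof -
  assume a: "a \<ge> 0"
  have "w n powr a \<le> (C * w (Suc n)) powr a"
    using w_doubling[of n] w_pos[of n] a by (intro powr_mono2) auto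
  also have "\<dots> = C powr a * w (Suc n) powr a"
    using C_ge_1 w_pos[of "Suc n"] by (subst powr_mult) auto
  finally show ?thesis using w_pos[of n] w_pos[of "Suc n"] by (simp add: field_simps)
qed

text \<open>Numerator and tail are monotone, so on each block the integrand lies between values at
  the two ends; doubling exchanges \<open>w (Suc n)\<close> for \<open>w n\<close>.\<close>

lemma integral_condition_iff:
  "(\<integral>\<^sup>+ r. ennreal ((1 - r) powr q / omega_hat \<omega> r powr (q - 1)) * indicator {0..<1} r \<partial>lborel) = \<infinity> \<longleftrightarrow> \<not> summable t"
proof -
  define f where "f = (\<lambda>r. (1 - r) powr q / omega_hat \<omega> r powr (q - 1))"
  have meas: "(\<lambda>r. ennreal (f r) * indicator {0..<1} r) \<in> borel_measurable borel"
  proof -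
    have "(\<lambda>r. ennreal ((1 - r) powr q / omega_hat \<omega> (max 0 r) powr (q - 1)) * indicator {0..<1} r) \<in> borel_measurable borel"
      using omega_hat_measurable by measurable
    moreover have "(\<lambda>r. ennreal ((1 - r) powr q / omega_hat \<omega> (max 0 r) powr (q - 1)) * indicator {0..<1} r)
      = (\<lambda>r. ennreal (f r) * indicator {0..<1} r)"
      by (auto simp: fun_eq_iff f_def split: split_indicator)
    ultimately show ?thesis by simp
  qed
  define J where "J n = (\<integral>\<^sup>+ r. ennreal (f r) * indicator {1 - (1/2)^n ..< 1 - (1/2)^Suc n} r \<partial>lborel)" for n
  have I: "(\<integral>\<^sup>+ r. ennreal (f r) * indicator {0..<1} r \<partial>lborel) = (\<Sum>n. J n)"
    unfolding J_def by (rule nn_integral_dyadic[OF meas])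
  have len: "emeasure lborel {1 - (1/2)^n ..< 1 - (1/2::real)^Suc n} = ennreal ((1/2)^n / 2)" for n :: nat
    by (subst emeasure_lborel_Ico) (auto simp: algebra_simps)
  have tn: "t n = ((1/2)^n) powr q / w n powr (q - 1) * (1/2)^n" for n
    unfolding t_def by (subst powr_add) (simp add: powr_one)
  have U: "J n \<le> ennreal (C powr (q - 1) * t n)" for n
  proof -
    have "J n \<le> (\<integral>\<^sup>+ (r::real). ennreal (((1/2)^n) powr q / w (Suc n) powr (q - 1)) * indicator {1 - (1/2)^n ..< 1 - (1/2)^Suc n} r \<partial>lborel)"
      unfolding J_def
    proof (rule nn_integral_mono)
      fix r :: real
      have "f r \<le> ((1/2)^n) powr q / w (Suc n) powr (q - 1)" if r: "1 - (1/2)^n \<le> r" "r < 1 - (1/2)^Suc n"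
      proof -
        have r0: "0 \<le> r" "r < 1" using r power_le_one[of "1/2::real" n] zero_less_power[of "1/2::real" "Suc n"] by linarith+
        have "w (Suc n) \<le> omega_hat \<omega> r" unfolding w_def using r r0 by (intro omega_hat_antimono) auto
        then show ?thesis unfolding f_def using r r0 q_gt_1 w_pos[of "Suc n"]
          by (intro frac_le powr_mono2) auto
      qed
      then show "ennreal (f r) * indicator {1 - (1/2)^n ..< 1 - (1/2)^Suc n} r \<le>
        ennreal (((1/2)^n) powr q / w (Suc n) powr (q - 1)) * indicator {1 - (1/2)^n ..< 1 - (1/2)^Suc n} r"
        by (auto intro: ennreal_leI split: split_indicator)
    qed
    also have "\<dots> = ennreal (((1/2)^n) powr q * (1 / w (Suc n) powr (q - 1)) * ((1/2)^n / 2))"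
      by (subst nn_integral_cmult_indicator) (auto simp: len ennreal_mult'[symmetric])
    also have "\<dots> \<le> ennreal (((1/2)^n) powr q * (C powr (q - 1) / w n powr (q - 1)) * (1/2)^n)"
      using q_gt_1 by (intro ennreal_leI mult_mono mult_left_mono w_Suc_powr) auto
    also have "((1/2)^n) powr q * (C powr (q - 1) / w n powr (q - 1)) * (1/2)^n = C powr (q - 1) * t n"
      unfolding tn by simp
    finally show ?thesis .
  qed
  have L: "ennreal ((1/2) powr q / 2 * t n) \<le> J n" for n
  proof -
    have "ennreal ((1/2) powr q / 2 * t n) = ennreal (((1/2)^n / 2) powr q / w n powr (q - 1) * ((1/2)^n / 2))"
      by (simp add: tn powr_divide powr_mult)
    also have "\<dots> = (\<integral>\<^sup>+ (r::real). ennreal (((1/2)^n / 2) powr q / w n powr (q - 1)) * indicator {1 - (1/2)^n ..< 1 - (1/2)^Suc n} r \<partial>lborel)"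
      by (subst nn_integral_cmult_indicator) (auto simp: len ennreal_mult'[symmetric])
    also have "\<dots> \<le> J n"
      unfolding J_def
    proof (rule nn_integral_mono)
      fix r :: real
      have "((1/2)^n / 2) powr q / w n powr (q - 1) \<le> f r" if r: "1 - (1/2)^n \<le> r" "r < 1 - (1/2)^Suc n"
      proof -
        have r0: "0 \<le> r" "r < 1" using r power_le_one[of "1/2::real" n] zero_less_power[of "1/2::real" "Suc n"] by linarith+
        have "omega_hat \<omega> r \<le> w n" unfolding w_def using r r0 by (intro omega_hat_antimono) (auto simp: power_le_one)
        then show ?thesis unfolding f_def using r r0 q_gt_1 omega_hat_pos[of r]
          by (intro frac_le powr_mono2) auto
      qed
      then show "ennreal (((1/2)^n / 2) powr q / w n powr (q - 1)) * indicator {1 - (1/2)^n ..< 1 - (1/2)^Suc n} r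
         \<le> ennreal (f r) * indicator {1 - (1/2)^n ..< 1 - (1/2)^Suc n} r"
        by (auto intro: ennreal_leI split: split_indicator)
    qed
    finally show ?thesis .
  qed
  have "(\<Sum>n. J n) = \<infinity> \<longleftrightarrow> \<not> summable t"
  proof
    assume J: "(\<Sum>n. J n) = \<infinity>"
    have "(\<Sum>n. J n) \<le> (\<Sum>n. ennreal (C powr (q - 1) * t n))" by (intro suminf_le U) auto
    then have "(\<Sum>n. ennreal (C powr (q - 1) * t n)) = \<infinity>" using J by (simp add: top_unique)
    then have "\<not> summable (\<lambda>n. C powr (q - 1) * t n)"
      using t_pos by (subst (asm) suminf_ennreal_finite_iff) (auto simp: less_imp_le)
    then show "\<not> summable t" using C_ge_1 by (auto intro: summable_mult)
  next
    assume "\<not> summable t"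
    then have "\<not> summable (\<lambda>n. (1/2) powr q / 2 * t n)" by (simp add: summable_cmult_iff)
    then have "(\<Sum>n. ennreal ((1/2) powr q / 2 * t n)) = \<infinity>"
      using t_pos by (subst suminf_ennreal_finite_iff) (auto simp: less_imp_le)
    moreover have "(\<Sum>n. ennreal ((1/2) powr q / 2 * t n)) \<le> (\<Sum>n. J n)" by (intro suminf_le L) auto
    ultimately show "(\<Sum>n. J n) = \<infinity>" by (simp add: top_unique)
  qed
  then show ?thesis unfolding I[symmetric] f_def .
qed

text \<open>For 2^n <= k + 1 < 2^(n+1) the moment is comparable to \<open>w n\<close>, so the
  summand is comparable to 2^-n \<open>t n\<close>, and condensation applies.\<close>

lemma moment_condition_iff:
  "summable (\<lambda>k::nat. 1 / ((real k + 1) powr (2 + q) * moment \<omega> (real k) powr (q - 1))) \<longleftrightarrow> summable t"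
proof -
  obtain K where K: "0 < K" "\<And>n k. 2 ^ n \<le> k + 1 \<Longrightarrow> moment \<omega> (real k) \<le> K * w n"
    using moment_le by blast
  have tn: "(1/2)^n * t n = ((1/2)^n) powr (2 + q) / w n powr (q - 1)" for n
  proof -
    have "((1/2)^n) powr (2 + q) = ((1/2)^n) powr (1 + (q + 1) :: real)" by simp
    also have "\<dots> = (1/2)^n * ((1/2)^n) powr (q + 1)" by (subst powr_add) (simp add: powr_one)
    finally show ?thesis by (simp add: t_def)
  qed
  show ?thesis
  proof (rule summable_dyadic_blocks_iff)
    show "0 \<le> 1 / ((real k + 1) powr (2 + q) * moment \<omega> (real k) powr (q - 1))" for k by simp
    show "0 \<le> t n" for n using t_pos by (simp add: less_imp_le)
    show "0 < (1/2) powr (2 + q) / K powr (q - 1)" using K by simp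
    show "0 < (4 * C) powr (q - 1)" using C_ge_1 by simp
  next
    fix n k :: nat assume k: "2 ^ n \<le> k + 1" "k + 1 < 2 ^ Suc n"
    have m0: "0 < moment \<omega> (real k)" using moment_ge[OF k(2)] w_pos[of "Suc n"] by linarith
    have "real (k + 1) < real (2 ^ Suc n)" using k(2) by (simp only: of_nat_less_iff)
    then have "real k + 1 \<le> 2 * 2 ^ n" by simp
    then have a: "(real k + 1) powr (2 + q) \<le> (2 * 2 ^ n) powr (2 + q)" using q_gt_1 by (intro powr_mono2) auto
    have b: "moment \<omega> (real k) powr (q - 1) \<le> (K * w n) powr (q - 1)"
      using K(2)[OF k(1)] q_gt_1 m0 by (intro powr_mono2) auto
    have "1 / ((2 * 2 ^ n) powr (2 + q) * (K * w n) powr (q - 1))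
       \<le> 1 / ((real k + 1) powr (2 + q) * moment \<omega> (real k) powr (q - 1))"
      using a b m0 by (intro divide_left_mono mult_mono) (use K w_pos[of n] in auto)
    moreover have "1 / ((2 * 2 ^ n) powr (2 + q) * (K * w n) powr (q - 1))
       = (1/2) powr (2 + q) / K powr (q - 1) * ((1/2)^n * t n)"
      unfolding tn using K(1) w_pos[of n] by (simp add: powr_mult powr_divide power_divide)
    ultimately show "(1/2) powr (2 + q) / K powr (q - 1) * ((1/2)^n * t n)
       \<le> 1 / ((real k + 1) powr (2 + q) * moment \<omega> (real k) powr (q - 1))" by simp
  next
    fix n k :: nat assume k: "2 ^ n \<le> k + 1" "k + 1 < 2 ^ Suc n"
    have m0: "0 < moment \<omega> (real k)" using moment_ge[OF k(2)] w_pos[of "Suc n"] by linarith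
    have "real (2 ^ n) \<le> real (k + 1)" using k(1) by (simp only: of_nat_le_iff)
    then have "2 ^ n \<le> real k + 1" by simp
    then have a: "(2 ^ n) powr (2 + q) \<le> (real k + 1) powr (2 + q)" using q_gt_1 by (intro powr_mono2) auto
    have "w n / (4 * C) \<le> moment \<omega> (real k)"
    proof -
      have "C * w (Suc n) \<le> C * (4 * moment \<omega> (real k))"
        using moment_ge[OF k(2)] C_ge_1 by (intro mult_left_mono) auto
      then have "w n \<le> moment \<omega> (real k) * (4 * C)" using w_doubling[of n] by (simp add: mult_ac)
      then show ?thesis using C_ge_1 by (simp add: pos_divide_le_eq)
    qed
    then have b: "(w n / (4 * C)) powr (q - 1) \<le> moment \<omega> (real k) powr (q - 1)"
      using q_gt_1 w_pos[of n] C_ge_1 by (intro powr_mono2) auto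
    have "1 / ((real k + 1) powr (2 + q) * moment \<omega> (real k) powr (q - 1))
      \<le> 1 / ((2 ^ n) powr (2 + q) * (w n / (4 * C)) powr (q - 1))"
      using a b m0 by (intro divide_left_mono mult_mono) (use C_ge_1 w_pos[of n] in auto)
    also have "\<dots> = (4 * C) powr (q - 1) * ((1/2)^n * t n)"
      unfolding tn using w_pos[of n] C_ge_1 by (simp add: powr_mult powr_divide power_divide)
    finally show "1 / ((real k + 1) powr (2 + q) * moment \<omega> (real k) powr (q - 1)) \<le> (4 * C) powr (q - 1) * ((1/2)^n * t n)" .
  qed
qed

end

subsection \<open>The embedding between Dirichlet-type spaces\<close>

lemma D_integrand_measurable:
  assumes f: "f holomorphic_on ball 0 1"
    and [measurable]: "(\<lambda>z. \<nu> z * indicator (ball 0 1) z) \<in> borel_measurable borel"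
  shows "(\<lambda>z. ennreal (norm (deriv f z) powr s * \<nu> z / pi) * indicator (ball 0 1) z) \<in> borel_measurable borel"
proof -
  have [measurable]: "(\<lambda>z. indicator (ball 0 1) z *\<^sub>R deriv f z) \<in> borel_measurable borel"
    by (intro borel_measurable_continuous_on_indicator holomorphic_on_imp_continuous_on holomorphic_deriv f) auto
  have "(\<lambda>z. ennreal (norm (indicator (ball 0 1) z *\<^sub>R deriv f z) powr s * (\<nu> z * indicator (ball 0 1) z) / pi)) \<in> borel_measurable borel"
    by measurable
  moreover have "(\<lambda>z. ennreal (norm (indicator (ball 0 1) z *\<^sub>R deriv f z) powr s * (\<nu> z * indicator (ball 0 1) z) / pi))
     = (\<lambda>z. ennreal (norm (deriv f z) powr s * \<nu> z / pi) * indicator (ball 0 1) z)"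
    by (auto simp: fun_eq_iff split: split_indicator)
  ultimately show ?thesis by simp
qed

lemma D_normpow_cmult:
  assumes f: "f holomorphic_on ball 0 1"
    and m: "(\<lambda>z. \<nu> z * indicator (ball 0 1) z) \<in> borel_measurable borel"
  shows "D_normpow s \<nu> (\<lambda>z. c * f z) = ennreal (norm c powr s) * D_normpow s \<nu> f"
proof -
  have "(\<integral>\<^sup>+ z. ennreal (norm (deriv (\<lambda>z. c * f z) z) powr s * \<nu> z / pi) * indicator (ball 0 1) z \<partial>lborel)
      = (\<integral>\<^sup>+ z. ennreal (norm c powr s) * (ennreal (norm (deriv f z) powr s * \<nu> z / pi) * indicator (ball 0 1) z) \<partial>lborel)"
  proof (rule nn_integral_cong)
    fix z
    have "deriv (\<lambda>z. c * f z) z = c * deriv f z" if "z \<in> ball 0 1"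
      using that f by (intro deriv_cmult) (auto simp: holomorphic_on_imp_differentiable_at)
    then show "ennreal (norm (deriv (\<lambda>z. c * f z) z) powr s * \<nu> z / pi) * indicator (ball 0 1) z
       = ennreal (norm c powr s) * (ennreal (norm (deriv f z) powr s * \<nu> z / pi) * indicator (ball 0 1) z)"
      by (auto simp: norm_mult powr_mult ennreal_mult'[symmetric] mult.assoc split: split_indicator)
  qed
  also have "\<dots> = ennreal (norm c powr s) * (\<integral>\<^sup>+ z. ennreal (norm (deriv f z) powr s * \<nu> z / pi) * indicator (ball 0 1) z \<partial>lborel)"
    using D_integrand_measurable[OF f m] by (intro nn_integral_cmult) simp
  finally show ?thesis
    unfolding D_normpow_def by (simp add: norm_mult powr_mult ennreal_mult' distrib_left)
qed

lemma D_norm_cmult: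
  assumes "f holomorphic_on ball 0 1" "(\<lambda>z. \<nu> z * indicator (ball 0 1) z) \<in> borel_measurable borel" and s: "0 < s"
  shows "D_norm s \<nu> (\<lambda>z. c * f z) = norm c * D_norm s \<nu> f"
  unfolding D_norm_def D_normpow_cmult[OF assms(1,2)] using s
  by (simp add: enn2real_mult powr_mult powr_powr)

lemma D_norm_nonneg [simp]: "0 \<le> D_norm s \<nu> f"
  by (simp add: D_norm_def)

text \<open>Dividing by a number strictly above the norm rather than by the norm itself avoids a
  case distinction at norm 0; \<open>le_mult_if_le_mult_greater\<close> later lets \<open>l\<close>
  decrease to the norm.\<close>

lemma D_normpow_normalized_le_1:
  assumes s: "0 < s" and f: "in_D s \<nu> f" and m: "(\<lambda>z. \<nu> z * indicator (ball 0 1) z) \<in> borel_measurable borel"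
    and l: "D_norm s \<nu> f < l"
  shows "D_normpow s \<nu> (\<lambda>z. of_real (1 / l) * f z) \<le> 1"
proof -
  have fh: "f holomorphic_on ball 0 1" and fin: "D_normpow s \<nu> f < \<infinity>" using f by (auto simp: in_D_def)
  define a where "a = enn2real (D_normpow s \<nu> f)"
  have a: "D_normpow s \<nu> f = ennreal a" "0 \<le> a" using fin by (auto simp: a_def)
  have l0: "0 < l" using l D_norm_nonneg[of s \<nu> f] by linarith
  have "a = (a powr (1 / s)) powr s" using s a by (simp add: powr_powr)
  also have "\<dots> \<le> l powr s" using l s by (intro powr_mono2) (auto simp: D_norm_def a_def)
  finally have "(1 / l) powr s * a \<le> 1" using l0 by (simp add: powr_divide field_simps)
  then have "ennreal ((1 / l) powr s * a) \<le> ennreal 1" by (rule ennreal_leI)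
  then show ?thesis unfolding D_normpow_cmult[OF fh m] a(1) using l0
    by (simp add: ennreal_mult' norm_divide)
qed

lemma D_norm_le:
  assumes "0 < s" "D_normpow s \<nu> f \<le> ennreal K" "0 \<le> K"
  shows "D_norm s \<nu> f \<le> K powr (1 / s)"
proof -
  have "enn2real (D_normpow s \<nu> f) \<le> K"
    using enn2real_mono[OF assms(2)] assms(3) by simp
  then show ?thesis unfolding D_norm_def using assms(1) by (intro powr_mono2) auto
qed

lemma le_mult_if_le_mult_greater:
  fixes a b C :: real
  assumes "\<And>l. a < l \<Longrightarrow> b \<le> C * l"
  shows "b \<le> C * a"
proof (rule LIMSEQ_le_const)
  show "(\<lambda>n. C * (a + inverse (real (Suc n)))) \<longlonglongrightarrow> C * a"
    using tendsto_mult_left[OF tendsto_add[OF tendsto_const[of a] LIMSEQ_inverse_real_of_nat]] by simp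
  show "\<exists>N. \<forall>n\<ge>N. b \<le> C * (a + inverse (real (Suc n)))" using assms by simp
qed

text \<open>Only homogeneity enters, not the triangle inequality, so exponents below 1 are covered
  as well.\<close>

lemma id_bounded_if_unit_ball_bounded:
  assumes s: "0 < s1" "0 < s2"
    and m1: "(\<lambda>z. \<nu>1 z * indicator (ball 0 1) z) \<in> borel_measurable borel"
    and m2: "(\<lambda>z. \<nu>2 z * indicator (ball 0 1) z) \<in> borel_measurable borel"
    and K: "0 \<le> K" "\<And>f. f holomorphic_on ball 0 1 \<Longrightarrow> D_normpow s1 \<nu>1 f \<le> 1 \<Longrightarrow> D_normpow s2 \<nu>2 f \<le> ennreal K"
  shows "id_bounded s1 \<nu>1 s2 \<nu>2"
  unfolding id_bounded_def
proof (intro exI allI impI)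
  fix f assume f: "in_D s1 \<nu>1 f"
  have fh: "f holomorphic_on ball 0 1" using f by (simp add: in_D_def)
  have main: "in_D s2 \<nu>2 f \<and> D_norm s2 \<nu>2 f \<le> K powr (1 / s2) * l" if l: "D_norm s1 \<nu>1 f < l" for l
  proof -
    define g where "g = (\<lambda>z. of_real (1 / l) * f z)"
    have l0: "0 < l" using l D_norm_nonneg[of s1 \<nu>1 f] by linarith
    have gh: "g holomorphic_on ball 0 1" unfolding g_def by (intro holomorphic_intros fh)
    have g2: "D_normpow s2 \<nu>2 g \<le> ennreal K"
      using D_normpow_normalized_le_1[OF s(1) f m1 l] by (intro K(2) gh) (simp add: g_def)
    have fg: "f = (\<lambda>z. of_real l * g z)" using l0 by (simp add: g_def fun_eq_iff)
    have "D_normpow s2 \<nu>2 f = ennreal (l powr s2) * D_normpow s2 \<nu>2 g"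
      using D_normpow_cmult[OF gh m2, of s2 "of_real l"] fg l0 by simp
    also have "\<dots> \<le> ennreal (l powr s2) * ennreal K" by (intro mult_left_mono g2) auto
    also have "\<dots> < \<infinity>" by (simp add: ennreal_mult_less_top)
    finally have "in_D s2 \<nu>2 f" using fh by (simp add: in_D_def)
    moreover have "D_norm s2 \<nu>2 f = l * D_norm s2 \<nu>2 g"
      using D_norm_cmult[OF gh m2 s(2), of "of_real l"] fg l0 by simp
    moreover have "D_norm s2 \<nu>2 g \<le> K powr (1 / s2)" by (rule D_norm_le[OF s(2) g2 K(1)])
    ultimately show ?thesis using l0 by (simp add: mult.commute)
  qed
  show "in_D s2 \<nu>2 f \<and> D_norm s2 \<nu>2 f \<le> K powr (1 / s2) * D_norm s1 \<nu>1 f"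
    using main[of "D_norm s1 \<nu>1 f + 1"] main by (auto intro: le_mult_if_le_mult_greater)
qed

section \<open>Boundedness of the embedding when the sum converges\<close>

context upper_doubling_exponent
begin

text \<open>Young's inequality for a product a b in which a^p is the integrand of the source space
  and b^q that of the integral condition. The relation x = p (y - 1) is what makes the powers of 1 -
  r match: y - 1 from a and 1 from b.\<close>

lemma young_pointwise:
  fixes h r y P :: real
  assumes h: "0 \<le> h" and r: "0 \<le> r" "r < 1" and P: "0 < P"
  shows "h powr (P / p) * (1 - r) powr y
    \<le> h powr P * (omega_hat \<omega> r * (1 - r) powr (p * (y - 1))) + (1 - r) powr q / omega_hat \<omega> r powr (q - 1)"
proof -
  define W where "W = omega_hat \<omega> r"
  have W: "0 < W" unfolding W_def by (rule omega_hat_pos[OF r])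
  define a b where "a = h powr (P / p) * (1 - r) powr (y - 1) * W powr (1 / p)" and "b = (1 - r) * W powr (- 1 / p)"
  have "(1 - r) powr y = (1 - r) powr (y - 1) * (1 - r)"
    using r powr_add[of "1 - r" "y - 1" 1] by simp
  moreover have "W powr (1 / p) * W powr (- 1 / p) = 1" using W by (simp add: powr_add[symmetric])
  ultimately have ab: "h powr (P / p) * (1 - r) powr y = a * b" by (simp add: a_def b_def)
  have "a powr p = h powr P * (W * (1 - r) powr (p * (y - 1)))"
    using p_gt_1 W r by (simp add: a_def powr_mult powr_powr mult.commute)
  moreover have "b powr q = (1 - r) powr q / W powr (q - 1)"
    using W r p_gt_1 q_div_p by (simp add: b_def powr_mult powr_powr powr_minus_divide powr_divide)
  moreover have "a * b \<le> a powr p / p + b powr q / q"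
    by (rule Youngs_inequality[OF p_gt_1 q_gt_1 conjugate]) (use r in \<open>auto simp: a_def b_def\<close>)
  moreover have "a powr p / p \<le> a powr p" "b powr q / q \<le> b powr q"
    using p_gt_1 q_gt_1 by (auto simp: divide_le_eq mult_le_cancel_left1)
  ultimately show ?thesis unfolding ab W_def by linarith
qed

lemma id_bounded_if_summable:
  assumes S: "summable t" and y: "q < y" and P: "0 < P"
  shows "id_bounded P (\<lambda>z. omega_hat \<omega> (norm z) * (1 - norm z) powr (p * (y - 1))) (P / p) (std_weight y)"
proof -
  define I where "I = (\<integral>\<^sup>+ r. ennreal ((1 - r) powr q / omega_hat \<omega> r powr (q - 1)) * indicator {0..<1} r \<partial>lborel)"
  have I: "I < \<infinity>" using S integral_condition_iff unfolding I_def by (simp add: less_top)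
  define \<nu>1 where "\<nu>1 = (\<lambda>z::complex. omega_hat \<omega> (norm z) * (1 - norm z) powr (p * (y - 1)))"
  \<comment> \<open>The factor \<open>2 powr y\<close> comes from 1 - r^2 <= 2 (1 - r), and
    \<open>y + 1\<close> from the normalization of \<open>std_weight\<close>.\<close>
  define M where "M = (y + 1) * 2 powr y"
  define v where "v = (\<lambda>r. (1 - r) powr q / omega_hat \<omega> (max 0 r) powr (q - 1))"
  have [measurable]: "v \<in> borel_measurable borel"
    using omega_hat_measurable unfolding v_def by measurable
  have y1: "1 < y" using y q_gt_1 by simp
  have M: "0 < M" using y1 by (simp add: M_def)
  have m1: "(\<lambda>z. \<nu>1 z * indicator (ball 0 1) z) \<in> borel_measurable borel"
    unfolding \<nu>1_def by measurable
  have m2: "(\<lambda>z. std_weight y z * indicator (ball 0 1) z) \<in> borel_measurable borel"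
    unfolding std_weight_def by measurable
  define V where "V = (\<integral>\<^sup>+ z. ennreal (v (norm z)) * indicator (ball 0 1) (z::complex) \<partial>lborel)"
  have "V = (\<integral>\<^sup>+ r. ennreal (v r) * ennreal (2 * pi * r) * indicator {0..<1} r \<partial>lborel)"
    unfolding V_def by (rule nn_integral_radial) measurable
  also have "\<dots> \<le> (\<integral>\<^sup>+ r. ennreal (2 * pi) * (ennreal (v r) * indicator {0..<1} r) \<partial>lborel)"
    (is "(\<integral>\<^sup>+ z. ?f z \<partial>_) \<le> (\<integral>\<^sup>+ z. ?g z \<partial>_)")
  proof (rule nn_integral_mono)
    fix r :: real
    show "?f r \<le> ?g r"
      by (auto simp: mult.commute[of "ennreal (v r)"] intro!: mult_right_mono ennreal_leI split: split_indicator)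
  qed
  also have "\<dots> = ennreal (2 * pi) * (\<integral>\<^sup>+ r. ennreal (v r) * indicator {0..<1} r \<partial>lborel)"
    by (rule nn_integral_cmult) measurable
  also have "(\<integral>\<^sup>+ r. ennreal (v r) * indicator {0..<1} r \<partial>lborel) = I"
    unfolding I_def v_def by (intro nn_integral_cong) (auto split: split_indicator)
  finally have "V \<le> ennreal (2 * pi) * I" .
  also have "\<dots> < \<infinity>" using I by (simp add: ennreal_mult_less_top)
  finally have V: "V < \<infinity>" .
  \<comment> \<open>The final \<open>+ 1\<close> accounts for the value of the function at
    0.\<close>
  define K where "K = M * (1 + enn2real V) + 1"
  show ?thesis
    unfolding \<nu>1_def[symmetric]
  proof (rule id_bounded_if_unit_ball_bounded[OF P _ m1 m2, of _ K])
    show "0 < P / p" using P p_gt_1 by simp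
    show "0 \<le> K" using M by (simp add: K_def)
    fix f assume f: "f holomorphic_on ball 0 1" and N: "D_normpow P \<nu>1 f \<le> 1"
    define A where "A = (\<integral>\<^sup>+ z. ennreal (norm (deriv f z) powr P * \<nu>1 z / pi) * indicator (ball 0 1) z \<partial>lborel)"
    have N': "A + ennreal (norm (f 0) powr P) \<le> 1" using N by (simp only: D_normpow_def A_def)
    have A1: "A \<le> 1" by (rule order_trans[OF _ N']) simp
    have "ennreal (norm (f 0) powr P) \<le> 1" by (rule order_trans[OF _ N']) simp
    then have "norm (f 0) powr P \<le> 1" by (simp add: ennreal_le_1)
    then have "(norm (f 0) powr P) powr (1 / p) \<le> 1" using p_gt_1 by (intro powr_le1) auto
    then have f0: "norm (f 0) powr (P / p) \<le> 1" by (simp add: powr_powr)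
    have "(\<integral>\<^sup>+ z. ennreal (norm (deriv f z) powr (P / p) * std_weight y z / pi) * indicator (ball 0 1) z \<partial>lborel)
      \<le> (\<integral>\<^sup>+ z. ennreal M * (ennreal (norm (deriv f z) powr P * \<nu>1 z / pi) * indicator (ball 0 1) z
           + ennreal (v (norm z)) * indicator (ball 0 1) z) \<partial>lborel)"
    (is "(\<integral>\<^sup>+ z. ?f z \<partial>_) \<le> (\<integral>\<^sup>+ z. ?g z \<partial>_)")
    proof (rule nn_integral_mono)
      fix z :: complex
      show "?f z \<le> ?g z"
      proof (cases "norm z < 1")
        case True
        define h r where "h = norm (deriv f z)" and "r = norm z"
        have r: "0 \<le> r" "r < 1" using True by (auto simp: r_def)
        have "(1 - r\<^sup>2) powr y \<le> (2 * (1 - r)) powr y"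
        proof (rule powr_mono2)
          have "1 - r\<^sup>2 = (1 + r) * (1 - r)" by (simp add: power2_eq_square algebra_simps)
          also have "\<dots> \<le> 2 * (1 - r)" using r by (intro mult_right_mono) auto
          finally show "1 - r\<^sup>2 \<le> 2 * (1 - r)" .
          show "0 \<le> 1 - r\<^sup>2" using r by (simp add: power_le_one)
        qed (use y1 in simp)
        also have "\<dots> = 2 powr y * (1 - r) powr y" using r by (subst powr_mult) auto
        finally have "std_weight y z \<le> M * (1 - r) powr y"
          using y1 by (simp add: std_weight_def M_def r_def mult.assoc)
        then have "h powr (P / p) * std_weight y z \<le> h powr (P / p) * (M * (1 - r) powr y)"
          by (intro mult_left_mono) auto
        also have "\<dots> = M * (h powr (P / p) * (1 - r) powr y)" by simp
        also have "\<dots> \<le> M * (h powr P * \<nu>1 z + v r)"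
          using young_pointwise[of h r P y] r P M unfolding \<nu>1_def v_def r_def[symmetric]
          by (intro mult_left_mono) (auto simp: h_def)
        finally have "h powr (P / p) * std_weight y z / pi \<le> M * (h powr P * \<nu>1 z + v r) / pi"
          by (intro divide_right_mono) auto
        also have "\<dots> = M * (h powr P * \<nu>1 z / pi + v r / pi)" by (simp add: field_simps)
        also have "\<dots> \<le> M * (h powr P * \<nu>1 z / pi + v r)"
        proof -
          have "0 \<le> v r" by (simp add: v_def)
          then have "v r / pi \<le> v r" using pi_gt3 by (simp add: divide_le_eq mult_le_cancel_left1)
          then show ?thesis using M by simp
        qed
        finally have "ennreal (h powr (P / p) * std_weight y z / pi) \<le> ennreal (M * (h powr P * \<nu>1 z / pi + v r))"
          by (rule ennreal_leI)
        also have "\<dots> = ennreal M * (ennreal (h powr P * \<nu>1 z / pi) + ennreal (v r))"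
        proof -
          have "0 \<le> h powr P * \<nu>1 z / pi" "0 \<le> v r"
            using r omega_hat_nonneg[of r] by (auto simp: \<nu>1_def v_def r_def)
          then show ?thesis using M by (simp add: ennreal_mult' ennreal_plus)
        qed
        finally show ?thesis using True by (simp add: h_def r_def)
      qed auto
    qed
    also have "\<dots> = ennreal M * (A + V)"
      unfolding A_def V_def using D_integrand_measurable[OF f m1, of P]
      by (subst nn_integral_cmult) (auto simp: nn_integral_add)
    also have "\<dots> \<le> ennreal M * (1 + ennreal (enn2real V))"
      using A1 V by (intro mult_left_mono add_mono) auto
    also have "\<dots> = ennreal (M * (1 + enn2real V))"
      using M by (simp add: ennreal_mult' ennreal_plus)
    finally have "D_normpow (P / p) (std_weight y) f \<le> ennreal (M * (1 + enn2real V)) + ennreal 1"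
      unfolding D_normpow_def by (intro add_mono ennreal_leI f0)
    also have "\<dots> = ennreal K" using M by (simp add: K_def ennreal_plus)
    finally show "D_normpow (P / p) (std_weight y) f \<le> ennreal K" .
  qed
qed

end

text \<open>Terms decaying with the distance of n from j, possibly at different rates on the two
  sides, have a sum bounded independently of j. It is the last step whenever one dyadic scale
  dominates a sum over all scales.\<close>

lemma sum_two_sided_le_suminf:
  fixes G1 G2 :: "nat \<Rightarrow> real"
  assumes fin: "finite A" and s1: "summable G1" and s2: "summable G2" and nn: "\<And>i. 0 \<le> G1 i" "\<And>i. 0 \<le> G2 i"
  shows "(\<Sum>n\<in>A. if n \<le> j then G1 (j - n) else G2 (n - j)) \<le> suminf G1 + suminf G2"
proof -
  have "(\<Sum>n\<in>A. if n \<le> j then G1 (j - n) else G2 (n - j))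
      = (\<Sum>n\<in>A \<inter> {..j}. G1 (j - n)) + (\<Sum>n\<in>A - {..j}. G2 (n - j))"
    using fin by (subst sum.If_cases) (auto intro!: arg_cong2[of _ _ _ _ "(+)"] sum.cong)
  also have "(\<Sum>n\<in>A \<inter> {..j}. G1 (j - n)) = sum G1 ((\<lambda>n. j - n) ` (A \<inter> {..j}))"
    by (subst sum.reindex) (auto simp: inj_on_def)
  also have "\<dots> \<le> suminf G1" using fin nn by (intro sum_le_suminf s1) auto
  also have "(\<Sum>n\<in>A - {..j}. G2 (n - j)) = sum G2 ((\<lambda>n. n - j) ` (A - {..j}))"
    by (subst sum.reindex) (auto simp: inj_on_def)
  also have "\<dots> \<le> suminf G2" using fin nn by (intro sum_le_suminf s2) auto
  finally show ?thesis by simp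
qed

lemma integral_exp_2pi_int:
  fixes j :: int
  assumes "j \<noteq> 0"
  shows "((\<lambda>x. exp (2 * of_real pi * \<i> * of_int j * of_real x)) has_integral 0) {0..1::real}"
proof -
  define c where "c = 2 * complex_of_real pi * \<i> * of_int j"
  have c: "c \<noteq> 0" using assms by (simp add: c_def)
  have "((\<lambda>x. exp (c * of_real x)) has_integral (exp (c * of_real 1) / c - exp (c * of_real 0) / c)) {0..1::real}"
  proof (rule fundamental_theorem_of_calculus)
    fix x :: real assume "x \<in> {0..1}"
    have "((\<lambda>z. exp (c * z) / c) has_field_derivative exp (c * of_real x)) (at (of_real x))"
      using c by (auto intro!: derivative_eq_intros)
    then show "((\<lambda>x. exp (c * of_real x) / c) has_vector_derivative exp (c * of_real x)) (at x within {0..1})"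
      using has_vector_derivative_real_field has_vector_derivative_at_within by blast
  qed simp
  moreover have "exp c = 1"
    using exp_integer_2pi[of "of_int j"] by (simp add: c_def mult_ac)
  ultimately show ?thesis by (simp add: c_def)
qed

text \<open>Integration against the conjugate character of frequency \<open>l m\<close> isolates one
  term, so a coefficient is at most the mean modulus on the circle.\<close>

lemma coefficient_rotation_mean:
  fixes c :: "nat \<Rightarrow> complex" and l :: "nat \<Rightarrow> nat" and z :: complex
  assumes fin: "finite A" and inj: "inj_on l A" and m: "m \<in> A"
  shows "ennreal (norm (c m) * norm z ^ l m) \<le> (\<integral>\<^sup>+ x. ennreal (norm (\<Sum>n\<in>A. c n * (exp (2 * of_real pi * \<i> * of_real x) * z) ^ l n))
    * indicator {0..1} x \<partial>lborel)"
proof -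
  define H where "H = (\<lambda>u::complex. \<Sum>n\<in>A. c n * u ^ l n)"
  define k where "k = (\<lambda>x. H (exp (2 * of_real pi * \<i> * of_real x) * z) * exp (- (2 * of_real pi * \<i> * of_nat (l m) * of_real x)))"
  have hi: "((\<lambda>x. \<Sum>n\<in>A. c n * z ^ l n * exp (2 * of_real pi * \<i> * of_int (int (l n) - int (l m)) * of_real x)) has_integral
      (\<Sum>n\<in>A. if n = m then c m * z ^ l m else 0)) {0..1::real}"
  proof (rule has_integral_sum[OF fin])
    fix n assume n: "n \<in> A"
    show "((\<lambda>x. c n * z ^ l n * exp (2 * of_real pi * \<i> * of_int (int (l n) - int (l m)) * of_real x)) has_integral
        (if n = m then c m * z ^ l m else 0)) {0..1::real}"
    proof (cases "n = m")
      case True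
      then show ?thesis using has_integral_const_real[of "c m * z ^ l m" 0 1] by simp
    next
      case False
      then have "int (l n) - int (l m) \<noteq> 0" using inj n m by (auto dest: inj_onD)
      from has_integral_mult_right[OF integral_exp_2pi_int[OF this], of "c n * z ^ l n"] False
      show ?thesis by simp
    qed
  qed
  moreover have keq: "k x = (\<Sum>n\<in>A. c n * z ^ l n * exp (2 * of_real pi * \<i> * of_int (int (l n) - int (l m)) * of_real x))" for x
  proof -
    have "k x = (\<Sum>n\<in>A. c n * z ^ l n * (exp (2 * of_real pi * \<i> * of_real x) ^ l n * exp (- (2 * of_real pi * \<i> * of_nat (l m) * of_real x))))"
      unfolding k_def H_def sum_distrib_right by (intro sum.cong refl) (simp add: power_mult_distrib mult_ac)
    also have "\<dots> = (\<Sum>n\<in>A. c n * z ^ l n * exp (2 * of_real pi * \<i> * of_int (int (l n) - int (l m)) * of_real x))"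
      by (intro sum.cong refl) (simp add: exp_of_nat_mult[symmetric] exp_add[symmetric] exp_diff[symmetric] algebra_simps)
    finally show ?thesis .
  qed
  ultimately have "integral {0..1} k = c m * z ^ l m"
    using fin m by (subst (asm) keq[symmetric]) (simp add: sum.delta integral_unique)
  moreover have "continuous_on {0..1} k" unfolding k_def H_def by (intro continuous_intros)
  ultimately have "ennreal (norm (c m * z ^ l m)) \<le> (\<integral>\<^sup>+ x. ennreal (norm (k x)) * indicator {0..1} x \<partial>lborel)"
    using norm_integral_le_nn_integral[of 0 1 k] by simp
  also have "\<dots> = (\<integral>\<^sup>+ x. ennreal (norm (H (exp (2 * of_real pi * \<i> * of_real x) * z))) * indicator {0..1} x \<partial>lborel)"
    by (intro nn_integral_cong) (simp add: k_def norm_mult norm_exp_eq_Re)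
  finally show ?thesis by (simp add: H_def norm_mult norm_power)
qed

text \<open>Jensen's inequality on the unit interval, obtained by integrating Young's inequality
  with the constant \<open>c\<close> as second factor. It lifts the first-power mean from
  \<open>coefficient_rotation_mean\<close> to the power Q and is the reason why Q >= 1 has to be
  arranged.\<close>

lemma nn_integral_powr_ge:
  fixes u :: "real \<Rightarrow> real"
  assumes Q: "1 \<le> Q" and c: "0 < c" and u: "\<And>x. 0 \<le> u x" and [measurable]: "u \<in> borel_measurable borel"
    and mean: "ennreal c \<le> (\<integral>\<^sup>+ x. ennreal (u x) * indicator {0..1} x \<partial>lborel)"
  shows "ennreal (c powr Q) \<le> (\<integral>\<^sup>+ x. ennreal (u x powr Q) * indicator {0..1} x \<partial>lborel)"
proof (cases "(\<integral>\<^sup>+ x. ennreal (u x powr Q) * indicator {0..1} x \<partial>lborel)")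
  case (real X)
  have pw: "u x * c powr (Q - 1) \<le> 1 / Q * u x powr Q + (1 - 1 / Q) * c powr Q" for x
  proof (cases "u x = 0")
    case False
    then have ux: "0 < u x" using u[of x] by simp
    have "(u x powr Q) powr (1 / Q) * (c powr Q) powr (1 - 1 / Q) \<le> 1 / Q * u x powr Q + (1 - 1 / Q) * c powr Q"
      using Q ux c by (intro Youngs_inequality_0) auto
    moreover have "(u x powr Q) powr (1 / Q) = u x" using Q ux by (simp add: powr_powr)
    moreover have "(c powr Q) powr (1 - 1 / Q) = c powr (Q - 1)" using Q by (simp add: powr_powr right_diff_distrib)
    ultimately show ?thesis by simp
  qed (use Q in auto)
  have "ennreal (c powr Q) = ennreal (c powr (Q - 1)) * ennreal c"
    using c by (simp add: ennreal_mult'[symmetric] powr_mult_base mult.commute)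
  also have "\<dots> \<le> ennreal (c powr (Q - 1)) * (\<integral>\<^sup>+ x. ennreal (u x) * indicator {0..1} x \<partial>lborel)"
    by (intro mult_left_mono mean) auto
  also have "\<dots> = (\<integral>\<^sup>+ x. ennreal (c powr (Q - 1)) * (ennreal (u x) * indicator {0..1} x) \<partial>lborel)"
    by (rule nn_integral_cmult[symmetric]) measurable
  also have "\<dots> \<le> (\<integral>\<^sup>+ x. ennreal (1 / Q) * (ennreal (u x powr Q) * indicator {0..1} x) + ennreal ((1 - 1 / Q) * c powr Q) * indicator {0..1} x \<partial>lborel)"
  proof (rule nn_integral_mono)
    fix x
    have "ennreal (c powr (Q - 1)) * ennreal (u x) \<le> ennreal (1 / Q) * ennreal (u x powr Q) + ennreal ((1 - 1 / Q) * c powr Q)"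
    proof -
      have "ennreal (c powr (Q - 1)) * ennreal (u x) = ennreal (u x * c powr (Q - 1))"
        using u by (simp add: ennreal_mult' mult.commute)
      also have "\<dots> \<le> ennreal (1 / Q * u x powr Q + (1 - 1 / Q) * c powr Q)" by (rule ennreal_leI[OF pw])
      also have "\<dots> = ennreal (1 / Q) * ennreal (u x powr Q) + ennreal ((1 - 1 / Q) * c powr Q)"
        using Q by (subst ennreal_plus) (auto simp: ennreal_mult'[symmetric])
      finally show ?thesis .
    qed
    then show "ennreal (c powr (Q - 1)) * (ennreal (u x) * indicator {0..1} x)
      \<le> ennreal (1 / Q) * (ennreal (u x powr Q) * indicator {0..1} x) + ennreal ((1 - 1 / Q) * c powr Q) * indicator {0..1} x"
      by (auto split: split_indicator)
  qed
  also have "\<dots> = ennreal (1 / Q) * ennreal X + ennreal ((1 - 1 / Q) * c powr Q)"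
    by (subst nn_integral_add) (auto simp: nn_integral_cmult real)
  also have "\<dots> = ennreal (1 / Q * X + (1 - 1 / Q) * c powr Q)"
    using Q real by (subst ennreal_plus) (auto simp: ennreal_mult'[symmetric])
  finally have "c powr Q \<le> 1 / Q * X + (1 - 1 / Q) * c powr Q"
    using Q real by (subst (asm) ennreal_le_iff) auto
  then have "1 / Q * c powr Q \<le> 1 / Q * X" by (simp add: algebra_simps)
  then have "c powr Q \<le> X" using Q by (simp add: field_simps)
  then show ?thesis using real by (simp add: ennreal_leI)
qed simp

lemma primitive_on_unit_ball:
  fixes h :: "complex \<Rightarrow> complex"
  assumes "h holomorphic_on ball 0 1"
  obtains f where "f holomorphic_on ball 0 1" "f 0 = 0" "\<And>z. z \<in> ball 0 1 \<Longrightarrow> (f has_field_derivative h z) (at z)"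
proof -
  obtain g where g: "\<And>z. z \<in> ball 0 1 \<Longrightarrow> (g has_field_derivative h z) (at z within ball 0 1)"
    using holomorphic_convex_primitive'[OF convex_ball open_ball assms] by blast
  have g': "((\<lambda>z. g z - g 0) has_field_derivative h z) (at z)" if "z \<in> ball 0 1" for z
    using g[OF that] that by (auto simp: at_within_open[OF _ open_ball] intro!: derivative_eq_intros)
  show ?thesis
  proof (rule that[of "\<lambda>z. g z - g 0"])
    show "(\<lambda>z. g z - g 0) holomorphic_on ball 0 1"
      using g' unfolding holomorphic_on_open[OF open_ball] by blast
  qed (use g' in auto)
qed

text \<open>If S > 2 a, the hypothesis gives S <= 2 M S^(1/p); dividing leaves S^(1/q) <= 2 M, a
  bound free of S. Both divergence arguments end here, with \<open>a\<close> standing for discarded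
  initial terms.\<close>

lemma bounded_by_self_powr:
  fixes S a M p q :: real
  assumes pq: "1 < p" "1 / p + 1 / q = 1" "0 < q" and S: "0 \<le> S" and a: "0 \<le> a" and M: "0 \<le> M"
    and le: "S - a \<le> M * S powr (1 / p)"
  shows "S \<le> max (2 * a) ((2 * M) powr q)"
proof (cases "S \<le> 2 * a")
  case False
  then have S0: "0 < S" using a by linarith
  have "S = S powr (1 / p) * S powr (1 / q)" using S0 pq by (simp add: powr_add[symmetric])
  moreover have "S \<le> 2 * M * S powr (1 / p)" using le False by linarith
  ultimately have "S powr (1 / p) * S powr (1 / q) \<le> S powr (1 / p) * (2 * M)" by (simp add: mult.commute)
  then have "S powr (1 / q) \<le> 2 * M" using S0 by simp
  then have "(S powr (1 / q)) powr q \<le> (2 * M) powr q" using pq by (intro powr_mono2) auto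
  then show ?thesis using S0 pq by (simp add: powr_powr)
qed simp

section \<open>Failure of the embedding when the sum diverges\<close>

context upper_doubling_exponent
begin

text \<open>The test function f has derivative (H N)^m, so |f'|^P0 = |H N|^P and |f'|^(P0/p) = |H
  N|^Q. On the k-th annulus the terms of \<open>H N\<close> before k sum geometrically because
  \<open>a\<close> grows by at least a fixed factor; those after k are killed by |z|^(2^n) <=
  exp(-2^(n-k)/2), which beats the growth of \<open>a\<close>. Hence |H N| is at most a multiple of
  \<open>a k\<close> there, and its k-th coefficient shows that this is its true size in the
  mean.\<close>

lemma not_id_bounded_if_not_summable:
  assumes NS: "\<not> summable t" and y: "q < y" and P0: "0 < P0"
  shows "\<not> id_bounded P0 (\<lambda>z. omega_hat \<omega> (norm z) * (1 - norm z) powr (p * (y - 1))) (P0 / p) (std_weight y)"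
proof
  define \<nu> where "\<nu> = (\<lambda>z::complex. omega_hat \<omega> (norm z) * (1 - norm z) powr (p * (y - 1)))"
  define x where "x = p * (y - 1)"
  define d where "d = (\<lambda>n::nat. (1/2::real)^n)"
  have d0: "0 < d n" for n by (simp add: d_def)
  have dSuc: "d (Suc n) = d n / 2" for n by (simp add: d_def)
  assume "id_bounded P0 (\<lambda>z. omega_hat \<omega> (norm z) * (1 - norm z) powr (p * (y - 1))) (P0 / p) (std_weight y)"
  then obtain B where B: "\<And>f. in_D P0 \<nu> f \<Longrightarrow> in_D (P0 / p) (std_weight y) f \<and> D_norm (P0 / p) (std_weight y) f \<le> B * D_norm P0 \<nu> f"
    unfolding id_bounded_def \<nu>_def by blast
  have p0: "0 < p" using p_gt_1 by simp
  have y1: "1 < y" using y q_gt_1 by simp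
  have "p * (q - 1) < p * (y - 1)" using y p0 by simp
  then have xq: "q < x" unfolding x_def p_mult_q_minus_1 .
  \<comment> \<open>Large enough for Q = m P0 / p to be at least 1, as Jensen's inequality
    demands.\<close>
  obtain m0 :: nat where m0: "p / P0 < real m0" using reals_Archimedean2 by blast
  define m where "m = Suc m0"
  define P where "P = real m * P0"
  define Q where "Q = P / p"
  have Pp: "0 < P" using P0 by (simp add: P_def m_def)
  have "p / P0 \<le> real m" using m0 by (simp add: m_def)
  then have Q1: "1 \<le> Q" using P0 p0 by (simp add: Q_def P_def field_simps)
  \<comment> \<open>The solution of a^P w d^x d = t. Since x = p (y - 1), the same \<open>a\<close>
    also satisfies a^Q d^y d = t, so source and target integrals both become partial sums of
    \<open>t\<close>.\<close>
  define a where "a = (\<lambda>n. (d n powr (q - x) * w n powr (- q)) powr (1 / P))"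
  have a0: "0 < a n" for n using d0[of n] w_pos[of n] by (simp add: a_def)
  have aP: "a n powr P = d n powr (q - x) * w n powr (- q)" for n
    using Pp d0[of n] w_pos[of n] by (simp add: a_def powr_powr)
  have tP: "a n powr P * (w n * d n powr x * d n) = t n" for n
  proof -
    have "d n powr (q - x) * d n powr x * d n = d n powr (q + 1)"
      using d0[of n] powr_add[of "d n" "q - x" x] powr_add[of "d n" q 1] by simp
    moreover have "w n powr (- q) * w n = 1 / w n powr (q - 1)"
      using w_pos[of n] powr_add[of "w n" "- q" 1] powr_minus_divide[of "w n" "q - 1"] by simp
    moreover have "a n powr P * (w n * d n powr x * d n) = (d n powr (q - x) * d n powr x * d n) * (w n powr (- q) * w n)"
      by (simp add: aP)
    ultimately show ?thesis by (simp add: t_def d_def)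
  qed
  have tQ: "a n powr Q * (d n powr y * d n) = t n" for n
  proof -
    have "a n powr Q = (d n powr (q - x) * w n powr (- q)) powr (1 / p)"
      unfolding aP[symmetric] by (simp add: Q_def powr_powr)
    also have "\<dots> = d n powr ((q - x) / p) * w n powr (- q / p)"
      using d0[of n] w_pos[of n] by (simp add: powr_mult powr_powr)
    also have "(q - x) / p = q - y"
      using p0 q_div_p by (simp add: x_def diff_divide_distrib)
    also have "- q / p = - (q - 1)" using q_div_p by simp
    finally have "a n powr Q * (d n powr y * d n) = (d n powr (q - y) * d n powr y * d n) * w n powr (- (q - 1))" by simp
    also have "d n powr (q - y) * d n powr y * d n = d n powr (q + 1)"
      using d0[of n] powr_add[of "d n" "q - y" y] powr_add[of "d n" q 1] by simp
    finally show ?thesis by (simp add: t_def d_def powr_minus_divide del: minus_diff_eq)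
  qed
  \<comment> \<open>As x > q, the factor d^(q - x) makes \<open>a\<close> grow geometrically with
    ratio at least 1 / \<open>\<beta>\<close>, whatever the weight does; the upper rate
    \<open>A\<close> is where doubling enters.\<close>
  define \<beta> where "\<beta> = 2 powr ((q - x) / P)"
  define A where "A = (2 powr (x - q) * C powr q) powr (1 / P)"
  have \<beta>: "0 < \<beta>" "\<beta> < 1"
    using xq Pp powr_less_mono[of "(q - x) / P" 0 "2::real"] by (auto simp: \<beta>_def divide_neg_pos)
  have A0: "0 < A" using C_ge_1 by (simp add: A_def)
  have dpow: "d (Suc n) powr (q - x) = 2 powr (x - q) * d n powr (q - x)" for n
    using d0[of n] powr_minus_divide[of 2 "x - q"] by (simp add: dSuc powr_divide)
  have growth: "a n \<le> \<beta> * a (Suc n)" for n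
  proof -
    have "w n powr (- q) \<le> w (Suc n) powr (- q)"
      using w_antimono[of n "Suc n"] w_pos q_gt_1 by (intro powr_mono2') auto
    then have "2 powr (x - q) * (d n powr (q - x) * w n powr (- q)) \<le> d (Suc n) powr (q - x) * w (Suc n) powr (- q)"
      unfolding dpow by (simp add: mult_left_mono)
    then have "(2 powr (x - q) * (d n powr (q - x) * w n powr (- q))) powr (1 / P) \<le> a (Suc n)"
      unfolding a_def using Pp by (intro powr_mono2) auto
    then have "2 powr ((x - q) / P) * a n \<le> a (Suc n)"
      by (simp add: a_def powr_mult powr_powr)
    then have "\<beta> * (2 powr ((x - q) / P) * a n) \<le> \<beta> * a (Suc n)" using \<beta> by simp
    moreover have "\<beta> * 2 powr ((x - q) / P) = 1"
      by (simp add: \<beta>_def powr_add[symmetric] add_divide_distrib[symmetric])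
    ultimately show ?thesis by (simp add: mult.assoc[symmetric])
  qed
  have growth2: "a (Suc n) \<le> A * a n" for n
  proof -
    have "w (Suc n) powr (- q) \<le> C powr q * w n powr (- q)"
      using w_Suc_powr[of q n] q_gt_1 by (simp add: powr_minus_divide)
    from mult_left_mono[OF this, of "2 powr (x - q) * d n powr (q - x)"]
    have "d (Suc n) powr (q - x) * w (Suc n) powr (- q) \<le> (2 powr (x - q) * C powr q) * (d n powr (q - x) * w n powr (- q))"
      unfolding dpow by (simp add: mult_ac)
    then have "a (Suc n) \<le> ((2 powr (x - q) * C powr q) * (d n powr (q - x) * w n powr (- q))) powr (1 / P)"
      unfolding a_def using Pp by (intro powr_mono2) auto
    then show ?thesis by (simp add: a_def A_def powr_mult)
  qed
  have gr: "a n \<le> \<beta> ^ i * a (n + i)" for n i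
  proof (induction i)
    case (Suc i)
    have "\<beta> ^ i * a (n + i) \<le> \<beta> ^ i * (\<beta> * a (Suc (n + i)))" using \<beta> growth by (intro mult_left_mono) auto
    with Suc show ?case by (simp add: mult_ac)
  qed simp
  have gr2: "a (n + i) \<le> A ^ i * a n" for n i
  proof (induction i)
    case (Suc i)
    have "A * a (n + i) \<le> A * (A ^ i * a n)" using A0 Suc by (intro mult_left_mono) auto
    with growth2[of "n + i"] show ?case by (simp add: mult_ac)
  qed simp
  define K where "K = (\<Sum>i. \<beta> ^ i) + (\<Sum>i. A ^ i * exp (- (1/2 * 2 ^ i)))"
  have s1: "summable (\<lambda>i. \<beta> ^ i)" using \<beta> by (intro summable_geometric) auto
  have s2: "summable (\<lambda>i. A ^ i * exp (- (1/2 * 2 ^ i)))" using A0 by (intro summable_power_mult_exp_neg) auto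
  have K0: "0 \<le> K" unfolding K_def using \<beta> A0 by (intro add_nonneg_nonneg suminf_nonneg s1 s2) auto
  define H where "H = (\<lambda>N (z::complex). \<Sum>n\<le>N. of_real (a n) * z ^ (2 ^ n))"
  \<comment> \<open>With \<open>min k N\<close>, the estimate also covers radii beyond the last
    frequency, where all terms are dominated by \<open>a N\<close>.\<close>
  have Hub: "norm (H N z) \<le> K * a (min k N)" if z: "norm z < 1 - d (Suc k)" for N k z
  proof -
    define j where "j = min k N"
    have "norm (H N z) \<le> (\<Sum>n\<le>N. a n * norm z ^ (2 ^ n))"
      unfolding H_def using a0 by (intro sum_norm_le) (simp add: norm_mult norm_power less_imp_le)
    also have "\<dots> \<le> (\<Sum>n\<le>N. a j * (if n \<le> j then \<beta> ^ (j - n) else A ^ (n - j) * exp (- (1/2 * 2 ^ (n - j)))))"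
    proof (rule sum_mono)
      fix n assume n: "n \<in> {..N}"
      show "a n * norm z ^ (2 ^ n) \<le> a j * (if n \<le> j then \<beta> ^ (j - n) else A ^ (n - j) * exp (- (1/2 * 2 ^ (n - j))))"
      proof (cases "n \<le> j")
        case True
        have "norm z ^ (2 ^ n) \<le> 1" using z d0[of "Suc k"] by (intro power_le_one) auto
        then have "a n * norm z ^ (2 ^ n) \<le> a n * 1" using a0[of n] by (intro mult_left_mono) auto
        also have "\<dots> \<le> \<beta> ^ (j - n) * a j" using gr[of n "j - n"] True by simp
        finally show ?thesis using True by (simp add: mult.commute)
      next
        case False
        then have jk: "j = k" "k < n" using n by (auto simp: j_def min_def split: if_splits)
        have "norm z \<le> exp (- d (Suc k))" using z exp_ge_add_one_self[of "- d (Suc k)"] by linarith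
        then have "norm z ^ (2 ^ n) \<le> exp (- d (Suc k)) ^ (2 ^ n)" by (intro power_mono) auto
        also have "\<dots> = exp (- (2 ^ n * d (Suc k)))" by (simp add: exp_of_nat_mult[symmetric])
        also have "2 ^ n * d (Suc k) = 1/2 * 2 ^ (n - k)"
          using jk by (simp add: d_def power_diff power_divide)
        finally have "norm z ^ (2 ^ n) \<le> exp (- (1/2 * 2 ^ (n - k)))" .
        moreover have "a n \<le> A ^ (n - k) * a k" using gr2[of k "n - k"] jk by simp
        ultimately have "a n * norm z ^ (2 ^ n) \<le> (A ^ (n - k) * a k) * exp (- (1/2 * 2 ^ (n - k)))"
          using a0 A0 by (intro mult_mono) (auto simp: less_imp_le)
        then show ?thesis using False jk by (simp add: mult_ac)
      qed
    qed
    also have "\<dots> = a j * (\<Sum>n\<le>N. if n \<le> j then \<beta> ^ (j - n) else A ^ (n - j) * exp (- (1/2 * 2 ^ (n - j))))"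
      by (simp only: sum_distrib_left)
    also have "\<dots> \<le> a j * K"
      unfolding K_def using a0[of j] \<beta> A0
      by (intro mult_left_mono sum_two_sided_le_suminf[of _ "\<lambda>i. \<beta> ^ i" "\<lambda>i. A ^ i * exp (- (1/2 * 2 ^ i))"] s1 s2) auto
    finally show ?thesis by (simp add: j_def mult.commute)
  qed
  have Hhol: "H N holomorphic_on S" for N S unfolding H_def by (intro holomorphic_intros)
  have Hc [measurable]: "H N \<in> borel_measurable borel" for N
    unfolding H_def by (intro borel_measurable_continuous_onI continuous_intros)
  define Ann where "Ann = (\<lambda>k. {z::complex. 1 - d k \<le> norm z \<and> norm z < 1 - d (Suc k)})"
  have [measurable]: "Ann k \<in> sets borel" for k unfolding Ann_def by measurable
  have d1: "d k \<le> 1" for k by (simp add: d_def power_le_one)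
  \<comment> \<open>The k-th coefficient bounds the mean modulus on circles in the annulus, Jensen's
    inequality passes to the power Q, and averaging over rotations passes to area. The case k = 0 is
    left out since that annulus contains 0, where z^(2^0) vanishes; this loses the term
    \<open>t 0\<close>.\<close>
  have lower: "ennreal ((a k / 4) powr Q * (pi * (d k / 2))) \<le> (\<integral>\<^sup>+ z. indicator (Ann k) z * ennreal (norm (H N z) powr Q) \<partial>lborel)"
    if k: "1 \<le> k" "k \<le> N" for k N
  proof -
    obtain k' where k': "k = Suc k'" using k by (cases k) auto
    have dh: "d k \<le> 1/2" using d1[of k'] by (simp add: k' dSuc)
    have pt: "ennreal ((a k / 4) powr Q) \<le> (\<integral>\<^sup>+ s. ennreal (norm (H N (exp (2 * of_real pi * \<i> * of_real s) * z)) powr Q) * indicator {0..1} s \<partial>lborel)"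
      if z: "z \<in> Ann k" for z
    proof (rule nn_integral_powr_ge[OF Q1])
      have "1/4 \<le> (1 - d k) ^ (2 ^ k)" using one_minus_power_ge_quarter[of k'] by (simp only: d_def k')
      also have "\<dots> \<le> norm z ^ (2 ^ k)" using z dh by (intro power_mono) (auto simp: Ann_def)
      finally have "a k * (1/4) \<le> a k * norm z ^ (2 ^ k)" using a0[of k] by (intro mult_left_mono) auto
      then have "ennreal (a k / 4) \<le> ennreal (norm (complex_of_real (a k)) * norm z ^ (2 ^ k))"
        using a0[of k] by (intro ennreal_leI) simp
      also have "\<dots> \<le> (\<integral>\<^sup>+ s. ennreal (norm (\<Sum>n\<le>N. of_real (a n) * (exp (2 * of_real pi * \<i> * of_real s) * z) ^ (2 ^ n))) * indicator {0..1} s \<partial>lborel)"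
        using k by (intro coefficient_rotation_mean[of "{..N}" "\<lambda>n. 2 ^ n" k "\<lambda>n. of_real (a n)"]) (auto simp: inj_on_def)
      finally show "ennreal (a k / 4) \<le> (\<integral>\<^sup>+ s. ennreal (norm (H N (exp (2 * of_real pi * \<i> * of_real s) * z))) * indicator {0..1} s \<partial>lborel)"
        by (simp only: H_def)
      show "(\<lambda>s. norm (H N (exp (2 * of_real pi * \<i> * of_real s) * z))) \<in> borel_measurable borel"
        unfolding H_def by (intro borel_measurable_continuous_onI continuous_intros)
    qed (use a0[of k] in auto)
    have "ennreal ((a k / 4) powr Q * (pi * (d k / 2))) = ennreal ((a k / 4) powr Q) * ennreal (pi * (d k / 2))"
      by (rule ennreal_mult') simp
    also have "\<dots> \<le> ennreal ((a k / 4) powr Q) * emeasure lborel (Ann k)"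
    proof (rule mult_left_mono)
      have e: "emeasure lborel (Ann k) = ennreal (pi * ((1 - d (Suc k))\<^sup>2 - (1 - d k)\<^sup>2))"
        unfolding Ann_def using d1[of k] d0[of k] by (intro emeasure_lborel_complex_annulus) (auto simp: dSuc)
      have "(1 - d (Suc k))\<^sup>2 - (1 - d k)\<^sup>2 = d k / 2 * (2 - 3/2 * d k)"
        by (simp add: dSuc power2_eq_square algebra_simps)
      moreover have "d k / 2 * 1 \<le> d k / 2 * (2 - 3/2 * d k)" using dh d0[of k] by (intro mult_left_mono) auto
      ultimately show "ennreal (pi * (d k / 2)) \<le> emeasure lborel (Ann k)"
        unfolding e by (intro ennreal_leI mult_left_mono) auto
    qed simp
    also have "\<dots> = (\<integral>\<^sup>+ z. indicator (Ann k) z * ennreal ((a k / 4) powr Q) \<partial>lborel)"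
      by (subst nn_integral_multc) (auto simp: mult.commute)
    also have "\<dots> \<le> (\<integral>\<^sup>+ z. indicator (Ann k) z * (\<integral>\<^sup>+ s. ennreal (norm (H N (exp (2 * of_real pi * \<i> * of_real s) * z)) powr Q) * indicator {0..1} s \<partial>lborel) \<partial>lborel)"
      by (rule nn_integral_mono) (use pt in \<open>auto split: split_indicator\<close>)
    also have "\<dots> = (\<integral>\<^sup>+ z. indicator (Ann k) z * ennreal (norm (H N z) powr Q) \<partial>lborel)"
      by (rule nn_integral_rotation_mean[symmetric]) (measurable, auto simp: Ann_def indicator_def norm_mult)
    finally show ?thesis .
  qed
  have dis: "disjoint_family_on Ann I" for I
    using disjoint_family_dyadic unfolding disjoint_family_on_def Ann_def d_def by fastforce
  define S where "S N = (\<Sum>n\<le>N. t n)" for N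
  have S0: "0 \<le> S N" for N unfolding S_def using t_pos by (intro sum_nonneg) (simp add: less_imp_le)
  define c1 where "c1 = 2 * K powr P"
  \<comment> \<open>The factor 1/4 is the lower bound for |z|^(2^k) on \<open>Ann k\<close>; y
    halves come from 1 - |z| > d k / 2 there, and one more from the area of \<open>Ann k\<close>
    being at least pi d k / 2.\<close>
  define c2 where "c2 = (1/4) powr Q * (1/2) powr (y + 1)"
  have c20: "0 < c2" by (simp add: c2_def)
  define M where "M = (max B 0) powr (P0 / p) * c1 powr (1 / p) / c2"
  have bnd: "S N - t 0 \<le> M * S N powr (1 / p)" for N
  proof -
    have hol: "(\<lambda>z. H N z ^ m) holomorphic_on ball 0 1" by (intro holomorphic_intros Hhol)
    obtain f where f: "f holomorphic_on ball 0 1" "f 0 = 0"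
        "\<And>z. z \<in> ball 0 1 \<Longrightarrow> (f has_field_derivative H N z ^ m) (at z)"
      using primitive_on_unit_ball[OF hol] by blast
    have df: "deriv f z = H N z ^ m" if "norm z < 1" for z using f(3)[of z] that by (intro DERIV_imp_deriv) simp
    have pw: "norm (deriv f z) powr s = norm (H N z) powr (real m * s)" if "norm z < 1" for z s
    proof -
      have "norm (H N z) ^ m = norm (H N z) powr real m"
        by (cases "H N z = 0") (simp add: m_def, simp add: powr_realpow)
      then show ?thesis by (simp add: df[OF that] norm_power powr_powr)
    qed
    have "D_normpow P0 \<nu> f = (\<integral>\<^sup>+ z. ennreal (norm (deriv f z) powr P0 * \<nu> z / pi) * indicator (ball 0 1) z \<partial>lborel)"
      using f(2) P0 by (simp add: D_normpow_def)
    \<comment> \<open>These are full outer annuli, not dyadic ones, so that the summand k = N also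
      covers all radii beyond the last frequency.\<close>
    also have "\<dots> \<le> (\<integral>\<^sup>+ z. (\<Sum>k\<le>N. ennreal ((K * a k) powr P * (w k * d k powr x) / pi) * indicator {z::complex. 1 - d k \<le> norm z \<and> norm z < 1} z) \<partial>lborel)"
    (is "(\<integral>\<^sup>+ z. ?f z \<partial>_) \<le> (\<integral>\<^sup>+ z. ?g z \<partial>_)")
    proof (rule nn_integral_mono)
      fix z :: complex
      show "?f z \<le> ?g z"
      proof (cases "norm z < 1")
        case True
        obtain k where k: "(1/2)^Suc k < 1 - norm z" "1 - norm z \<le> (1/2)^k"
          using dyadic_block_exists[of "1 - norm z"] True by auto
        define j where "j = min k N"
        have "norm (H N z) \<le> K * a j" unfolding j_def by (rule Hub) (use k in \<open>simp add: d_def\<close>)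
        then have u1: "norm (H N z) powr P \<le> (K * a j) powr P" using Pp by (intro powr_mono2) auto
        have dkj: "d k \<le> d j" unfolding d_def j_def by (intro power_decreasing) auto
        have zj: "1 - d j \<le> norm z" using k(2) dkj unfolding d_def by linarith
        have "omega_hat \<omega> (norm z) \<le> w j"
          unfolding w_def using zj d1[of j] by (intro omega_hat_antimono) (auto simp: d_def)
        moreover have "(1 - norm z) powr x \<le> d j powr x"
          using True zj xq q_gt_1 by (intro powr_mono2) auto
        ultimately have "\<nu> z \<le> w j * d j powr x"
          unfolding \<nu>_def x_def[symmetric] using omega_hat_nonneg[of "norm z"] w_pos[of j] by (intro mult_mono) auto
        then have "norm (H N z) powr P * \<nu> z \<le> (K * a j) powr P * (w j * d j powr x)"
          using u1 omega_hat_nonneg[of "norm z"] by (intro mult_mono) (auto simp: \<nu>_def)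
        then have "ennreal (norm (deriv f z) powr P0 * \<nu> z / pi) \<le> ennreal ((K * a j) powr P * (w j * d j powr x) / pi)"
          unfolding pw[OF True] P_def[symmetric] by (intro ennreal_leI divide_right_mono) auto
        also have "\<dots> = ennreal ((K * a j) powr P * (w j * d j powr x) / pi) * indicator {z::complex. 1 - d j \<le> norm z \<and> norm z < 1} z"
          using zj True by simp
        also have "\<dots> \<le> (\<Sum>k\<le>N. ennreal ((K * a k) powr P * (w k * d k powr x) / pi) * indicator {z::complex. 1 - d k \<le> norm z \<and> norm z < 1} z)"
          by (rule member_le_sum) (auto simp: j_def)
        finally show ?thesis using True by simp
      qed auto
    qed
    also have "\<dots> = (\<Sum>k\<le>N. ennreal ((K * a k) powr P * (w k * d k powr x) / pi) * emeasure lborel {z::complex. 1 - d k \<le> norm z \<and> norm z < 1})"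
      by (subst nn_integral_sum) (measurable, auto intro!: sum.cong simp: nn_integral_cmult_indicator)
    also have "\<dots> \<le> (\<Sum>k\<le>N. ennreal (c1 * t k))"
    proof (rule sum_mono)
      fix k
      have "emeasure lborel {z::complex. 1 - d k \<le> norm z \<and> norm z < 1} = ennreal (pi * (1\<^sup>2 - (1 - d k)\<^sup>2))"
        using d1[of k] d0[of k] by (intro emeasure_lborel_complex_annulus) auto
      also have "\<dots> \<le> ennreal (pi * (2 * d k))"
        by (intro ennreal_leI mult_left_mono) (auto simp: power2_eq_square algebra_simps)
      finally have "ennreal ((K * a k) powr P * (w k * d k powr x) / pi) * emeasure lborel {z::complex. 1 - d k \<le> norm z \<and> norm z < 1}
        \<le> ennreal ((K * a k) powr P * (w k * d k powr x) / pi) * ennreal (pi * (2 * d k))" by (intro mult_left_mono) auto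
      also have "\<dots> = ennreal ((K * a k) powr P * (w k * d k powr x) / pi * (pi * (2 * d k)))"
        using w_pos[of k] by (intro ennreal_mult'[symmetric]) auto
      also have "(K * a k) powr P * (w k * d k powr x) / pi * (pi * (2 * d k)) = c1 * (a k powr P * (w k * d k powr x * d k))"
        using K0 a0[of k] by (simp add: c1_def powr_mult)
      finally show "ennreal ((K * a k) powr P * (w k * d k powr x) / pi) * emeasure lborel {z::complex. 1 - d k \<le> norm z \<and> norm z < 1}
        \<le> ennreal (c1 * t k)" by (simp only: tP)
    qed
    also have "\<dots> = ennreal (c1 * S N)"
      unfolding S_def sum_distrib_left using t_pos by (intro sum_ennreal) (auto simp: c1_def less_imp_le)
    finally have up: "D_normpow P0 \<nu> f \<le> ennreal (c1 * S N)" .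
    then have inD: "in_D P0 \<nu> f" using f(1) by (auto simp: in_D_def intro: le_less_trans)
    have c1S: "0 \<le> c1 * S N" using S0 by (simp add: c1_def)
    have "ennreal (c2 * (\<Sum>k=1..N. t k)) = (\<Sum>k=1..N. ennreal (c2 * t k))"
      unfolding sum_distrib_left using t_pos c20 by (intro sum_ennreal[symmetric]) (auto simp: less_imp_le)
    also have "\<dots> \<le> (\<Sum>k=1..N. ennreal ((d k / 2) powr y / pi) * (\<integral>\<^sup>+ z. indicator (Ann k) z * ennreal (norm (H N z) powr Q) \<partial>lborel))"
    proof (rule sum_mono)
      fix k assume k: "k \<in> {1..N}"
      have "c2 * t k = c2 * (a k powr Q * (d k powr y * d k))" by (simp only: tQ)
      also have "\<dots> = (d k / 2) powr y / pi * ((a k / 4) powr Q * (pi * (d k / 2)))"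
        using a0[of k] d0[of k] by (simp add: c2_def powr_divide powr_add mult_ac)
      finally have "ennreal (c2 * t k) = ennreal ((d k / 2) powr y / pi) * ennreal ((a k / 4) powr Q * (pi * (d k / 2)))"
        by (simp only:) (intro ennreal_mult', simp)
      also have "\<dots> \<le> ennreal ((d k / 2) powr y / pi) * (\<integral>\<^sup>+ z. indicator (Ann k) z * ennreal (norm (H N z) powr Q) \<partial>lborel)"
        using k by (intro mult_left_mono lower) auto
      finally show "ennreal (c2 * t k) \<le> ennreal ((d k / 2) powr y / pi) * (\<integral>\<^sup>+ z. indicator (Ann k) z * ennreal (norm (H N z) powr Q) \<partial>lborel)" .
    qed
    also have "\<dots> = (\<integral>\<^sup>+ z. (\<Sum>k=1..N. ennreal ((d k / 2) powr y / pi) * (indicator (Ann k) z * ennreal (norm (H N z) powr Q))) \<partial>lborel)"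
      by (subst nn_integral_sum) (measurable, auto intro!: sum.cong nn_integral_cmult[symmetric])
    also have "\<dots> \<le> (\<integral>\<^sup>+ z. ennreal (norm (deriv f z) powr (P0 / p) * std_weight y z / pi) * indicator (ball 0 1) z \<partial>lborel)"
    (is "(\<integral>\<^sup>+ z. ?f z \<partial>_) \<le> (\<integral>\<^sup>+ z. ?g z \<partial>_)")
    proof (rule nn_integral_mono)
      fix z :: complex
      show "?f z \<le> ?g z"
      proof (cases "norm z < 1")
        case True
        have "norm z ^ 2 \<le> norm z" using True by (simp add: power2_eq_square mult_left_le_one_le)
        then have "(1 - norm z) powr y \<le> (1 - norm z ^ 2) powr y" using True y1 by (intro powr_mono2) auto
        also have "\<dots> \<le> (y + 1) * (1 - norm z ^ 2) powr y"
          using y1 mult_right_mono[of 1 "y + 1" "(1 - norm z ^ 2) powr y"] by simp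
        finally have st: "(1 - norm z) powr y \<le> std_weight y z" by (simp add: std_weight_def)
        have "(\<Sum>k=1..N. ennreal ((d k / 2) powr y / pi) * (indicator (Ann k) z * ennreal (norm (H N z) powr Q)))
          \<le> (\<Sum>k=1..N. indicator (Ann k) z * ennreal (norm (H N z) powr Q * std_weight y z / pi))"
        proof (rule sum_mono)
          fix k
          show "ennreal ((d k / 2) powr y / pi) * (indicator (Ann k) z * ennreal (norm (H N z) powr Q))
            \<le> indicator (Ann k) z * ennreal (norm (H N z) powr Q * std_weight y z / pi)"
          proof (cases "z \<in> Ann k")
            case zk: True
            then have "(d k / 2) powr y \<le> (1 - norm z) powr y"
              using d0[of k] y1 by (intro powr_mono2) (auto simp: Ann_def dSuc)
            with st have le: "(d k / 2) powr y \<le> std_weight y z" by linarith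
            have "norm (H N z) powr Q * (d k / 2) powr y / pi \<le> norm (H N z) powr Q * std_weight y z / pi"
              by (intro divide_right_mono mult_left_mono le) auto
            then have "(d k / 2) powr y / pi * norm (H N z) powr Q \<le> norm (H N z) powr Q * std_weight y z / pi"
              by (simp add: mult.commute)
            then show ?thesis using zk by (simp add: ennreal_mult'[symmetric] ennreal_leI)
          qed auto
        qed
        also have "\<dots> = indicator (\<Union>k\<in>{1..N}. Ann k) z * ennreal (norm (H N z) powr Q * std_weight y z / pi)"
          by (subst indicator_UN_disjoint[OF _ dis]) (auto simp: sum_distrib_right)
        also have "\<dots> \<le> 1 * ennreal (norm (H N z) powr Q * std_weight y z / pi)"
          by (intro mult_right_mono) (auto split: split_indicator)
        finally show ?thesis using True unfolding pw[OF True] by (simp add: Q_def P_def)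
      next
        case False
        have "d (Suc k) > 0" for k by (rule d0)
        then have "z \<notin> Ann k" for k using False unfolding Ann_def by (smt (verit) mem_Collect_eq)
        then show ?thesis by simp
      qed
    qed
    also have "\<dots> \<le> D_normpow (P0 / p) (std_weight y) f" by (simp add: D_normpow_def)
    finally have lo: "ennreal (c2 * (\<Sum>k=1..N. t k)) \<le> D_normpow (P0 / p) (std_weight y) f" .
    have fin2: "D_normpow (P0 / p) (std_weight y) f < \<infinity>" and Bf: "D_norm (P0 / p) (std_weight y) f \<le> B * D_norm P0 \<nu> f"
      using B[OF inD] by (auto simp: in_D_def)
    define n2 where "n2 = enn2real (D_normpow (P0 / p) (std_weight y) f)"
    have n2: "c2 * (\<Sum>k=1..N. t k) \<le> n2" "0 \<le> n2"
    proof -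
      have "ennreal (c2 * (\<Sum>k=1..N. t k)) \<le> ennreal n2" using lo fin2 by (simp add: n2_def)
      then show "c2 * (\<Sum>k=1..N. t k) \<le> n2" by (subst (asm) ennreal_le_iff) (auto simp: n2_def)
    qed (simp add: n2_def)
    \<comment> \<open>The target norm is the power p / P0 of its integral; raising to P0 / p leaves
      S^(1/p) on the right. \<open>B\<close> may be negative, hence \<open>max B 0\<close>.\<close>
    have "n2 powr (p / P0) \<le> B * D_norm P0 \<nu> f" using Bf by (simp add: D_norm_def n2_def)
    also have "\<dots> \<le> max B 0 * D_norm P0 \<nu> f" by (intro mult_right_mono) auto
    also have "\<dots> \<le> max B 0 * (c1 * S N) powr (1 / P0)" by (intro mult_left_mono D_norm_le P0 up c1S) auto
    finally have "(n2 powr (p / P0)) powr (P0 / p) \<le> (max B 0 * (c1 * S N) powr (1 / P0)) powr (P0 / p)"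
      using P0 p0 by (intro powr_mono2) auto
    also have "(n2 powr (p / P0)) powr (P0 / p) = n2" using P0 p0 n2 by (simp add: powr_powr)
    also have "(max B 0 * (c1 * S N) powr (1 / P0)) powr (P0 / p) = (max B 0) powr (P0 / p) * (c1 powr (1 / p) * S N powr (1 / p))"
      using P0 p0 S0[of N] by (simp add: powr_mult powr_powr c1_def)
    finally have "c2 * (\<Sum>k=1..N. t k) \<le> (max B 0) powr (P0 / p) * (c1 powr (1 / p) * S N powr (1 / p))"
      using n2 by linarith
    moreover have "(\<Sum>k=1..N. t k) = S N - t 0"
      unfolding S_def by (simp add: atMost_atLeast0 sum.atLeast_Suc_atMost)
    ultimately have "(S N - t 0) * c2 \<le> (max B 0) powr (P0 / p) * c1 powr (1 / p) * S N powr (1 / p)"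
      by (simp add: mult_ac)
    then show ?thesis using c20 by (simp add: M_def pos_le_divide_eq)
  qed
  have "summable t"
  proof (rule bounded_imp_summable)
    show "0 \<le> t n" for n using t_pos by (simp add: less_imp_le)
    fix N
    show "(\<Sum>n\<le>N. t n) \<le> max (2 * t 0) ((2 * M) powr q)"
      unfolding S_def[symmetric]
      by (rule bounded_by_self_powr[OF p_gt_1 conjugate _ S0 _ _ bnd])
         (use q_gt_1 t_pos[of 0] c20 in \<open>auto simp: M_def\<close>)
  qed
  with NS show False by simp
qed

end

subsection \<open>Volterra operators when the sum diverges\<close>

lemma D_normpow_rotation:
  assumes f: "f holomorphic_on ball 0 1" and c: "norm c = 1"
    and m: "(\<lambda>z. \<nu> z * indicator (ball 0 1) z) \<in> borel_measurable borel"
    and rad: "\<And>z. \<nu> (c * z) = \<nu> z"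
  shows "D_normpow s \<nu> (\<lambda>z. f (c * z)) = D_normpow s \<nu> f"
proof -
  define G where "G = (\<lambda>z. ennreal (norm (deriv f z) powr s * \<nu> z / pi) * indicator (ball 0 1) z)"
  have G: "G \<in> borel_measurable borel" unfolding G_def by (rule D_integrand_measurable[OF f m])
  have "ennreal (norm (deriv (\<lambda>z. f (c * z)) z) powr s * \<nu> z / pi) * indicator (ball 0 1) z = G (c * z)" for z
  proof (cases "norm z < 1")
    case True
    then have "f field_differentiable at (c * z)"
      using f c by (intro holomorphic_on_imp_differentiable_at[OF f]) (auto simp: norm_mult)
    then have "(f has_field_derivative deriv f (c * z)) (at (c * z))" by (simp add: DERIV_deriv_iff_field_differentiable)
    then have "((\<lambda>z. f (c * z)) has_field_derivative deriv f (c * z) * c) (at z)"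
      by (rule DERIV_chain2) (auto intro!: derivative_eq_intros)
    then have "deriv (\<lambda>z. f (c * z)) z = deriv f (c * z) * c" by (rule DERIV_imp_deriv)
    then show ?thesis using True c by (simp add: G_def rad norm_mult)
  qed (auto simp: G_def norm_mult c)
  then have "(\<integral>\<^sup>+ z. ennreal (norm (deriv (\<lambda>z. f (c * z)) z) powr s * \<nu> z / pi) * indicator (ball 0 1) z \<partial>lborel) = (\<integral>\<^sup>+ z. G z \<partial>lborel)"
    using nn_integral_rotation[OF c G] by simp
  then show ?thesis by (simp add: D_normpow_def G_def)
qed

lemma T_op_eq_integral: "T_op g f z = integral {0..1} (\<lambda>s. f (of_real s * z) * deriv g (of_real s * z) * z)"
  unfolding T_op_def contour_integral_integral by (simp add: linepath_def scaleR_conv_of_real)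

text \<open>The local factorization near 0 is glued to division by z^m away from 0, which makes the
  cofactor holomorphic on the whole disc.\<close>

lemma holomorphic_factor_at_zero:
  assumes h: "h holomorphic_on ball 0 1" and nz: "\<not> (\<forall>z\<in>ball 0 1. h z = 0)"
  obtains m k where "k holomorphic_on ball 0 1" "k 0 \<noteq> 0" "\<And>z. z \<in> ball 0 1 \<Longrightarrow> h z = z ^ m * k z"
proof (cases "h 0 = 0")
  case False
  show ?thesis by (rule that[of h 0]) (use h False in auto)
next
  case True
  have nc: "\<not> h constant_on ball 0 1"
    using nz True unfolding constant_on_def by (metis centre_in_ball zero_less_one)
  have "\<exists>g r n. 0 < n \<and> 0 < r \<and> ball 0 r \<subseteq> ball (0::complex) 1 \<and> g holomorphic_on ball 0 r \<and>
      (\<forall>z\<in>ball 0 r. h z = (z - 0) ^ n * g z) \<and> (\<forall>z\<in>ball 0 r. g z \<noteq> 0)"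
  proof (rule holomorphic_factor_zero_nonconstant[OF h open_ball connected_ball _ True nc])
    fix g r n
    assume "0 < n" "0 < r" "ball 0 r \<subseteq> ball (0::complex) 1" "g holomorphic_on ball 0 r"
      "\<And>z. z \<in> ball 0 r \<Longrightarrow> h z = (z - 0) ^ n * g z" "\<And>z. z \<in> ball 0 r \<Longrightarrow> g z \<noteq> 0"
    then show ?thesis by (intro exI[of _ g] exI[of _ r] exI[of _ n] conjI ballI)
  qed simp
  then obtain g r n where g: "0 < n" "0 < r" "ball 0 r \<subseteq> ball (0::complex) 1" "g holomorphic_on ball 0 r"
      "\<And>z. z \<in> ball 0 r \<Longrightarrow> h z = (z - 0) ^ n * g z" "\<And>z. z \<in> ball 0 r \<Longrightarrow> g z \<noteq> 0"
    by blast
  define k where "k = (\<lambda>z. if norm z < r then g z else h z / z ^ n)"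
  have k1: "k holomorphic_on ball 0 r"
    using g(4) by (rule holomorphic_transform) (simp add: k_def)
  have "(\<lambda>z. h z / z ^ n) holomorphic_on ball 0 1 - {0}"
    by (intro holomorphic_intros holomorphic_on_subset[OF h]) auto
  then have k2: "k holomorphic_on ball 0 1 - {0}"
    by (rule holomorphic_transform) (use g(5) in \<open>auto simp: k_def\<close>)
  have "k holomorphic_on ball 0 r \<union> (ball 0 1 - {0})"
    by (rule holomorphic_on_Un[OF k1 k2]) auto
  moreover have "ball 0 r \<union> (ball 0 1 - {0}) = ball (0::complex) 1" using g(2,3) by auto
  ultimately have "k holomorphic_on ball 0 1" by simp
  then show ?thesis
  proof (rule that[of k n])
    show "k 0 \<noteq> 0" using g(2,6) by (simp add: k_def)
    show "h z = z ^ n * k z" if "z \<in> ball 0 1" for z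
      using g(5)[of z] that g(2) by (auto simp: k_def)
  qed
qed

text \<open>Rotating \<open>f\<close> and \<open>z\<close> together replaces \<open>g'\<close> by \<open>\<zeta> \<mapsto> g' (u \<zeta>)\<close>, which is holomorphic in \<open>u\<close>;
  the maximum principle in \<open>u\<close> reduces a general symbol to a monomial.\<close>

lemma T_bounded_imp_monomial_bound:
  assumes g: "g holomorphic_on ball 0 1" and T: "T_bounded_Hinf s \<nu> g"
    and nc: "\<not> (\<exists>c. \<forall>z\<in>ball 0 1. g z = c)"
    and m: "(\<lambda>z. \<nu> z * indicator (ball 0 1) z) \<in> borel_measurable borel"
    and rad: "\<And>c z. norm c = 1 \<Longrightarrow> \<nu> (c * z) = \<nu> z"
  obtains n M where "0 \<le> M" "\<And>f \<rho>. in_D s \<nu> f \<Longrightarrow> 0 < \<rho> \<Longrightarrow> \<rho> < 1 \<Longrightarrow>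
    norm (integral {0..1} (\<lambda>x. f (of_real (x * \<rho>)) * of_real ((x * \<rho>) ^ n * \<rho>))) \<le> M * D_norm s \<nu> f"
proof -
  have dg: "deriv g holomorphic_on ball 0 1" by (rule holomorphic_deriv[OF g open_ball])
  have "\<not> (\<forall>z\<in>ball 0 1. deriv g z = 0)"
  proof
    assume z: "\<forall>z\<in>ball 0 1. deriv g z = 0"
    have "(g has_field_derivative 0) (at z within ball 0 1)" if "z \<in> ball 0 1" for z
      using holomorphic_derivI[OF g open_ball that] z that by simp
    then obtain c where "\<And>z. z \<in> ball 0 1 \<Longrightarrow> g z = c"
      using has_field_derivative_zero_constant[OF convex_ball, of 0 1 g] by blast
    with nc show False by blast
  qed
  then obtain n k where k: "k holomorphic_on ball 0 1" "k 0 \<noteq> 0" "\<And>z. z \<in> ball 0 1 \<Longrightarrow> deriv g z = z ^ n * k z"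
    using holomorphic_factor_at_zero[OF dg] by blast
  obtain B where B: "\<And>f z. in_D s \<nu> f \<Longrightarrow> z \<in> ball 0 1 \<Longrightarrow> norm (T_op g f z) \<le> B * D_norm s \<nu> f"
    using T unfolding T_bounded_Hinf_def by blast
  define M where "M = max B 0 / norm (k 0)"
  show ?thesis
  proof (rule that[of M n])
    show "0 \<le> M" by (simp add: M_def)
    fix f and \<rho> :: real assume f: "in_D s \<nu> f" and \<rho>: "0 < \<rho>" "\<rho> < 1"
    have fh: "f holomorphic_on ball 0 1" using f by (simp add: in_D_def)
    define b where "b = (\<lambda>x::real. f (of_real (x * \<rho>)) * of_real ((x * \<rho>) ^ n * \<rho>))"
    \<comment> \<open>For |u| = 1, u^(n+1) \<open>\<Psi> u\<close> is the operator applied to a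
      rotation of \<open>f\<close>, evaluated at u \<open>\<rho>\<close>, so it is bounded by the
      norm of \<open>f\<close>. At u = 0 only \<open>k 0\<close>, the leading coefficient of g',
      survives. Since \<open>\<rho>\<close> < 1, \<open>\<Psi>\<close> is holomorphic beyond the
      closed unit disc.\<close>
    define \<Psi> where "\<Psi> = (\<lambda>u. integral {0..1} (\<lambda>x. b x * k (u * of_real (x * \<rho>))))"
    define U where "U = ball (0::complex) (1 / \<rho>)"
    have xr: "norm (u * of_real (x * \<rho>)) < 1" if "u \<in> U" "x \<in> {0..1}" for u x
    proof -
      have "norm u * (x * \<rho>) \<le> norm u * \<rho>" using that \<rho> by (intro mult_left_mono mult_left_le_one_le) auto
      also have "\<dots> < 1" using that \<rho> by (simp add: U_def field_simps)
      finally show ?thesis using that \<rho> by (simp add: norm_mult)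
    qed
    have cf: "continuous_on (ball 0 1) f" by (rule holomorphic_on_imp_continuous_on[OF fh])
    have xr0: "x * \<rho> < 1" "0 \<le> x * \<rho>" if "x \<in> {0..1}" for x
    proof -
    have "x * \<rho> \<le> 1 * \<rho>" using that \<rho> by (intro mult_right_mono) auto
    then show "x * \<rho> < 1" using \<rho> by linarith
    show "0 \<le> x * \<rho>" using that \<rho> by simp
  qed
    have cb: "continuous_on {0..1} b"
      unfolding b_def
      by (intro continuous_intros continuous_on_compose2[OF cf]) (use xr0 in \<open>auto simp del: of_real_mult\<close>)
    have ck: "continuous_on (ball 0 1) k" "continuous_on (ball 0 1) (deriv k)"
      by (auto intro!: holomorphic_on_imp_continuous_on k(1) holomorphic_deriv)
    have hol: "\<Psi> holomorphic_on U"
      unfolding \<Psi>_def cbox_interval[symmetric]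
    proof (rule leibniz_rule_holomorphic)
      show "((\<lambda>u. b x * k (u * of_real (x * \<rho>))) has_field_derivative b x * (deriv k (u * of_real (x * \<rho>)) * of_real (x * \<rho>))) (at u within U)"
        if "u \<in> U" "x \<in> cbox 0 1" for u x
      proof -
        have "u * of_real (x * \<rho>) \<in> ball 0 1" using xr[of u x] that by auto
        from holomorphic_derivI[OF k(1) open_ball this, of UNIV]
        have "(k has_field_derivative deriv k (u * of_real (x * \<rho>))) (at (u * of_real (x * \<rho>)))" by simp
        moreover have "((\<lambda>u. u * of_real (x * \<rho>)) has_field_derivative of_real (x * \<rho>)) (at u within U)"
          by (auto intro!: derivative_eq_intros)
        ultimately have "((\<lambda>u. k (u * of_real (x * \<rho>))) has_field_derivative deriv k (u * of_real (x * \<rho>)) * of_real (x * \<rho>)) (at u within U)"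
          by (rule DERIV_chain2)
        then show ?thesis by (rule DERIV_cmult)
      qed
      show "(\<lambda>x. b x * k (u * of_real (x * \<rho>))) integrable_on cbox 0 1" if "u \<in> U" for u
        unfolding cbox_interval
        by (intro integrable_continuous_interval continuous_intros cb continuous_on_compose2[OF ck(1)])
           (use xr[OF that] in auto)
      show "continuous_on (U \<times> cbox 0 1) (\<lambda>(u, x). b x * (deriv k (u * of_real (x * \<rho>)) * of_real (x * \<rho>)))"
        unfolding case_prod_beta cbox_interval
        by (intro continuous_intros continuous_on_compose2[OF cb] continuous_on_compose2[OF ck(2)])
           (use xr in auto)
      show "convex U" by (simp add: U_def)
    qed
    have "1 < 1 / \<rho>" using \<rho> by simp
    then have sub: "cball 0 1 \<subseteq> U" by (auto simp: U_def)
    have bd: "norm (\<Psi> u) \<le> B * D_norm s \<nu> f" if u: "norm u = 1" for u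
    proof -
      have cu: "norm (cnj u) = 1" using u by simp
      have uu: "cnj u * u = 1" using u by (metis complex_norm_square mult.commute of_real_1 power_one)
      \<comment> \<open>Rotating back by \<open>cnj u\<close> gives fu (u y) = f y, so along the
        radius through u only the symbol sees the rotation.\<close>
      define fu where "fu = (\<lambda>z. f (cnj u * z))"
      have fuh: "fu holomorphic_on ball 0 1"
        unfolding fu_def
        by (rule holomorphic_on_compose_gen[of "\<lambda>z. cnj u * z" _ f "ball 0 1", unfolded o_def])
           (use fh cu in \<open>auto intro!: holomorphic_intros simp: norm_mult\<close>)
      have eq: "D_normpow s \<nu> fu = D_normpow s \<nu> f"
        unfolding fu_def by (rule D_normpow_rotation[OF fh cu m rad[OF cu]])
      have "norm (T_op g fu (u * of_real \<rho>)) \<le> B * D_norm s \<nu> fu"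
        using f fuh eq u \<rho> by (intro B) (auto simp: in_D_def norm_mult)
      also have "D_norm s \<nu> fu = D_norm s \<nu> f" by (simp add: D_norm_def eq)
      also have "T_op g fu (u * of_real \<rho>) = integral {0..1} (\<lambda>x. u ^ Suc n * (b x * k (u * of_real (x * \<rho>))))"
        unfolding T_op_eq_integral
      proof (rule integral_cong)
        fix x :: real assume x: "x \<in> {0..1}"
        define y where "y = complex_of_real (x * \<rho>)"
        have e: "of_real x * (u * of_real \<rho>) = u * y" by (simp add: y_def mult_ac)
        have "u * y \<in> ball 0 1" using xr[of u x] x u sub by (auto simp: y_def subset_iff)
        then have d: "deriv g (u * y) = (u * y) ^ n * k (u * y)" by (rule k(3))
        have fy: "fu (u * y) = f y" using uu by (simp add: fu_def mult.assoc[symmetric])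
        show "fu (of_real x * (u * of_real \<rho>)) * deriv g (of_real x * (u * of_real \<rho>)) * (u * of_real \<rho>)
          = u ^ Suc n * (b x * k (u * of_real (x * \<rho>)))"
          unfolding e d fy b_def y_def[symmetric] by (simp add: power_mult_distrib y_def mult_ac)
      qed
      also have "\<dots> = u ^ Suc n * \<Psi> u" by (simp add: \<Psi>_def)
      finally show ?thesis using u by (simp add: norm_mult norm_power)
    qed
    have "norm (\<Psi> 0) \<le> B * D_norm s \<nu> f"
    proof (rule maximum_modulus_frontier[of \<Psi> "cball 0 1"])
      show "\<Psi> holomorphic_on interior (cball 0 1)"
        by (rule holomorphic_on_subset[OF hol]) (use sub in auto)
      show "continuous_on (closure (cball 0 1)) \<Psi>"
        using continuous_on_subset[OF holomorphic_on_imp_continuous_on[OF hol] sub] by simp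
    qed (use bd in auto)
    also have "\<dots> \<le> max B 0 * D_norm s \<nu> f" by (intro mult_right_mono) auto
    also have "\<Psi> 0 = integral {0..1} b * k 0" by (simp add: \<Psi>_def)
    finally show "norm (integral {0..1} (\<lambda>x. f (of_real (x * \<rho>)) * of_real ((x * \<rho>) ^ n * \<rho>))) \<le> M * D_norm s \<nu> f"
      using k(2) unfolding b_def[symmetric] M_def by (simp add: norm_mult field_simps)
  qed
qed

text \<open>The pole 1 / (1 - d) lies at distance at least d beyond the point 1, so |1 - (1 - d) z|
  is at least half of the larger of d and |1 - z|. Used for the bumps, and with 1 - d = s for the
  Poisson-type factor.\<close>

lemma norm_one_minus_mult_ge:
  fixes z :: complex
  assumes "norm z < 1" "0 < d" "d \<le> 1"
  shows "d \<le> norm (1 - of_real (1 - d) * z)" "norm (1 - z) / 2 \<le> norm (1 - of_real (1 - d) * z)"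
proof -
  define A where "A = complex_of_real (1 - d) * z"
  have "norm (complex_of_real (1 - d)) = 1 - d" unfolding norm_of_real using assms by simp
  then have "norm A \<le> (1 - d) * 1" unfolding A_def norm_mult using assms by (intro mult_mono) auto
  moreover have "1 - norm A \<le> norm (1 - A)" using norm_triangle_ineq2[of 1 A] by simp
  ultimately have 1: "d \<le> norm (1 - A)" by simp
  then show "d \<le> norm (1 - of_real (1 - d) * z)" by (simp only: A_def)
  have "1 - z = (1 - A) - of_real d * z" by (simp add: A_def algebra_simps)
  then have "norm (1 - z) \<le> norm (1 - A) + norm (of_real d * z)" by (metis norm_triangle_ineq4)
  moreover have "norm (of_real d * z) \<le> d * 1" unfolding norm_mult using assms by (intro mult_mono) auto
  ultimately have "norm (1 - z) / 2 \<le> norm (1 - A)" using 1 by linarith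
  then show "norm (1 - z) / 2 \<le> norm (1 - of_real (1 - d) * z)" by (simp only: A_def)
qed

text \<open>A bump of height about 1 and width \<open>d\<close> at the boundary point 1, vanishing to order \<open>L\<close> there.\<close>

definition bump :: "nat \<Rightarrow> nat \<Rightarrow> real \<Rightarrow> complex \<Rightarrow> complex" where
  "bump L M d z = ((1 - z) / of_real d) ^ L * (of_real d / (1 - of_real (1 - d) * z)) ^ (L + M)"

lemma bump_holomorphic:
  assumes "0 < d" "d \<le> 1"
  shows "bump L M d holomorphic_on ball 0 1"
proof -
  have "1 - of_real (1 - d) * z \<noteq> 0" if "norm z < 1" for z :: complex
    using norm_one_minus_mult_ge(1)[OF that assms] assms by auto
  then show ?thesis unfolding bump_def using assms by (intro holomorphic_intros) auto
qed

text \<open>At distance about e from 1: the zero of order L gives decay (e/d)^L at scales e finer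
  than d. At coarser scales L factors of the kernel compensate the zero, as |1 - z| is at most twice
  the denominator, and the remaining M factors give (d/e)^M.\<close>

lemma bump_norm_le:
  fixes z :: complex
  assumes z: "norm z < 1" and d: "0 < d" "d \<le> 1" and e: "0 < e" "e \<le> norm (1 - z)" "norm (1 - z) \<le> 2 * e"
  shows "norm (bump L M d z) \<le> 2 ^ (L + M) * (e / d) ^ L" "norm (bump L M d z) \<le> 2 ^ (L + M) * (d / e) ^ M"
proof -
  define D where "D = norm (1 - of_real (1 - d) * z)"
  define \<delta> where "\<delta> = norm (1 - z)"
  have D: "d \<le> D" "\<delta> / 2 \<le> D" unfolding D_def \<delta>_def using norm_one_minus_mult_ge[OF z d] by auto
  have D0: "0 < D" using D d by linarith
  have nb: "norm (bump L M d z) = (\<delta> / d) ^ L * (d / D) ^ (L + M)"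
    using d by (simp add: bump_def norm_mult norm_power norm_divide D_def \<delta>_def)
  have "(\<delta> / d) ^ L * (d / D) ^ (L + M) \<le> (2 * e / d) ^ L * 1"
  proof (rule mult_mono)
    show "(\<delta> / d) ^ L \<le> (2 * e / d) ^ L" using d e by (intro power_mono divide_right_mono) (auto simp: \<delta>_def)
    show "(d / D) ^ (L + M) \<le> 1" using D D0 d by (intro power_le_one) auto
  qed (use d D0 e in auto)
  also have "\<dots> = 2 ^ L * (e / d) ^ L" by (simp add: power_mult_distrib power_divide)
  also have "\<dots> \<le> 2 ^ (L + M) * (e / d) ^ L" using d e by (intro mult_right_mono power_increasing) auto
  finally show "norm (bump L M d z) \<le> 2 ^ (L + M) * (e / d) ^ L" unfolding nb .
  have "(\<delta> / d) ^ L * (d / D) ^ (L + M) = (\<delta> / D) ^ L * (d / D) ^ M"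
    using d D0 by (simp add: power_add power_divide)
  also have "\<dots> \<le> 2 ^ L * (2 * d / e) ^ M"
  proof (intro mult_mono power_mono)
    show "\<delta> / D \<le> 2" using D D0 by (simp add: field_simps)
    have "e \<le> 2 * D" using D e unfolding \<delta>_def by linarith
    then have "d * e \<le> d * (2 * D)" using d by (intro mult_left_mono) auto
    then show "d / D \<le> 2 * d / e" using D0 e by (simp add: field_simps)
  qed (use d D0 e in \<open>auto simp: \<delta>_def\<close>)
  also have "\<dots> = 2 ^ (L + M) * (d / e) ^ M" by (simp add: power_add power_mult_distrib power_divide)
  finally show "norm (bump L M d z) \<le> 2 ^ (L + M) * (d / e) ^ M" unfolding nb .
qed

lemma bump_of_real:
  "bump L M d (of_real x) = of_real (((1 - x) / d) ^ L * (d / (1 - (1 - d) * x)) ^ (L + M))"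
  by (simp add: bump_def)

lemma bump_real_nonneg:
  assumes "0 < d" "d \<le> 1" "0 \<le> x" "x < 1"
  shows "0 \<le> Re (bump L M d (of_real x))"
proof -
  have "(1 - d) * x \<le> 1 * 1" using assms by (intro mult_mono) auto
  then show ?thesis unfolding bump_of_real Re_complex_of_real using assms by simp
qed

lemma bump_real_ge:
  assumes d: "0 < d" "d \<le> 1" and x: "1 - d \<le> x" "x \<le> 1 - d / 2"
  shows "(1/2) ^ L * (1/2) ^ (L + M) \<le> Re (bump L M d (of_real x))"
  unfolding bump_of_real Re_complex_of_real
proof (intro mult_mono power_mono)
  show "1/2 \<le> (1 - x) / d" using d x by (simp add: field_simps)
  have "(1 - d) * (1 - d) \<le> (1 - d) * x" using d x by (intro mult_left_mono) auto
  then have a: "1 - (1 - d) * x \<le> 2 * d" 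
  proof -
    have "(1 - d) * (1 - d) = 1 - 2 * d + d * d" by (simp add: algebra_simps)
    then show ?thesis using \<open>(1 - d) * (1 - d) \<le> (1 - d) * x\<close> zero_le_square[of d] by linarith
  qed
  have "(1 - d) * x \<le> (1 - d) * 1" using d x by (intro mult_left_mono) auto
  then have b: "d \<le> 1 - (1 - d) * x" by simp
  show "1/2 \<le> d / (1 - (1 - d) * x)" using a b d by (simp add: field_simps)
qed (use d x in auto)

text \<open>On the radius the bump is nonnegative, so Re F increases; it gains at least c d / 2 over
  [1 - d, 1 - d/2], where the bump is at least c. Integrating this gain over [1 - d/2, 1 - d/4]
  yields order d^2. The exponent collects c, a factor (1/2)^n from the monomial, and 1/8 from the
  two interval lengths.\<close>

lemma bump_primitive_integral_ge:
  assumes d: "0 < d" "d \<le> 1" and \<rho>: "1 - d / 4 \<le> \<rho>" "\<rho> < 1"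
    and F: "F holomorphic_on ball 0 1" "F 0 = 0" "\<And>z. z \<in> ball 0 1 \<Longrightarrow> (F has_field_derivative bump L M d z) (at z)"
  shows "(1/2) ^ (2 * L + M + n + 3) * \<rho> * d\<^sup>2 \<le> Re (integral {0..1} (\<lambda>x. F (of_real (x * \<rho>)) * of_real ((x * \<rho>) ^ n * \<rho>)))"
proof -
  define c where "c = (1/2::real) ^ L * (1/2) ^ (L + M)"
  define R where "R = (\<lambda>x. Re (F (of_real x)))"
  have \<rho>0: "0 < \<rho>" using d \<rho> by linarith
  have R': "(R has_real_derivative Re (bump L M d (of_real x))) (at x)" if "0 \<le> x" "x < 1" for x
  proof -
    have "(F has_field_derivative bump L M d (of_real x)) (at (of_real x))" using that by (intro F(3)) auto
    then have "((\<lambda>x. F (of_real x)) has_vector_derivative bump L M d (of_real x)) (at x)"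
      by (rule has_vector_derivative_real_field)
    then have "(R has_vector_derivative Re (bump L M d (of_real x))) (at x)"
      unfolding R_def by (rule bounded_linear.has_vector_derivative[OF bounded_linear_Re])
    then show ?thesis by (simp add: has_real_derivative_iff_has_vector_derivative)
  qed
  have Rmono: "R a \<le> R b" if "0 \<le> a" "a \<le> b" "b < 1" for a b
  proof (rule DERIV_nonneg_imp_nondecreasing[OF that(2)])
    fix x assume "a \<le> x" "x \<le> b"
    then show "\<exists>y. (R has_real_derivative y) (at x) \<and> 0 \<le> y"
      using R'[of x] bump_real_nonneg[OF d, of x L M] that by auto
  qed
  have R0: "R 0 = 0" using F(2) by (simp add: R_def)
  have Rpos: "0 \<le> R x" if "0 \<le> x" "x < 1" for x using Rmono[of 0 x] that R0 by simp
  have Rge: "c * (d / 2) \<le> R x" if "1 - d / 2 \<le> x" "x < 1" for x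
  proof -
    have "R (1 - d) - c * (1 - d) \<le> R (1 - d / 2) - c * (1 - d / 2)"
    proof (rule DERIV_nonneg_imp_nondecreasing[of _ _ "\<lambda>x. R x - c * x"])
      fix x assume x: "1 - d \<le> x" "x \<le> 1 - d / 2"
      have "((\<lambda>x. R x - c * x) has_real_derivative Re (bump L M d (of_real x)) - c) (at x)"
        using x d by (auto intro!: derivative_eq_intros R')
      moreover have "c \<le> Re (bump L M d (of_real x))" unfolding c_def by (rule bump_real_ge[OF d x])
      ultimately show "\<exists>y. ((\<lambda>x. R x - c * x) has_real_derivative y) (at x) \<and> 0 \<le> y" by auto
    qed (use d in simp)
    moreover have "0 \<le> R (1 - d)" using d by (intro Rpos) auto
    moreover have "R (1 - d / 2) \<le> R x" using that d by (intro Rmono) auto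
    ultimately show ?thesis by (simp add: algebra_simps)
  qed
  define I where "I = (\<lambda>x. F (of_real (x * \<rho>)) * of_real ((x * \<rho>) ^ n * \<rho>))"
  define J where "J = (\<lambda>x. R (x * \<rho>) * ((x * \<rho>) ^ n * \<rho>))"
  have cF: "continuous_on (ball 0 1) F" by (rule holomorphic_on_imp_continuous_on[OF F(1)])
  have xr0: "x * \<rho> < 1" "0 \<le> x * \<rho>" if "x \<in> {0..1}" for x
  proof -
    have "x * \<rho> \<le> 1 * \<rho>" using that \<rho> \<rho>0 by (intro mult_right_mono) auto
    then show "x * \<rho> < 1" using \<rho> by linarith
    show "0 \<le> x * \<rho>" using that \<rho> \<rho>0 by simp
  qed
  have cI: "continuous_on {0..1} I"
    unfolding I_def by (intro continuous_intros continuous_on_compose2[OF cF]) (use xr0 in \<open>auto simp del: of_real_mult\<close>)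
  have IJ: "Re (I x) = J x" for x by (simp add: I_def J_def R_def)
  have int: "(J has_integral Re (integral {0..1} I)) {0..1}"
    using has_integral_linear[OF integrable_integral[OF integrable_continuous_interval[OF cI]] bounded_linear_Re]
    by (simp add: o_def IJ)
  \<comment> \<open>The points x with x \<open>\<rho>\<close> in [1 - d/2, 1 - d/4]; b <= 1 is
    exactly the lower bound assumed for \<open>\<rho>\<close>.\<close>
  define a b where "a = (1 - d / 2) / \<rho>" and "b = (1 - d / 4) / \<rho>"
  have ab: "0 \<le> a" "a \<le> b" "b \<le> 1" using d \<rho> \<rho>0 by (auto simp: a_def b_def divide_right_mono)
  define K where "K = c * (d / 2) * ((1/2) ^ n * \<rho>)"
  have cJ: "continuous_on {0..1} J"
    using continuous_on_Re[OF cI] by (simp add: IJ)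
  have cJ': "continuous_on {a..b} J" by (rule continuous_on_subset[OF cJ]) (use ab in auto)
  have "K * (b - a) = integral {a..b} (\<lambda>_. K)" using ab by simp
  also have "\<dots> \<le> integral {a..b} J"
    proof (rule integral_le)
      fix x assume x: "x \<in> {a..b}"
      have x01: "x \<in> {0..1}" using x ab by auto
      have "1 - d / 2 \<le> x * \<rho>" using x \<rho>0 by (simp add: a_def field_simps)
      moreover have "1/2 \<le> 1 - d / 2" using d by simp
      ultimately have xh: "1 - d / 2 \<le> x * \<rho>" "1/2 \<le> x * \<rho>" by linarith+
      show "K \<le> J x" unfolding K_def J_def
        using Rge[OF xh(1) xr0(1)[OF x01]] xh \<rho>0 d
        by (intro mult_mono power_mono) (auto simp: Rpos xr0[OF x01])
    qed (use integrable_continuous_interval[OF cJ'] in auto)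
  also have "\<dots> \<le> integral {0..1} J"
  proof (rule integral_subset_le)
    show "\<forall>x\<in>{0..1}. 0 \<le> J x"
      unfolding J_def using Rpos xr0 \<rho>0 by auto
  qed (use ab integrable_continuous_interval[OF cJ'] integrable_continuous_interval[OF cJ] in auto)
  also have "\<dots> = Re (integral {0..1} I)" using int by (rule integral_unique)
  finally have le: "K * (b - a) \<le> Re (integral {0..1} I)" .
  have "b - a = d / 4 / \<rho>" by (simp add: a_def b_def diff_divide_distrib[symmetric])
  then have "K * (b - a) = c * (1/2) ^ n * (1/8) * d\<^sup>2"
    using \<rho>0 by (simp add: K_def power2_eq_square)
  moreover have "(1/2) ^ (2 * L + M + n + 3) = c * (1/2) ^ n * (1/8)"
  proof -
    have "2 * L + M + n + 3 = L + (L + M) + n + 3" "(1/2::real) ^ 3 = 1/8" by (simp_all add: power3_eq_cube)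
    then show ?thesis by (simp only: c_def power_add)
  qed
  moreover have "(1/2) ^ (2 * L + M + n + 3) * \<rho> * d\<^sup>2 \<le> (1/2) ^ (2 * L + M + n + 3) * 1 * d\<^sup>2"
    using \<rho> by (intro mult_right_mono mult_left_mono) auto
  ultimately show ?thesis using le unfolding I_def by (simp only: mult_1_right)
qed

section \<open>Sums of bumps as test functions\<close>

context upper_doubling_exponent
begin

lemma weight_measurable: "(\<lambda>z::complex. \<omega> (norm z) * indicator (ball 0 1) z) \<in> borel_measurable borel"
proof -
  have "(\<lambda>z::complex. indicator {0..<1} (norm z) * \<omega> (norm z)) \<in> borel_measurable borel"
    by (rule measurable_compose[OF borel_measurable_norm omega_measurable])
  moreover have "(\<lambda>z::complex. indicator {0..<1} (norm z) * \<omega> (norm z)) = (\<lambda>z. \<omega> (norm z) * indicator (ball 0 1) z)"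
    by (auto simp: fun_eq_iff split: split_indicator)
  ultimately show ?thesis by simp
qed

text \<open>The weights of the bumps, chosen so that equality holds in Hoelder's inequality.\<close>

definition \<alpha> :: "nat \<Rightarrow> real" where
  "\<alpha> n = ((1/2)^n / w n) powr (q - 1)"

lemma \<alpha>_pos: "0 < \<alpha> n"
  using w_pos[of n] by (simp add: \<alpha>_def)

text \<open>The pairing side: the weight times the d^2 gained from one bump. In
  \<open>\<alpha>_powr\<close>, the norm side, d w bounds, up to a constant, the weighted mass of
  the region of size d at the point 1. Both sides equal \<open>t n\<close>.\<close>

lemma \<alpha>_mult: "\<alpha> n * ((1/2)^n)\<^sup>2 = t n"
proof -
  define d :: real where "d = (1/2)^n"
  have d: "0 < d" by (simp add: d_def)
  have "d powr (q - 1) * d\<^sup>2 = d powr (q + 1)"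
    using d powr_add[of d "q - 1" 2] by (simp add: powr_numeral add.commute)
  then show ?thesis using d w_pos[of n] by (simp add: \<alpha>_def t_def powr_divide d_def[symmetric])
qed

lemma \<alpha>_powr: "\<alpha> n powr p * ((1/2)^n * w n) = t n"
proof -
  define d :: real where "d = (1/2)^n"
  have d: "0 < d" by (simp add: d_def)
  have "(q - 1) * p = q" using p_mult_q_minus_1 by (simp add: mult.commute)
  then have "\<alpha> n powr p = d powr q / w n powr q"
    using d w_pos[of n] by (simp add: \<alpha>_def powr_powr d_def[symmetric] powr_divide)
  moreover have "d powr q * d = d powr (q + 1)" using d powr_add[of d q 1] by simp
  moreover have "w n powr q = w n powr (q - 1) * w n" using w_pos[of n] powr_add[of "w n" "q - 1" 1] by simp
  ultimately show ?thesis using w_pos[of n] by (simp add: t_def d_def[symmetric])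
qed

text \<open>This bounds the decrease of the weights per dyadic step, and \<open>\<alpha>_le2\<close>
  their increase; the bump orders L and M are chosen to beat the respective rates.\<close>

lemma \<alpha>_le: "\<alpha> n \<le> (2 powr (q - 1)) ^ i * \<alpha> (n + i)"
proof (induction i)
  case (Suc i)
  have "(1/2) ^ (n + i) / w (n + i) \<le> 2 * ((1/2) ^ (Suc (n + i)) / w (Suc (n + i)))"
    using w_antimono[of "n + i" "Suc (n + i)"] w_pos by (simp add: divide_left_mono)
  then have "\<alpha> (n + i) \<le> (2 * ((1/2) ^ (Suc (n + i)) / w (Suc (n + i)))) powr (q - 1)"
    unfolding \<alpha>_def using q_gt_1 w_pos[of "n + i"] by (intro powr_mono2) auto
  also have "\<dots> = 2 powr (q - 1) * \<alpha> (Suc (n + i))"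
    unfolding \<alpha>_def using w_pos[of "Suc (n + i)"] by (subst powr_mult) auto
  finally have "(2 powr (q - 1)) ^ i * \<alpha> (n + i) \<le> (2 powr (q - 1)) ^ i * (2 powr (q - 1) * \<alpha> (Suc (n + i)))"
    by (intro mult_left_mono) auto
  from order_trans[OF Suc this] show ?case by (simp add: mult_ac)
qed simp

lemma \<alpha>_le2: "\<alpha> (n + i) \<le> (C powr (q - 1)) ^ i * \<alpha> n"
proof (induction i)
  case (Suc i)
  have "(1/2) ^ (Suc (n + i)) / w (Suc (n + i)) \<le> C * ((1/2) ^ (n + i) / w (n + i))"
  proof -
    have "(1/2::real) ^ (Suc (n + i)) * w (n + i) \<le> (1/2) ^ (n + i) * (C * w (Suc (n + i)))"
      using w_doubling[of "n + i"] w_pos[of "n + i"] by (intro mult_mono) auto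
    then show ?thesis using w_pos[of "n + i"] w_pos[of "Suc (n + i)"]
      by (simp add: field_simps)
  qed
  then have "\<alpha> (Suc (n + i)) \<le> (C * ((1/2) ^ (n + i) / w (n + i))) powr (q - 1)"
    unfolding \<alpha>_def using q_gt_1 w_pos[of "Suc (n + i)"] by (intro powr_mono2) auto
  also have "\<dots> = C powr (q - 1) * \<alpha> (n + i)"
    unfolding \<alpha>_def using w_pos[of "n + i"] C_ge_1 by (subst powr_mult) auto
  also have "\<dots> \<le> C powr (q - 1) * ((C powr (q - 1)) ^ i * \<alpha> n)" by (intro mult_left_mono Suc) auto
  finally show ?case by (simp add: mult_ac)
qed simp

text \<open>Where |1 - z| is about 2^-j, the weighted bumps decay at least like 2^-|n-j| away from n
  = j: L makes 2^(q-1) 2^-L <= 1/2, and M makes C^(q-1) 2^-M <= 1/2. So |F'| is at most a multiple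
  of \<open>\<alpha> j\<close> there, and \<open>W_ball_le\<close> bounds the mass of the region by
  a multiple of 2^-j \<open>w j\<close>.\<close>

lemma test_function_norm:
  assumes L: "q \<le> real L" and M: "2 * C powr (q - 1) \<le> 2 ^ M"
    and F: "F holomorphic_on ball 0 1" "F 0 = 0"
      "\<And>z. z \<in> ball 0 1 \<Longrightarrow> (F has_field_derivative (\<Sum>n\<le>N. of_real (\<alpha> n) * bump L M ((1/2)^n) z)) (at z)"
  shows "D_normpow p (\<lambda>z. \<omega> (norm z)) F \<le> ennreal (16 * C * (4 * 2 ^ (L + M)) powr p * (\<Sum>n\<le>N. t n))"
proof -
  define d where "d = (\<lambda>n::nat. (1/2::real)^n)"
  have d0: "0 < d n" "d n \<le> 1" for n by (auto simp: d_def power_le_one)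
  have dd: "d (n + i) / d n = (1/2)^i" for n i by (simp add: d_def power_add)
  define K where "K = 4 * (2::real) ^ (L + M)"
  have K0: "0 < K" by (simp add: K_def)
  have rL: "2 powr (q - 1) * (1/2) ^ L \<le> (1/2 :: real)"
  proof -
    have "2 powr (q - 1) \<le> 2 powr (real L - 1)" using L by simp
    also have "\<dots> = 2 ^ L / 2" by (simp add: powr_diff powr_realpow)
    finally show ?thesis by (simp add: power_divide field_simps)
  qed
  have rM: "C powr (q - 1) * (1/2) ^ M \<le> (1/2 :: real)" using M by (simp add: power_divide field_simps)
  have dF: "deriv F z = (\<Sum>n\<le>N. of_real (\<alpha> n) * bump L M (d n) z)" if "norm z < 1" for z
    using F(3)[of z] that unfolding d_def by (intro DERIV_imp_deriv) simp
  have pt: "norm (deriv F z) \<le> K * \<alpha> (min j N)"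
    if z: "norm z < 1" and j: "d j \<le> norm (1 - z)" "norm (1 - z) \<le> 2 * d j" for z j
  proof -
    \<comment> \<open>Closer to 1 than the width of the finest bump, the N-th weight still
      dominates.\<close>
    define j' where "j' = min j N"
    have "norm (deriv F z) \<le> (\<Sum>n\<le>N. \<alpha> n * norm (bump L M (d n) z))"
      unfolding dF[OF z] using \<alpha>_pos by (intro sum_norm_le) (simp add: norm_mult less_imp_le)
    also have "\<dots> \<le> (\<Sum>n\<le>N. 2 ^ (L + M) * \<alpha> j' * (if n \<le> j' then (1/2) ^ (j' - n) else (1/2) ^ (n - j')))"
    proof (rule sum_mono)
      fix n assume n: "n \<in> {..N}"
      show "\<alpha> n * norm (bump L M (d n) z) \<le> 2 ^ (L + M) * \<alpha> j' * (if n \<le> j' then (1/2) ^ (j' - n) else (1/2) ^ (n - j'))"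
      proof (cases "n \<le> j'")
        case True
        have "d j \<le> d j'" unfolding d_def j'_def by (intro power_decreasing) auto
        have "norm (bump L M (d n) z) \<le> 2 ^ (L + M) * (d j / d n) ^ L"
          by (rule bump_norm_le(1)[OF z d0(1) d0(2) d0(1) j])
        also have "\<dots> \<le> 2 ^ (L + M) * (d j' / d n) ^ L"
          using \<open>d j \<le> d j'\<close> d0(1)[of n] d0(1)[of j] by (intro mult_left_mono power_mono divide_right_mono) auto
        also have "d j' / d n = (1/2) ^ (j' - n)" using dd[of n "j' - n"] True by simp
        finally have 1: "norm (bump L M (d n) z) \<le> 2 ^ (L + M) * ((1/2) ^ (j' - n)) ^ L" .
        have 2: "\<alpha> n \<le> (2 powr (q - 1)) ^ (j' - n) * \<alpha> j'" using \<alpha>_le[of n "j' - n"] True by simp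
        have "\<alpha> n * norm (bump L M (d n) z) \<le> ((2 powr (q - 1)) ^ (j' - n) * \<alpha> j') * (2 ^ (L + M) * ((1/2) ^ (j' - n)) ^ L)"
          using \<alpha>_pos by (intro mult_mono 1 2) (auto simp: less_imp_le)
        also have "\<dots> = 2 ^ (L + M) * \<alpha> j' * (2 powr (q - 1) * (1/2) ^ L) ^ (j' - n)"
          by (simp add: power_mult_distrib power_mult[symmetric] mult_ac)
        also have "\<dots> \<le> 2 ^ (L + M) * \<alpha> j' * (1/2) ^ (j' - n)"
          using \<alpha>_pos[of j'] by (intro mult_left_mono power_mono rL) auto
        finally show ?thesis using True by simp
      next
        case False
        then have jn: "j' = j" "j < n" using n by (auto simp: j'_def min_def split: if_splits)
        have "norm (bump L M (d n) z) \<le> 2 ^ (L + M) * (d n / d j) ^ M"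
          by (rule bump_norm_le(2)[OF z d0(1) d0(2) d0(1) j])
        also have "d n / d j = (1/2) ^ (n - j)" using dd[of j "n - j"] jn by simp
        finally have 1: "norm (bump L M (d n) z) \<le> 2 ^ (L + M) * ((1/2) ^ (n - j)) ^ M" .
        have 2: "\<alpha> n \<le> (C powr (q - 1)) ^ (n - j) * \<alpha> j" using \<alpha>_le2[of j "n - j"] jn by simp
        have "\<alpha> n * norm (bump L M (d n) z) \<le> ((C powr (q - 1)) ^ (n - j) * \<alpha> j) * (2 ^ (L + M) * ((1/2) ^ (n - j)) ^ M)"
          using \<alpha>_pos by (intro mult_mono 1 2) (auto simp: less_imp_le)
        also have "\<dots> = 2 ^ (L + M) * \<alpha> j * (C powr (q - 1) * (1/2) ^ M) ^ (n - j)"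
          by (simp add: power_mult_distrib power_mult[symmetric] mult_ac)
        also have "\<dots> \<le> 2 ^ (L + M) * \<alpha> j * (1/2) ^ (n - j)"
          using \<alpha>_pos[of j] by (intro mult_left_mono power_mono rM) auto
        finally show ?thesis using False jn by simp
      qed
    qed
    also have "\<dots> = 2 ^ (L + M) * \<alpha> j' * (\<Sum>n\<le>N. if n \<le> j' then (1/2) ^ (j' - n) else (1/2) ^ (n - j'))"
      by (simp only: sum_distrib_left)
    also have "\<dots> \<le> 2 ^ (L + M) * \<alpha> j' * (suminf (\<lambda>i. (1/2) ^ i) + suminf (\<lambda>i. (1/2) ^ i))"
      using \<alpha>_pos[of j'] by (intro mult_left_mono sum_two_sided_le_suminf) (auto intro!: summable_geometric)
    also have "\<dots> = K * \<alpha> j'" by (simp add: suminf_geometric K_def)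
    finally show ?thesis by (simp add: j'_def)
  qed
  \<comment> \<open>A point with |1 - z| <= 2 d j has |z| >= 1 - 2 d j = 1 - d (j - 1); for j = 0
    truncated subtraction gives the vacuous condition |z| >= 0. The radius 4 d j turns the
    inequality |1 - z| <= 2 d j into a strict one.\<close>
  define E where "E = (\<lambda>j z. W z * indicator (ball 1 (4 * d j)) z * indicator {z. 1 - d (j - 1) \<le> norm z} z)"
  have E_le: "(\<integral>\<^sup>+ z. E j z \<partial>lborel) \<le> ennreal (16 * pi * C * (d j * w j))" for j
  proof -
    have "(\<integral>\<^sup>+ z. E j z \<partial>lborel) \<le> ennreal (4 * pi * (4 * d j) * w (j - 1))"
      unfolding E_def w_def d_def[symmetric] using d0[of "j - 1"] d0[of j] W_ball_le[of "4 * d j" "1 - d (j - 1)"] by (simp add: d_def)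
    also have "\<dots> \<le> ennreal (4 * pi * (4 * d j) * (C * w j))"
    proof (intro ennreal_leI mult_left_mono)
      show "w (j - 1) \<le> C * w j"
      proof (cases j)
        case 0
        then show ?thesis using C_ge_1 w_pos[of 0] mult_right_mono[of 1 C "w 0"] by simp
      next
        case (Suc i)
        then show ?thesis using w_doubling[of i] by simp
      qed
    qed (use d0 in \<open>simp add: less_imp_le\<close>)
    also have "4 * pi * (4 * d j) * (C * w j) = 16 * pi * C * (d j * w j)" by simp
    finally show ?thesis .
  qed
  have Em: "E j \<in> borel_measurable borel" for j unfolding E_def by measurable
  have "D_normpow p (\<lambda>z. \<omega> (norm z)) F
     = (\<integral>\<^sup>+ z. ennreal (norm (deriv F z) powr p * \<omega> (norm z) / pi) * indicator (ball 0 1) z \<partial>lborel)"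
    using F(2) p_gt_1 by (simp add: D_normpow_def)
  also have "\<dots> \<le> (\<integral>\<^sup>+ z. (\<Sum>j\<le>N. ennreal ((K * \<alpha> j) powr p / pi) * E j z) \<partial>lborel)"
    (is "(\<integral>\<^sup>+ z. ?f z \<partial>_) \<le> (\<integral>\<^sup>+ z. ?g z \<partial>_)")
  proof (rule nn_integral_mono)
    fix z :: complex
    show "?f z \<le> ?g z"
    proof (cases "norm z < 1")
      case True
      have z1: "0 < norm (1 - z)" "norm (1 - z) < 2"
        using True norm_triangle_ineq4[of 1 z] by auto
      obtain j where j: "(1/2)^Suc j < norm (1 - z) / 2" "norm (1 - z) / 2 \<le> (1/2)^j"
        using dyadic_block_exists[of "norm (1 - z) / 2"] z1 by auto
      have j1: "d j \<le> norm (1 - z)" "norm (1 - z) \<le> 2 * d j" using j by (auto simp: d_def)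
      define j' where "j' = min j N"
      have jj: "d j \<le> d j'" unfolding d_def j'_def by (intro power_decreasing) auto
      have om: "0 \<le> \<omega> (norm z)" using True by (simp add: omega_nonneg)
      have "norm (deriv F z) powr p \<le> (K * \<alpha> j') powr p"
        unfolding j'_def using p_gt_1 by (intro powr_mono2 pt[OF True j1]) auto
      then have "norm (deriv F z) powr p * \<omega> (norm z) / pi \<le> (K * \<alpha> j') powr p * \<omega> (norm z) / pi"
        using om by (intro divide_right_mono mult_right_mono) auto
      then have "ennreal (norm (deriv F z) powr p * \<omega> (norm z) / pi) \<le> ennreal ((K * \<alpha> j') powr p / pi * \<omega> (norm z))"
        by (intro ennreal_leI) simp
      also have "\<dots> = ennreal ((K * \<alpha> j') powr p / pi) * ennreal (\<omega> (norm z))" by (rule ennreal_mult') simp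
      also have "ennreal (\<omega> (norm z)) = E j' z"
      proof -
        have "norm (1 - z) < 4 * d j'" using j1 jj d0(1)[of j'] by linarith
        moreover have "1 - d (j' - 1) \<le> norm z"
        proof (cases j')
          case 0
          then show ?thesis by (simp add: d_def)
        next
          case (Suc i)
          then have "d (j' - 1) = 2 * d j'" by (simp add: d_def)
          moreover have "1 - norm z \<le> norm (1 - z)" using norm_triangle_ineq2[of 1 z] by simp
          ultimately show ?thesis using j1 jj by linarith
        qed
        ultimately show ?thesis using True by (simp add: E_def W_def dist_norm)
      qed
      also have "ennreal ((K * \<alpha> j') powr p / pi) * E j' z \<le> (\<Sum>j\<le>N. ennreal ((K * \<alpha> j) powr p / pi) * E j z)"
        by (rule member_le_sum) (auto simp: j'_def)
      finally show ?thesis using True by simp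
    qed auto
  qed
  also have "\<dots> = (\<Sum>j\<le>N. ennreal ((K * \<alpha> j) powr p / pi) * (\<integral>\<^sup>+ z. E j z \<partial>lborel))"
    using Em by (subst nn_integral_sum) (auto intro!: sum.cong nn_integral_cmult)
  also have "\<dots> \<le> (\<Sum>j\<le>N. ennreal (16 * C * K powr p * t j))"
  proof (rule sum_mono)
    fix j
    have "ennreal ((K * \<alpha> j) powr p / pi) * (\<integral>\<^sup>+ z. E j z \<partial>lborel)
      \<le> ennreal ((K * \<alpha> j) powr p / pi) * ennreal (16 * pi * C * (d j * w j))"
      by (intro mult_left_mono E_le) auto
    also have "\<dots> = ennreal ((K * \<alpha> j) powr p / pi * (16 * pi * C * (d j * w j)))"
      by (rule ennreal_mult'[symmetric]) simp
    also have "(K * \<alpha> j) powr p / pi * (16 * pi * C * (d j * w j)) = 16 * C * K powr p * (\<alpha> j powr p * (d j * w j))"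
      using K0 \<alpha>_pos[of j] by (simp add: powr_mult)
    also have "\<alpha> j powr p * (d j * w j) = t j" unfolding d_def by (rule \<alpha>_powr)
    finally show "ennreal ((K * \<alpha> j) powr p / pi) * (\<integral>\<^sup>+ z. E j z \<partial>lborel) \<le> ennreal (16 * C * K powr p * t j)" .
  qed
  also have "\<dots> = ennreal (16 * C * K powr p * (\<Sum>j\<le>N. t j))"
    unfolding sum_distrib_left using t_pos C_ge_1 by (intro sum_ennreal) (auto simp: less_imp_le)
  finally show ?thesis by (simp only: K_def)
qed

lemma T_bounded_imp_constant:
  assumes NS: "\<not> summable t" and g: "g holomorphic_on ball 0 1" and T: "T_bounded_Hinf p (\<lambda>z. \<omega> (norm z)) g"
  shows "\<exists>c. \<forall>z\<in>ball 0 1. g z = c"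
proof (rule ccontr)
  assume nc: "\<not> (\<exists>c. \<forall>z\<in>ball 0 1. g z = c)"
  let ?\<nu> = "\<lambda>z::complex. \<omega> (norm z)"
  have rad: "\<omega> (norm (c * z)) = \<omega> (norm z)" if "norm c = 1" for c z :: complex
    using that by (simp add: norm_mult)
  obtain n M0 where M0: "0 \<le> M0" "\<And>f \<rho>. in_D p ?\<nu> f \<Longrightarrow> 0 < \<rho> \<Longrightarrow> \<rho> < 1 \<Longrightarrow>
    norm (integral {0..1} (\<lambda>x. f (of_real (x * \<rho>)) * of_real ((x * \<rho>) ^ n * \<rho>))) \<le> M0 * D_norm p ?\<nu> f"
    by (rule T_bounded_imp_monomial_bound[OF g T nc weight_measurable rad]) (assumption, rule that)
  \<comment> \<open>The orders needed for the two geometric decays in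
    \<open>test_function_norm\<close>.\<close>
  obtain L :: nat where L: "q \<le> real L" using real_arch_simple by blast
  obtain M :: nat where "2 * C powr (q - 1) < 2 ^ M" using real_arch_pow[of 2 "2 * C powr (q - 1)"] by auto
  then have M: "2 * C powr (q - 1) \<le> 2 ^ M" by simp
  define K where "K = 16 * C * (4 * 2 ^ (L + M)) powr p"
  have K0: "0 \<le> K" using C_ge_1 by (simp add: K_def)
  \<comment> \<open>The constant of \<open>bump_primitive_integral_ge\<close>, with one further
    factor 1/2 from \<open>\<rho>\<close> >= 1/2.\<close>
  define c where "c = (1/2::real) ^ (2 * L + M + n + 4)"
  have c0: "0 < c" by (simp add: c_def)
  define S where "S N = (\<Sum>n\<le>N. t n)" for N
  have S0: "0 \<le> S N" for N unfolding S_def using t_pos by (intro sum_nonneg) (simp add: less_imp_le)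
  \<comment> \<open>The form \<open>- 0\<close> matches \<open>bounded_by_self_powr\<close>; here no
    initial term is lost.\<close>
  have bnd: "S N - 0 \<le> M0 * K powr (1 / p) / c * S N powr (1 / p)" for N
  proof -
    have "\<exists>F. F holomorphic_on ball 0 1 \<and> F 0 = 0 \<and>
        (\<forall>z\<in>ball 0 1. (F has_field_derivative bump L M ((1/2)^i) z) (at z))" for i :: nat
      using primitive_on_unit_ball[OF bump_holomorphic[of "(1/2)^i" L M]] by (metis power_le_one zero_less_power half_gt_zero_iff zero_less_one less_imp_le divide_le_eq_1 one_le_numeral zero_less_divide_1_iff zero_less_numeral)
    then obtain F where F: "\<And>i::nat. F i holomorphic_on ball 0 1" "\<And>i::nat. F i 0 = 0"
        "\<And>(i::nat) z. z \<in> ball 0 1 \<Longrightarrow> (F i has_field_derivative bump L M ((1/2)^i) z) (at z)" by metis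
    define f where "f = (\<lambda>z. \<Sum>i\<le>N. of_real (\<alpha> i) * F i z)"
    have fh: "f holomorphic_on ball 0 1" unfolding f_def by (intro holomorphic_intros F)
    have f0: "f 0 = 0" by (simp add: f_def F)
    have f': "(f has_field_derivative (\<Sum>i\<le>N. of_real (\<alpha> i) * bump L M ((1/2)^i) z)) (at z)" if "z \<in> ball 0 1" for z
      unfolding f_def by (intro DERIV_sum DERIV_cmult F(3)[OF that])
    have up: "D_normpow p ?\<nu> f \<le> ennreal (K * S N)"
      unfolding K_def S_def by (rule test_function_norm[OF L M fh f0 f'])
    then have inD: "in_D p ?\<nu> f" using fh by (auto simp: in_D_def intro: le_less_trans)
    \<comment> \<open>Close enough to 1 for \<open>\<rho>\<close> >= 1 - d / 4 to hold for the
      widths of all bumps i <= N simultaneously.\<close>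
    define \<rho> where "\<rho> = 1 - (1/2::real) ^ (N + 2)"
    have "(1/2::real) ^ (N + 2) \<le> (1/2) ^ 2" by (intro power_decreasing) auto
    then have \<rho>: "1/2 \<le> \<rho>" "\<rho> < 1" by (auto simp: \<rho>_def power2_eq_square)
    define I where "I = (\<lambda>f::complex \<Rightarrow> complex. integral {0..1} (\<lambda>x. f (of_real (x * \<rho>)) * complex_of_real ((x * \<rho>) ^ n * \<rho>)))"
    have xr0: "x * \<rho> < 1 \<and> 0 \<le> x * \<rho>" if "x \<in> {0..1}" for x
    proof -
      have "x * \<rho> \<le> 1 * \<rho>" using that \<rho> by (intro mult_right_mono) auto
      then have "x * \<rho> < 1" using \<rho> by linarith
      then show ?thesis using \<rho> that by auto
    qed
    have int: "(\<lambda>x. F i (of_real (x * \<rho>)) * complex_of_real ((x * \<rho>) ^ n * \<rho>)) integrable_on {0..1}" for i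
      by (intro integrable_continuous_interval continuous_intros
          continuous_on_compose2[OF holomorphic_on_imp_continuous_on[OF F(1)]])
         (use xr0 in \<open>auto simp del: of_real_mult\<close>)
    have "I f = integral {0..1} (\<lambda>x. \<Sum>i\<le>N. of_real (\<alpha> i) * (F i (of_real (x * \<rho>)) * complex_of_real ((x * \<rho>) ^ n * \<rho>)))"
      unfolding I_def f_def sum_distrib_right by (simp only: mult.assoc)
    also have "\<dots> = (\<Sum>i\<le>N. integral {0..1} (\<lambda>x. of_real (\<alpha> i) * (F i (of_real (x * \<rho>)) * complex_of_real ((x * \<rho>) ^ n * \<rho>))))"
      by (intro integral_sum integrable_on_cmult_left int) auto
    also have "\<dots> = (\<Sum>i\<le>N. of_real (\<alpha> i) * I (F i))" unfolding I_def by (simp only: integral_mult_right)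
    finally have "Re (I f) = (\<Sum>i\<le>N. \<alpha> i * Re (I (F i)))" by simp
    moreover have "(\<Sum>i\<le>N. c * t i) \<le> (\<Sum>i\<le>N. \<alpha> i * Re (I (F i)))"
    proof (rule sum_mono)
      fix i assume i: "i \<in> {..N}"
      define d :: real where "d = (1/2) ^ i"
      have d: "0 < d" "d \<le> 1" by (auto simp: d_def power_le_one)
      have "(1/2::real) ^ (N + 2) \<le> (1/2) ^ (i + 2)" using i by (intro power_decreasing) auto
      then have \<rho>d: "1 - d / 4 \<le> \<rho>" by (simp add: \<rho>_def d_def)
      have "(1/2) ^ (2 * L + M + n + 3) * \<rho> * d\<^sup>2 \<le> Re (I (F i))"
        unfolding I_def
        by (rule bump_primitive_integral_ge[OF d \<rho>d \<rho>(2) F(1,2)]) (unfold d_def, rule F(3))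
      moreover have "(1/2) ^ (2 * L + M + n + 3) * (1/2) * d\<^sup>2 \<le> (1/2) ^ (2 * L + M + n + 3) * \<rho> * d\<^sup>2"
        using \<rho> by (intro mult_right_mono mult_left_mono) auto
      moreover have "c = (1/2) ^ (2 * L + M + n + 3) * (1/2)"
        unfolding c_def by (simp add: power_add power_divide)
      ultimately have "c * d\<^sup>2 \<le> Re (I (F i))" by (simp only:)
      then have "\<alpha> i * (c * d\<^sup>2) \<le> \<alpha> i * Re (I (F i))" using \<alpha>_pos[of i] by (intro mult_left_mono) auto
      moreover have "\<alpha> i * (c * d\<^sup>2) = c * t i" using \<alpha>_mult[of i] by (simp add: d_def[symmetric] mult_ac)
      ultimately show "c * t i \<le> \<alpha> i * Re (I (F i))" by simp
    qed
    ultimately have "c * S N \<le> Re (I f)" by (simp add: S_def sum_distrib_left)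
    also have "\<dots> \<le> norm (I f)" by (rule complex_Re_le_cmod)
    also have "\<dots> \<le> M0 * D_norm p ?\<nu> f" unfolding I_def using \<rho> by (intro M0(2) inD) auto
    also have "\<dots> \<le> M0 * (K * S N) powr (1 / p)"
      using p_gt_1 K0 S0 M0(1) by (intro mult_left_mono D_norm_le up) auto
    also have "(K * S N) powr (1 / p) = K powr (1 / p) * S N powr (1 / p)" using K0 S0 by (simp add: powr_mult)
    finally have "S N * c \<le> M0 * K powr (1 / p) * S N powr (1 / p)" by (simp add: mult_ac)
    then show ?thesis using c0 by (simp add: pos_le_divide_eq)
  qed
  have "summable t"
  proof (rule bounded_imp_summable)
    show "0 \<le> t n" for n using t_pos by (simp add: less_imp_le)
    fix N
    show "(\<Sum>n\<le>N. t n) \<le> max (2 * 0) ((2 * (M0 * K powr (1 / p) / c)) powr q)"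
      unfolding S_def[symmetric]
      by (rule bounded_by_self_powr[OF p_gt_1 conjugate _ S0 _ _ bnd])
         (use q_gt_1 c0 M0(1) in auto)
  qed
  with NS show False by simp
qed

subsection \<open>Volterra operators when the sum converges\<close>

text \<open>The factor \<open>(1 - s\<^sup>2) / (1 - s z)\<close> is 1 at \<open>z = s\<close> and upgrades the Cauchy kernel
  \<open>1 / (z - s)\<close> to one with Poisson-type decay away from the point 1.\<close>

lemma norm_le_poisson_type_integral:
  assumes h: "h holomorphic_on ball 0 1" and s: "1 - (1/2)^n \<le> s" "s < 1 - (1/2)^Suc n"
  shows "ennreal (w n * norm (h (of_real s))) \<le> ennreal (20 * C\<^sup>2 / pi) *
    (\<integral>\<^sup>+ z. W z * indicator {z. 1 - (1/2)^n \<le> norm z} z * ennreal (norm (h z) * ((1/2)^n / (max ((1/2)^n) (norm (1 - z)))\<^sup>2)) \<partial>lborel)"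
proof -
  define d :: real where "d = (1/2)^n"
  have d: "0 < d" "d \<le> 1" by (auto simp: d_def power_le_one)
  have s': "1 - d \<le> s" "s < 1 - d / 2" using s by (auto simp: d_def)
  \<comment> \<open>Averaging only beyond 1 - d/4 leaves a gap of d/4 between \<open>s\<close> and
    the circles, so the Cauchy kernel is at most 4/d; two doubling steps, hence the factor C^2,
    compare the tail at \<open>r\<close> with \<open>w n\<close>.\<close>
  define r where "r = 1 - d / 4"
  have r2: "r = 1 - (1/2)^(n + 2)" by (simp add: r_def d_def)
  have s0: "0 \<le> s" "s < 1" using s' d by linarith+
  have sr: "norm (complex_of_real s) < r" "1/2 \<le> r" "s < r" using s0 s' d by (auto simp: r_def)
  define F where "F = (\<lambda>z. h z * (of_real (1 - s\<^sup>2) / (1 - of_real s * z)))"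
  have ps: "0 < 1 - s" "1 - s \<le> 1" using s0 by auto
  have ge: "1 - s \<le> norm (1 - of_real s * z)" "norm (1 - z) / 2 \<le> norm (1 - of_real s * z)" if "norm z < 1" for z :: complex
    using norm_one_minus_mult_ge[OF that ps] by (auto simp del: of_real_diff)
  have nz: "1 - of_real s * z \<noteq> 0" if "norm z < 1" for z :: complex
    using ge(1)[OF that] ps by auto
  have Fh: "F holomorphic_on ball 0 1"
    unfolding F_def using nz by (intro holomorphic_intros h) auto
  have "1 - complex_of_real s * of_real s = of_real (1 - s\<^sup>2)" by (simp add: power2_eq_square)
  moreover have "1 - s\<^sup>2 \<noteq> 0" using s0 power_strict_mono[of s 1 2] by simp
  ultimately have Fs: "F (of_real s) = h (of_real s)" unfolding F_def by (simp only: divide_self_if of_real_eq_0_iff if_False mult_1_right)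
  \<comment> \<open>With m = max d |1 - z|, 20 = 2 * 2 * 5 comes from 1 - s^2 <= 2 d, |1 - s z| >=
    m/2 and |z - s| >= m/5. The last holds because |z - s| >= d/4 and |1 - z| <= d + |z -
    s|.\<close>
  have ker: "norm (F z) * norm z / norm (z - of_real s) \<le> 20 * (norm (h z) * (d / (max d (norm (1 - z)))\<^sup>2))"
    if z: "r \<le> norm z" "norm z < 1" for z
  proof -
    define m where "m = max d (norm (1 - z))"
    have m0: "0 < m" using d by (simp add: m_def)
    define a where "a = norm (1 - of_real s * z)"
    define b where "b = norm (z - of_real s)"
    have a: "m / 2 \<le> a" using ge[OF z(2)] s' unfolding a_def[symmetric] m_def by (auto simp: max_def)
    have "norm z - s \<le> b" using norm_triangle_ineq2[of z "of_real s"] s0 by (simp add: b_def)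
    then have b1: "d / 4 \<le> b" using z s' unfolding r_def by linarith
    have "norm (1 - z) = norm (of_real (1 - s) - (z - of_real s))" by simp
    also have "\<dots> \<le> norm (complex_of_real (1 - s)) + b" unfolding b_def by (rule norm_triangle_ineq4)
    also have "norm (complex_of_real (1 - s)) = 1 - s" unfolding norm_of_real using ps by simp
    finally have "norm (1 - z) \<le> 5 * b" using b1 s' by linarith
    then have b: "m / 5 \<le> b" using b1 d unfolding m_def by (auto simp: max_def)
    have c: "1 - s\<^sup>2 \<le> 2 * d"
    proof -
      have "1 - s\<^sup>2 = (1 + s) * (1 - s)" by (simp add: power2_eq_square algebra_simps)
      also have "\<dots> \<le> 2 * d" using s0 s' by (intro mult_mono) auto
      finally show ?thesis .
    qed
    have c0: "0 \<le> 1 - s\<^sup>2" using s0 by (simp add: power_le_one)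
    have "norm (F z) * norm z / b = norm (h z) * ((1 - s\<^sup>2) / a * (norm z / b))"
    proof -
      have "norm (complex_of_real (1 - s\<^sup>2)) = 1 - s\<^sup>2" unfolding norm_of_real using c0 by simp
      then show ?thesis unfolding F_def a_def norm_mult norm_divide by simp
    qed
    also have "\<dots> \<le> norm (h z) * ((2 * d) / (m / 2) * (1 / (m / 5)))"
      using a b c c0 d m0 z by (intro mult_left_mono mult_mono frac_le) auto
    also have "\<dots> = 20 * (norm (h z) * (d / m\<^sup>2))" using m0 by (simp add: power2_eq_square field_simps)
    finally show ?thesis by (simp add: b_def m_def)
  qed
  have [measurable]: "(\<lambda>z. indicator (ball 0 1) z *\<^sub>R h z) \<in> borel_measurable borel"
    by (intro borel_measurable_continuous_on_indicator holomorphic_on_imp_continuous_on h) auto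
  define I where "I = (\<integral>\<^sup>+ z. W z * indicator {z. 1 - d \<le> norm z} z * ennreal (norm (h z) * (d / (max d (norm (1 - z)))\<^sup>2)) \<partial>lborel)"
  have Ieq: "I = (\<integral>\<^sup>+ z. W z * indicator {z. 1 - d \<le> norm z} z * ennreal (norm (indicator (ball 0 1) z *\<^sub>R h z) * (d / (max d (norm (1 - z)))\<^sup>2)) \<partial>lborel)"
    unfolding I_def by (intro nn_integral_cong) (auto simp: W_def split: split_indicator)
  have "ennreal (pi * omega_hat \<omega> r * norm (h (of_real s)))
    \<le> (\<integral>\<^sup>+ z. W z * indicator {z. r \<le> norm z} z * ennreal (norm (F z) * norm z / norm (z - of_real s)) \<partial>lborel)"
    using norm_le_W_integral[OF Fh sr(1,2)] by (simp only: Fs)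
  also have "\<dots> \<le> (\<integral>\<^sup>+ z. ennreal 20 * (W z * indicator {z. 1 - d \<le> norm z} z * ennreal (norm (indicator (ball 0 1) z *\<^sub>R h z) * (d / (max d (norm (1 - z)))\<^sup>2))) \<partial>lborel)"
    (is "(\<integral>\<^sup>+ z. ?f z \<partial>_) \<le> (\<integral>\<^sup>+ z. ?g z \<partial>_)")
  proof (rule nn_integral_mono)
    fix z
    show "?f z \<le> ?g z"
    proof (cases "r \<le> norm z \<and> norm z < 1")
      case True
      have "ennreal (norm (F z) * norm z / norm (z - of_real s)) \<le> ennreal (20 * (norm (h z) * (d / (max d (norm (1 - z)))\<^sup>2)))"
        using True by (intro ennreal_leI ker) auto
      also have "\<dots> = ennreal 20 * ennreal (norm (h z) * (d / (max d (norm (1 - z)))\<^sup>2))"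
        by (rule ennreal_mult') simp
      finally have "W z * ennreal (norm (F z) * norm z / norm (z - of_real s)) \<le> W z * (ennreal 20 * ennreal (norm (h z) * (d / (max d (norm (1 - z)))\<^sup>2)))"
        by (intro mult_left_mono) auto
      then show ?thesis using True d by (simp add: r_def mult_ac)
    qed (auto simp: W_def)
  qed
  also have "\<dots> = ennreal 20 * I" unfolding Ieq by (rule nn_integral_cmult) measurable
  finally have *: "ennreal (pi * omega_hat \<omega> r * norm (h (of_real s))) \<le> ennreal 20 * I" .
  have "w n \<le> C\<^sup>2 * omega_hat \<omega> r" using w_le_power[of n 2] by (simp add: w_def r2)
  then have "w n * norm (h (of_real s)) \<le> C\<^sup>2 * omega_hat \<omega> r * norm (h (of_real s))" by (intro mult_right_mono) auto
  also have "\<dots> = C\<^sup>2 / pi * (pi * omega_hat \<omega> r * norm (h (of_real s)))" by simp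
  finally have "ennreal (w n * norm (h (of_real s))) \<le> ennreal (C\<^sup>2 / pi * (pi * omega_hat \<omega> r * norm (h (of_real s))))"
    by (rule ennreal_leI)
  also have "\<dots> = ennreal (C\<^sup>2 / pi) * ennreal (pi * omega_hat \<omega> r * norm (h (of_real s)))"
    by (rule ennreal_mult') simp
  also have "\<dots> \<le> ennreal (C\<^sup>2 / pi) * (ennreal 20 * I)" by (intro mult_left_mono *) auto
  also have "\<dots> = ennreal (20 * C\<^sup>2 / pi) * I"
  proof -
    have "ennreal (C\<^sup>2 / pi) * ennreal 20 = ennreal (C\<^sup>2 / pi * 20)" by (rule ennreal_mult'[symmetric]) simp
    also have "C\<^sup>2 / pi * 20 = 20 * C\<^sup>2 / pi" by simp
    finally show ?thesis by (simp only: mult.assoc[symmetric])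
  qed
  finally show ?thesis unfolding I_def d_def .
qed

text \<open>The integrand is what Young's inequality leaves on the dual side: the q-th power of the
  Poisson-type kernel times \<open>offdiag\<close> to the power 1 - q. With u = 2^(n-j) the relative
  size of |1 - z|, \<open>W_ball_le\<close> gives mass of order u 2^-n \<open>w n\<close>. For u >=
  1 the kernel is at most of order u^(-2) u^(1/2), since q > 1, and for u <= 1 of order u^(-1/2).
  The products decay like u^(-1/2) and u^(1/2), that is by \<open>\<gamma>\<close> = 2^(-1/2) per
  scale on both sides.\<close>

lemma W_kernel_integral_le:
  obtains K where "0 \<le> K" "\<And>n. (\<integral>\<^sup>+ z. W z * indicator {z. 1 - (1/2)^n \<le> norm z} z *
    ennreal ((max 1 (norm (1 - z) / (1/2)^n)) powr (- 2 * q) * sqrt (max (norm (1 - z) / (1/2)^n) ((1/2)^n / norm (1 - z)))) \<partial>lborel)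
      \<le> ennreal (K * ((1/2)^n * w n))"
proof -
  define \<gamma> where "\<gamma> = sqrt 2 / 2"
  have sq: "sqrt 2 < 2" using real_sqrt_less_mono[of 2 4] by simp
  have \<gamma>: "0 \<le> \<gamma>" "\<gamma> < 1" using sq by (auto simp: \<gamma>_def)
  have s1: "summable (\<lambda>i. 2 * \<gamma> ^ i)" using \<gamma> by (intro summable_mult summable_geometric) auto
  define K2 where "K2 = (\<Sum>i. 2 * \<gamma> ^ i) + (\<Sum>i. 2 * \<gamma> ^ i)"
  have K2: "0 \<le> K2" unfolding K2_def using \<gamma> by (intro add_nonneg_nonneg suminf_nonneg s1) auto
  show ?thesis
  proof (rule that[of "16 * pi * K2"])
    show "0 \<le> 16 * pi * K2" using K2 by simp
    fix n :: nat
    define d where "d = (\<lambda>n::nat. (1/2::real)^n)"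
    have d0: "0 < d j" "d j \<le> 1" for j by (auto simp: d_def power_le_one)
    define c where "c = (\<lambda>j. if j \<le> n then 2 * ((1/4) ^ (n - j) * sqrt 2 ^ (n - j)) else 2 * sqrt 2 ^ (j - n))"
    have c0: "0 \<le> c j" for j by (simp add: c_def)
    have cd: "c j * d j = d n * (if j \<le> n then 2 * \<gamma> ^ (n - j) else 2 * \<gamma> ^ (j - n))" for j
    proof (cases "j \<le> n")
      case True
      then obtain i where i: "n = j + i" using le_Suc_ex by blast
      have "(1/4::real) ^ i * sqrt 2 ^ i = (1/2) ^ i * \<gamma> ^ i"
        unfolding power_mult_distrib[symmetric] by (simp add: \<gamma>_def)
      then show ?thesis by (simp add: c_def i d_def power_add mult_ac)
    next
      case False
      then obtain i where i: "j = n + i" "0 < i" using le_Suc_ex[of n j] by auto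
      have "sqrt 2 ^ i * (1/2::real) ^ i = \<gamma> ^ i"
        unfolding power_mult_distrib[symmetric] by (simp add: \<gamma>_def)
      then show ?thesis using i by (simp add: c_def d_def power_add mult_ac)
    qed
    define f where "f = (\<lambda>z::complex. (max 1 (norm (1 - z) / d n)) powr (- 2 * q) * sqrt (max (norm (1 - z) / d n) (d n / norm (1 - z))))"
    have pt: "f z \<le> c j" if j: "d j \<le> norm (1 - z)" "norm (1 - z) \<le> 2 * d j" for z j
    proof (cases "j \<le> n")
      case True
      then obtain i where i: "n = j + i" using le_Suc_ex by blast
      define u where "u = norm (1 - z) / d n"
      have dj: "d j = 2 ^ i * d n" by (simp add: d_def i power_add power_divide)
      have u: "2 ^ i \<le> u" "u \<le> 2 * 2 ^ i" using j d0(1)[of n] unfolding dj u_def by (auto simp: field_simps)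
      have u1: "1 \<le> u" using u one_le_power[of "2::real" i] by linarith
      have "(max 1 u) powr (- 2 * q) \<le> (2 ^ i) powr (- 2 * q)"
        using u u1 q_gt_1 by (intro powr_mono2') auto
      also have "\<dots> \<le> (2 ^ i) powr (- 2)" using q_gt_1 by (intro powr_mono) auto
      also have "\<dots> = (1/4) ^ i"
        by (simp add: powr_minus_divide powr_numeral power_divide power_mult[symmetric] mult.commute[of i] power_mult)
      finally have 1: "(max 1 u) powr (- 2 * q) \<le> (1/4) ^ i" .
      have "1 / u \<le> 1" using u1 by simp
      then have "max u (1 / u) = u" using u1 by (intro max_absorb1) linarith
      then have "sqrt (max u (1 / u)) \<le> sqrt (2 * 2 ^ i)" using u by simp
      also have "\<dots> \<le> 2 * sqrt 2 ^ i"
        using sq by (simp add: real_sqrt_mult real_sqrt_power)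
      finally have 2: "sqrt (max u (1 / u)) \<le> 2 * sqrt 2 ^ i" .
      have "f z = (max 1 u) powr (- 2 * q) * sqrt (max u (1 / u))" by (simp add: f_def u_def)
      also have "\<dots> \<le> (1/4) ^ i * (2 * sqrt 2 ^ i)" using u1 by (intro mult_mono 1 2) auto
      finally show ?thesis using True by (simp add: c_def i)
    next
      case False
      then obtain i where i: "j = n + i" "0 < i" using le_Suc_ex[of n j] by auto
      define u where "u = norm (1 - z) / d n"
      have dj: "d j = d n / 2 ^ i" by (simp add: d_def i power_add power_divide)
      have u: "1 / 2 ^ i \<le> u" "u \<le> 2 / 2 ^ i" using j d0(1)[of n] unfolding dj u_def by (auto simp: field_simps)
      have u0: "0 < u" using u(1) by (rule less_le_trans[rotated]) simp
      have "(2::real) ^ 1 \<le> 2 ^ i" using i by (intro power_increasing) auto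
      then have u1: "u \<le> 1" using u(2) by (intro order_trans[OF u(2)]) (simp add: field_simps)
      have "(max 1 u) powr (- 2 * q) = 1" using u1 by (simp add: max_def)
      moreover have "max u (1 / u) = 1 / u"
      proof -
        have "1 \<le> 1 / u" using u0 u1 by simp
        then show ?thesis using u1 by (simp add: max_def)
      qed
      moreover have "sqrt (1 / u) \<le> sqrt (2 ^ i)" using u(1) u0 by (simp add: field_simps)
      ultimately have "f z \<le> sqrt (2 ^ i)" by (simp add: f_def u_def)
      moreover have "0 \<le> sqrt 2 ^ i" by simp
      ultimately have "f z \<le> 2 * sqrt 2 ^ i" unfolding real_sqrt_power by linarith
      then show ?thesis using i by (simp add: c_def)
    qed
    have "(\<integral>\<^sup>+ z. W z * indicator {z. 1 - d n \<le> norm z} z * ennreal (f z) \<partial>lborel)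
      \<le> (\<integral>\<^sup>+ z. (\<Sum>j. ennreal (c j) * (W z * indicator (ball 1 (4 * d j)) z * indicator {z. 1 - d n \<le> norm z} z)) \<partial>lborel)"
    (is "(\<integral>\<^sup>+ z. ?f z \<partial>_) \<le> (\<integral>\<^sup>+ z. ?g z \<partial>_)")
    proof (rule nn_integral_mono)
      fix z :: complex
      show "?f z \<le> ?g z"
      proof (cases "norm z < 1")
        case True
        have z1: "0 < norm (1 - z)" "norm (1 - z) < 2"
          using True norm_triangle_ineq4[of 1 z] by auto
        obtain j where j: "(1/2)^Suc j < norm (1 - z) / 2" "norm (1 - z) / 2 \<le> (1/2)^j"
          using dyadic_block_exists[of "norm (1 - z) / 2"] z1 by auto
        have j1: "d j \<le> norm (1 - z)" "norm (1 - z) \<le> 2 * d j" using j by (auto simp: d_def)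
        have "norm (1 - z) < 4 * d j" using j1 d0(1)[of j] by linarith
        then have ib: "indicator (ball 1 (4 * d j)) z = (1::ennreal)" by (simp add: dist_norm)
        have "W z * indicator {z. 1 - d n \<le> norm z} z * ennreal (f z) \<le> W z * indicator {z. 1 - d n \<le> norm z} z * ennreal (c j)"
          by (intro mult_left_mono ennreal_leI pt[OF j1]) auto
        also have "\<dots> = ennreal (c j) * (W z * indicator (ball 1 (4 * d j)) z * indicator {z. 1 - d n \<le> norm z} z)"
          unfolding ib mult_1_right by (rule mult.commute)
        also have "\<dots> = (\<Sum>j\<in>{j}. ennreal (c j) * (W z * indicator (ball 1 (4 * d j)) z * indicator {z. 1 - d n \<le> norm z} z))"
          by simp
        also have "\<dots> \<le> (\<Sum>j. ennreal (c j) * (W z * indicator (ball 1 (4 * d j)) z * indicator {z. 1 - d n \<le> norm z} z))"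
          by (intro sum_le_suminf) auto
        finally show ?thesis .
      qed (simp add: W_def)
    qed
    also have "\<dots> = (\<Sum>j. ennreal (c j) * (\<integral>\<^sup>+ z. W z * indicator (ball 1 (4 * d j)) z * indicator {z. 1 - d n \<le> norm z} z \<partial>lborel))"
      by (subst nn_integral_suminf) (measurable, auto intro!: suminf_cong nn_integral_cmult)
    also have "\<dots> \<le> (\<Sum>j. ennreal (16 * pi * (c j * d j) * w n))"
    proof (intro suminf_le allI)
      fix j
      have "(\<integral>\<^sup>+ z. W z * indicator (ball 1 (4 * d j)) z * indicator {z. 1 - d n \<le> norm z} z \<partial>lborel) \<le> ennreal (4 * pi * (4 * d j) * w n)"
        using W_ball_le[of "4 * d j" "1 - d n"] d0[of j] d0[of n] by (simp add: w_def d_def)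
      then have "ennreal (c j) * (\<integral>\<^sup>+ z. W z * indicator (ball 1 (4 * d j)) z * indicator {z. 1 - d n \<le> norm z} z \<partial>lborel)
        \<le> ennreal (c j) * ennreal (4 * pi * (4 * d j) * w n)" by (intro mult_left_mono) auto
      also have "\<dots> = ennreal (c j * (4 * pi * (4 * d j) * w n))" by (rule ennreal_mult'[symmetric, OF c0])
      also have "c j * (4 * pi * (4 * d j) * w n) = 16 * pi * (c j * d j) * w n" by simp
      finally show "ennreal (c j) * (\<integral>\<^sup>+ z. W z * indicator (ball 1 (4 * d j)) z * indicator {z. 1 - d n \<le> norm z} z \<partial>lborel)
        \<le> ennreal (16 * pi * (c j * d j) * w n)" .
    qed auto
    also have "\<dots> \<le> ennreal (16 * pi * K2 * (d n * w n))"
      unfolding suminf_eq_SUP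
    proof (rule SUP_least)
      fix N
      have "(\<Sum>j<N. ennreal (16 * pi * (c j * d j) * w n)) = ennreal (\<Sum>j<N. 16 * pi * (c j * d j) * w n)"
        using c0 d0 w_pos[of n] by (intro sum_ennreal mult_nonneg_nonneg) (auto simp: less_imp_le)
      also have "(\<Sum>j<N. 16 * pi * (c j * d j) * w n) = 16 * pi * (d n * w n) * (\<Sum>j<N. if j \<le> n then 2 * \<gamma> ^ (n - j) else 2 * \<gamma> ^ (j - n))"
        unfolding cd by (simp add: sum_distrib_left mult_ac)
      also have "\<dots> \<le> 16 * pi * (d n * w n) * K2"
        unfolding K2_def using \<gamma> d0[of n] w_pos[of n]
        by (intro mult_left_mono sum_two_sided_le_suminf[of _ "\<lambda>i. 2 * \<gamma> ^ i" "\<lambda>i. 2 * \<gamma> ^ i"] s1) auto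
      finally show "(\<Sum>j<N. ennreal (16 * pi * (c j * d j) * w n)) \<le> ennreal (16 * pi * K2 * (d n * w n))"
        by (simp add: mult_ac ennreal_leI)
    qed
    finally show "(\<integral>\<^sup>+ z. W z * indicator {z. 1 - (1/2)^n \<le> norm z} z *
      ennreal ((max 1 (norm (1 - z) / (1/2)^n)) powr (- 2 * q) * sqrt (max (norm (1 - z) / (1/2)^n) ((1/2)^n / norm (1 - z)))) \<partial>lborel)
      \<le> ennreal (16 * pi * K2 * ((1/2)^n * w n))"
      unfolding f_def d_def .
  qed
qed

text \<open>The free parameter will be \<open>\<eta>\<close> times \<open>offdiag\<close>: a small
  \<open>\<eta>\<close> makes the norm term small at the price of the factor \<open>\<eta>\<close>
  to the power 1 - q on the tail of the sum.\<close>

lemma young_weighted: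
  fixes x b \<mu> :: real
  assumes "0 \<le> x" "0 \<le> b" "0 < \<mu>"
  shows "x * b \<le> \<mu> * x powr p + \<mu> powr (1 - q) * b powr q"
proof -
  define a c where "a = \<mu> powr (1 / p) * x" and "c = b * \<mu> powr (- 1 / p)"
  have "\<mu> powr (1 / p) * \<mu> powr (- 1 / p) = 1" using assms by (simp add: powr_add[symmetric])
  then have ac: "a * c = x * b" by (simp add: a_def c_def)
  have "a powr p = \<mu> * x powr p" using assms p_gt_1 by (simp add: a_def powr_mult powr_powr)
  moreover have "c powr q = \<mu> powr (1 - q) * b powr q"
  proof -
    have "- 1 / p * q = 1 - q" using q_div_p by simp
    then show ?thesis using assms unfolding c_def by (simp add: powr_mult powr_powr del: divide_minus_left)
  qed
  moreover have "a * c \<le> a powr p / p + c powr q / q"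
    by (rule Youngs_inequality[OF p_gt_1 q_gt_1 conjugate]) (use assms in \<open>auto simp: a_def c_def\<close>)
  moreover have "a powr p / p \<le> a powr p" "c powr q / q \<le> c powr q"
    using p_gt_1 q_gt_1 by (auto simp: divide_le_eq mult_le_cancel_left1)
  ultimately show ?thesis unfolding ac by linarith
qed

text \<open>Equal to 1 where |1 - z| = 2^-n, and decaying geometrically in the number of dyadic
  scales between |1 - z| and 2^-n. As weight in Young's inequality it lets the norm integral at z be
  counted mainly at its own scale.\<close>

definition offdiag :: "nat \<Rightarrow> complex \<Rightarrow> real" where
  "offdiag n z = min (norm (1 - z) / (1/2)^n) ((1/2)^n / norm (1 - z)) powr ((p - 1) / 2)"

lemma offdiag_measurable [measurable]: "offdiag n \<in> borel_measurable borel"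
  unfolding offdiag_def by measurable

text \<open>The exponent of \<open>offdiag\<close> is chosen so that \<open>offdiag powr (1 - q)\<close> is a square root.\<close>

lemma offdiag_powr:
  assumes "z \<noteq> 1"
  shows "offdiag n z powr (1 - q) = sqrt (max (norm (1 - z) / (1/2)^n) ((1/2)^n / norm (1 - z)))"
proof -
  define u where "u = norm (1 - z) / (1/2)^n"
  have u: "0 < u" using assms by (simp add: u_def)
  have iu: "(1/2)^n / norm (1 - z) = 1 / u" by (simp add: u_def)
  have "(p - 1) / 2 * (1 - q) = - (1/2)"
    using q_minus_1 p_gt_1 by (simp add: field_simps)
  then have "offdiag n z powr (1 - q) = min u (1 / u) powr (- (1/2))"
    unfolding offdiag_def u_def[symmetric] iu by (simp add: powr_powr)
  also have "\<dots> = sqrt (1 / min u (1 / u))"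
    using u by (simp add: powr_minus_divide powr_half_sqrt real_sqrt_divide)
  also have "1 / min u (1 / u) = max u (1 / u)"
  proof (cases "u \<le> 1 / u")
    case True
    then show ?thesis by simp
  next
    case False
    then show ?thesis by simp
  qed
  finally show ?thesis by (simp only: u_def[symmetric] iu)
qed

text \<open>If |1 - z| is about 2^-j, the terms decay geometrically in |n - j|, with a bound
  independent of z and of the shift m.\<close>

lemma offdiag_suminf_le:
  obtains K where "0 \<le> K" "\<And>z m. norm z < 1 \<Longrightarrow> (\<Sum>n. ennreal (offdiag (n + m) z)) \<le> ennreal K"
proof -
  define e where "e = (p - 1) / 2"
  have e: "0 < e" using p_gt_1 by (simp add: e_def)
  define \<theta> :: real where "\<theta> = (1/2) powr e"
  have \<theta>: "0 \<le> \<theta>" "\<theta> < 1" unfolding \<theta>_def using e powr_less_mono'[of "1/2" 0 e] by auto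
  have s1: "summable (\<lambda>i. 2 powr e * \<theta> ^ i)" using \<theta> by (intro summable_mult summable_geometric) auto
  define K where "K = (\<Sum>i. 2 powr e * \<theta> ^ i) + (\<Sum>i. 2 powr e * \<theta> ^ i)"
  show ?thesis
  proof (rule that[of K])
    show "0 \<le> K" unfolding K_def using \<theta> by (intro add_nonneg_nonneg suminf_nonneg s1) auto
    fix z :: complex and m assume z: "norm z < 1"
    have z1: "0 < norm (1 - z)" "norm (1 - z) < 2"
      using z norm_triangle_ineq4[of 1 z] by auto
    obtain j where j: "(1/2)^Suc j < norm (1 - z) / 2" "norm (1 - z) / 2 \<le> (1/2)^j"
      using dyadic_block_exists[of "norm (1 - z) / 2"] z1 by auto
    define \<delta> where "\<delta> = norm (1 - z)"
    have j1: "(1/2)^j \<le> \<delta>" "\<delta> \<le> 2 * (1/2)^j" using j by (auto simp: \<delta>_def)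
    have th: "\<theta> ^ i = ((1/2) ^ i) powr e" for i
      unfolding \<theta>_def by (simp add: powr_realpow[symmetric] powr_powr mult.commute)
    have pt: "offdiag n z \<le> (if n \<le> j then 2 powr e * \<theta> ^ (j - n) else 2 powr e * \<theta> ^ (n - j))" for n
    proof (cases "n \<le> j")
      case True
      then obtain i where i: "j = n + i" using le_Suc_ex by blast
      have "offdiag n z \<le> (2 * (1/2) ^ i) powr e"
        unfolding offdiag_def e_def[symmetric] \<delta>_def[symmetric]
      proof (rule powr_mono2)
        have "\<delta> / (1/2)^n \<le> 2 * (1/2)^j / (1/2)^n" using j1 by (intro divide_right_mono) auto
        then show "min (\<delta> / (1/2)^n) ((1/2)^n / \<delta>) \<le> 2 * (1/2) ^ i" by (simp add: i power_add min.coboundedI1)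
      qed (use e in \<open>auto simp: \<delta>_def\<close>)
      also have "\<dots> = 2 powr e * \<theta> ^ i" by (simp add: powr_mult th)
      finally show ?thesis by (simp add: i)
    next
      case False
      then obtain i where i: "n = j + i" "0 < i" using le_Suc_ex[of j n] by auto
      have "offdiag n z \<le> ((1/2) ^ i) powr e"
        unfolding offdiag_def e_def[symmetric] \<delta>_def[symmetric]
      proof (rule powr_mono2)
        have "(1/2)^n / \<delta> \<le> (1/2)^n / (1/2)^j" using j1 z1(1) by (intro divide_left_mono mult_pos_pos) (auto simp: \<delta>_def)
        then show "min (\<delta> / (1/2)^n) ((1/2)^n / \<delta>) \<le> (1/2) ^ i" by (simp add: i power_add min.coboundedI2)
      qed (use e in \<open>auto simp: \<delta>_def\<close>)
      also have "\<dots> \<le> 2 powr e * \<theta> ^ i"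
        unfolding th using e ge_one_powr_ge_zero[of 2 e] mult_right_mono[of 1 "2 powr e" "((1/2) ^ i) powr e"] by simp
      finally show ?thesis using i by simp
    qed
    show "(\<Sum>n. ennreal (offdiag (n + m) z)) \<le> ennreal K"
      unfolding suminf_eq_SUP
    proof (rule SUP_least)
      fix N
      have "(\<Sum>n<N. ennreal (offdiag (n + m) z)) = ennreal (\<Sum>n<N. offdiag (n + m) z)"
        by (intro sum_ennreal) (simp add: offdiag_def)
      also have "(\<Sum>n<N. offdiag (n + m) z) = (\<Sum>n\<in>(\<lambda>n. n + m) ` {..<N}. offdiag n z)"
        by (subst sum.reindex) auto
      also have "\<dots> \<le> (\<Sum>n\<in>(\<lambda>n. n + m) ` {..<N}. if n \<le> j then 2 powr e * \<theta> ^ (j - n) else 2 powr e * \<theta> ^ (n - j))"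
        by (intro sum_mono pt)
      also have "\<dots> \<le> K"
        unfolding K_def using \<theta>
        by (intro sum_two_sided_le_suminf[of _ "\<lambda>i. 2 powr e * \<theta> ^ i" "\<lambda>i. 2 powr e * \<theta> ^ i"] s1) auto
      finally show "(\<Sum>n<N. ennreal (offdiag (n + m) z)) \<le> ennreal K" by (simp add: ennreal_leI)
    qed
  qed
qed

text \<open>On block n the Poisson-type bound, the factor 1 - s <= 2^-n and the block length combine
  to 4^-n / \<open>w n\<close> times an average over the tail. Young's inequality with weight
  \<open>\<eta>\<close> times \<open>offdiag\<close> splits this into a norm term and a multiple of
  \<open>t n\<close>. A point z lies in all tails with 2^-n >= 1 - |z|, a number without bound near
  the boundary; summability of \<open>offdiag\<close> over n is what keeps the sum of the norm terms
  finite.\<close>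

lemma radial_tail_estimate:
  obtains K where "0 \<le> K" "\<And>h \<eta> m. h holomorphic_on ball 0 1 \<Longrightarrow> 0 < \<eta> \<Longrightarrow>
    (\<integral>\<^sup>+ s. ennreal ((1 - s) * norm (h (of_real s))) * indicator {1 - (1/2)^m..<1} s \<partial>lborel)
      \<le> ennreal K * (ennreal \<eta> * (\<integral>\<^sup>+ z. W z * ennreal (norm (h z) powr p) \<partial>lborel)
          + ennreal (\<eta> powr (1 - q)) * (\<Sum>n. ennreal (t (n + m))))"
proof -
  obtain K1 where K1: "0 \<le> K1" "\<And>n. (\<integral>\<^sup>+ z. W z * indicator {z. 1 - (1/2)^n \<le> norm z} z *
    ennreal ((max 1 (norm (1 - z) / (1/2)^n)) powr (- 2 * q) * sqrt (max (norm (1 - z) / (1/2)^n) ((1/2)^n / norm (1 - z)))) \<partial>lborel)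
      \<le> ennreal (K1 * ((1/2)^n * w n))"
    by (rule W_kernel_integral_le) (rule that)
  obtain K2 where K2: "0 \<le> K2" "\<And>z m. norm z < 1 \<Longrightarrow> (\<Sum>n. ennreal (offdiag (n + m) z)) \<le> ennreal K2"
    by (rule offdiag_suminf_le) (rule that)
  define K0 where "K0 = 20 * C\<^sup>2 / pi"
  have K0: "0 \<le> K0" by (simp add: K0_def)
  show ?thesis
  proof (rule that[of "K0 * max K1 K2"])
    show "0 \<le> K0 * max K1 K2" using K0 K1 by simp
    fix h and \<eta> :: real and m
    assume h: "h holomorphic_on ball 0 1" and \<eta>: "0 < \<eta>"
    define d where "d = (\<lambda>n::nat. (1/2::real)^n)"
    have d0: "0 < d n" "d n \<le> 1" for n by (auto simp: d_def power_le_one)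
    define hb where "hb = (\<lambda>z. indicator (ball 0 1) z *\<^sub>R h z)"
    have [measurable]: "hb \<in> borel_measurable borel"
      unfolding hb_def by (intro borel_measurable_continuous_on_indicator holomorphic_on_imp_continuous_on h) auto
    define k where "k = (\<lambda>n (z::complex). (max 1 (norm (1 - z) / d n)) powr (- 2 * q) * sqrt (max (norm (1 - z) / d n) (d n / norm (1 - z))))"
    have [measurable]: "k n \<in> borel_measurable borel" for n unfolding k_def by measurable
    define A where "A = (\<integral>\<^sup>+ z. W z * ennreal (norm (h z) powr p) \<partial>lborel)"
    have A: "A = (\<integral>\<^sup>+ z. W z * ennreal (norm (hb z) powr p) \<partial>lborel)"
      unfolding A_def hb_def by (intro nn_integral_cong) (auto simp: W_def split: split_indicator)
    define B where "B = (\<lambda>n. \<integral>\<^sup>+ z. W z * (ennreal (offdiag n z) * ennreal (norm (hb z) powr p)) \<partial>lborel)"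
    have blk: "(\<integral>\<^sup>+ s. ennreal ((1 - s) * norm (h (of_real s))) * indicator {1 - d n..<1 - d (Suc n)} s \<partial>lborel)
      \<le> ennreal K0 * (ennreal \<eta> * B n + ennreal (\<eta> powr (1 - q)) * ennreal (K1 * t n))" for n
    proof -
      define X where "X = (\<integral>\<^sup>+ z. W z * indicator {z. 1 - d n \<le> norm z} z * ennreal (norm (h z) * (d n / (max (d n) (norm (1 - z)))\<^sup>2)) \<partial>lborel)"
      have Xeq: "X = (\<integral>\<^sup>+ z. W z * indicator {z. 1 - d n \<le> norm z} z * ennreal (norm (hb z) * (d n / (max (d n) (norm (1 - z)))\<^sup>2)) \<partial>lborel)"
        unfolding X_def hb_def by (intro nn_integral_cong) (auto simp: W_def split: split_indicator)
      have pt: "ennreal ((1 - s) * norm (h (of_real s))) \<le> ennreal (d n / w n) * (ennreal K0 * X)"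
        if s: "1 - d n \<le> s" "s < 1 - d (Suc n)" for s
      proof -
        have "(1 - s) * norm (h (of_real s)) \<le> d n * norm (h (of_real s))" using s by (intro mult_right_mono) auto
        also have "\<dots> = d n / w n * (w n * norm (h (of_real s)))" using w_pos[of n] by simp
        finally have "ennreal ((1 - s) * norm (h (of_real s))) \<le> ennreal (d n / w n * (w n * norm (h (of_real s))))"
          by (rule ennreal_leI)
        also have "\<dots> = ennreal (d n / w n) * ennreal (w n * norm (h (of_real s)))"
          using d0[of n] w_pos[of n] by (intro ennreal_mult') simp
        also have "\<dots> \<le> ennreal (d n / w n) * (ennreal K0 * X)"
          using norm_le_poisson_type_integral[OF h, of n s] s unfolding K0_def X_def d_def by (intro mult_left_mono) auto
        finally show ?thesis .
      qed
      have "(\<integral>\<^sup>+ s. ennreal ((1 - s) * norm (h (of_real s))) * indicator {1 - d n..<1 - d (Suc n)} s \<partial>lborel)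
        \<le> (\<integral>\<^sup>+ s. ennreal (d n / w n) * (ennreal K0 * X) * indicator {1 - d n..<1 - d (Suc n)} s \<partial>lborel)"
        by (intro nn_integral_mono) (use pt in \<open>auto split: split_indicator\<close>)
      also have "\<dots> = ennreal (d n / w n) * (ennreal K0 * X) * ennreal (d n / 2)"
        by (subst nn_integral_cmult_indicator) (auto simp: d_def)
      also have "\<dots> \<le> ennreal (d n / w n) * (ennreal K0 * X) * ennreal (d n)"
        using d0[of n] by (intro mult_left_mono ennreal_leI) auto
      also have "\<dots> = ennreal K0 * (ennreal ((d n)\<^sup>2 / w n) * X)"
      proof -
        have "ennreal ((d n)\<^sup>2 / w n) = ennreal (d n / w n) * ennreal (d n)"
          using d0[of n] w_pos[of n] by (subst ennreal_mult'[symmetric]) (auto simp: power2_eq_square)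
        then show ?thesis by (simp only: mult_ac)
      qed
      also have "ennreal ((d n)\<^sup>2 / w n) * X = (\<integral>\<^sup>+ z. ennreal ((d n)\<^sup>2 / w n) * (W z * indicator {z. 1 - d n \<le> norm z} z * ennreal (norm (hb z) * (d n / (max (d n) (norm (1 - z)))\<^sup>2))) \<partial>lborel)"
        unfolding Xeq by (rule nn_integral_cmult[symmetric]) measurable
      also have "\<dots> \<le> (\<integral>\<^sup>+ z. ennreal \<eta> * (W z * (ennreal (offdiag n z) * ennreal (norm (hb z) powr p)))
          + ennreal (\<eta> powr (1 - q)) * (ennreal ((d n / w n) powr q) * (W z * indicator {z. 1 - d n \<le> norm z} z * ennreal (k n z))) \<partial>lborel)"
    (is "(\<integral>\<^sup>+ z. ?f z \<partial>_) \<le> (\<integral>\<^sup>+ z. ?g z \<partial>_)")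
      proof (rule nn_integral_mono)
        fix z :: complex
        show "?f z \<le> ?g z"
        proof (cases "1 - d n \<le> norm z \<and> norm z < 1")
          case True
          then have z1: "z \<noteq> 1" by auto
          define mx where "mx = max 1 (norm (1 - z) / d n)"
          have mx0: "0 < mx" by (simp add: mx_def)
          have mx: "max (d n) (norm (1 - z)) = d n * mx"
            using d0[of n] by (simp add: mx_def max_mult_distrib_left)
          \<comment> \<open>The kernel d / max(d, |1 - z|)^2 equals 1 / (d mx^2), so the prefactor
            d^2 / w turns it into this \<open>b\<close>.\<close>
          define b where "b = d n / w n * mx powr (- 2)"
          have b0: "0 \<le> b" using d0[of n] w_pos[of n] by (simp add: b_def)
          have beq: "(d n)\<^sup>2 / w n * (norm (hb z) * (d n / (max (d n) (norm (1 - z)))\<^sup>2)) = norm (hb z) * b"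
            unfolding mx b_def using d0[of n] mx0
            by (simp add: powr_minus_divide powr_numeral power2_eq_square)
          have "0 < min (norm (1 - z) / (1/2)^n) ((1/2)^n / norm (1 - z))" using z1 by simp
          then have l0: "0 < offdiag n z" unfolding offdiag_def powr_gt_zero by (rule less_imp_neq[symmetric])
          have "norm (hb z) * b \<le> (\<eta> * offdiag n z) * norm (hb z) powr p + (\<eta> * offdiag n z) powr (1 - q) * b powr q"
            using \<eta> l0 b0 by (intro young_weighted) auto
          also have "(\<eta> * offdiag n z) powr (1 - q) * b powr q = \<eta> powr (1 - q) * ((d n / w n) powr q * k n z)"
          proof -
            have "(\<eta> * offdiag n z) powr (1 - q) = \<eta> powr (1 - q) * offdiag n z powr (1 - q)" using \<eta> l0 by (simp add: powr_mult)
            moreover have "b powr q = (d n / w n) powr q * mx powr (- 2 * q)"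
              using d0[of n] w_pos[of n] unfolding b_def by (subst powr_mult) (auto simp: powr_powr)
            moreover have "k n z = mx powr (- 2 * q) * offdiag n z powr (1 - q)"
              unfolding k_def offdiag_powr[OF z1] mx_def d_def by simp
            ultimately show ?thesis by (simp only: mult_ac)
          qed
          finally have "ennreal (norm (hb z) * b) \<le> ennreal ((\<eta> * offdiag n z) * norm (hb z) powr p + \<eta> powr (1 - q) * ((d n / w n) powr q * k n z))"
            by (rule ennreal_leI)
          also have "\<dots> = ennreal \<eta> * (ennreal (offdiag n z) * ennreal (norm (hb z) powr p)) + ennreal (\<eta> powr (1 - q)) * (ennreal ((d n / w n) powr q) * ennreal (k n z))"
          proof -
            have "0 \<le> k n z"
              unfolding k_def using d0(1)[of n] by (intro mult_nonneg_nonneg real_sqrt_ge_zero max.coboundedI1) auto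
            then show ?thesis using \<eta> l0
              by (subst ennreal_plus) (auto simp: ennreal_mult' mult.assoc)
          qed
          finally have main: "ennreal (norm (hb z) * b) \<le> ennreal \<eta> * (ennreal (offdiag n z) * ennreal (norm (hb z) powr p)) + ennreal (\<eta> powr (1 - q)) * (ennreal ((d n / w n) powr q) * ennreal (k n z))" .
          have "ennreal ((d n)\<^sup>2 / w n) * ennreal (norm (hb z) * (d n / (max (d n) (norm (1 - z)))\<^sup>2)) = ennreal (norm (hb z) * b)"
            unfolding beq[symmetric] using w_pos[of n] by (intro ennreal_mult'[symmetric]) simp
          then have "ennreal ((d n)\<^sup>2 / w n) * (W z * ennreal (norm (hb z) * (d n / (max (d n) (norm (1 - z)))\<^sup>2))) = W z * ennreal (norm (hb z) * b)"
            by (metis mult.left_commute)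
          also have "\<dots> \<le> W z * (ennreal \<eta> * (ennreal (offdiag n z) * ennreal (norm (hb z) powr p)) + ennreal (\<eta> powr (1 - q)) * (ennreal ((d n / w n) powr q) * ennreal (k n z)))"
            by (intro mult_left_mono main) auto
          also have "\<dots> = ennreal \<eta> * (W z * (ennreal (offdiag n z) * ennreal (norm (hb z) powr p))) + ennreal (\<eta> powr (1 - q)) * (ennreal ((d n / w n) powr q) * (W z * ennreal (k n z)))"
            by (simp only: distrib_left mult_ac)
          finally show ?thesis using True by simp
        qed (auto simp: W_def)
      qed
      also have "\<dots> = ennreal \<eta> * B n + ennreal (\<eta> powr (1 - q)) * (ennreal ((d n / w n) powr q) * (\<integral>\<^sup>+ z. W z * indicator {z. 1 - d n \<le> norm z} z * ennreal (k n z) \<partial>lborel))"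
        unfolding B_def by (simp add: nn_integral_add nn_integral_cmult)
      also have "\<dots> \<le> ennreal \<eta> * B n + ennreal (\<eta> powr (1 - q)) * (ennreal ((d n / w n) powr q) * ennreal (K1 * (d n * w n)))"
        using K1(2)[of n] unfolding k_def d_def by (intro add_left_mono mult_left_mono) auto
      also have "ennreal ((d n / w n) powr q) * ennreal (K1 * (d n * w n)) = ennreal (K1 * t n)"
      proof -
        have "(d n / w n) powr q * (d n * w n) = t n"
        proof -
          have "d n powr q * d n = d n powr (q + 1)" using d0[of n] powr_add[of "d n" q 1] by simp
          moreover have "w n powr q = w n powr (q - 1) * w n" using w_pos[of n] powr_add[of "w n" "q - 1" 1] by simp
          ultimately show ?thesis using d0[of n] w_pos[of n] by (simp add: powr_divide t_def d_def[symmetric])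
        qed
        then have "(d n / w n) powr q * (K1 * (d n * w n)) = K1 * t n" by (metis mult.left_commute)
        then show ?thesis by (metis ennreal_mult' powr_ge_zero)
      qed
      finally show ?thesis by (simp add: mult_left_mono)
    qed
    define hs where "hs = (\<lambda>s. ennreal (indicator {0..<1} s *\<^sub>R ((1 - s) * norm (h (of_real s)))))"
    have [measurable]: "hs \<in> borel_measurable borel"
    proof -
      have "continuous_on {0..<1} (\<lambda>s. (1 - s) * norm (h (complex_of_real s)))"
        by (intro continuous_intros continuous_on_compose2[OF holomorphic_on_imp_continuous_on[OF h]]) auto
      then have "(\<lambda>s. indicator {0..<1} s *\<^sub>R ((1 - s) * norm (h (complex_of_real s)))) \<in> borel_measurable borel"
        by (intro borel_measurable_continuous_on_indicator) auto
      then show ?thesis unfolding hs_def by measurable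
    qed
    have hs: "hs s = ennreal ((1 - s) * norm (h (of_real s)))" if "0 \<le> s" "s < 1" for s using that by (simp add: hs_def)
    have "(\<integral>\<^sup>+ s. ennreal ((1 - s) * norm (h (of_real s))) * indicator {1 - (1/2)^m..<1} s \<partial>lborel)
      \<le> (\<integral>\<^sup>+ s. (\<Sum>n. hs s * indicator {1 - d (n + m)..<1 - d (Suc (n + m))} s) \<partial>lborel)"
    (is "(\<integral>\<^sup>+ z. ?f z \<partial>_) \<le> (\<integral>\<^sup>+ z. ?g z \<partial>_)")
    proof (rule nn_integral_mono)
      fix s :: real
      show "?f s \<le> ?g s"
      proof (cases "1 - (1/2)^m \<le> s \<and> s < 1")
        case True
        have s0: "0 \<le> s" using True d0(2)[of m] unfolding d_def by linarith
        obtain k where k: "(1/2)^Suc k < 1 - s" "1 - s \<le> (1/2)^k"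
          using dyadic_block_exists[of "1 - s"] True s0 by auto
        have "m \<le> k"
        proof (rule ccontr)
          assume "\<not> m \<le> k"
          then have "(1/2::real)^m \<le> (1/2)^Suc k" by (intro power_decreasing) auto
          then show False using k True by linarith
        qed
        then obtain i where i: "k = i + m" by (metis add.commute le_Suc_ex)
        have "hs s = (\<Sum>n\<in>{i}. hs s * indicator {1 - d (n + m)..<1 - d (Suc (n + m))} s)"
          using k unfolding i d_def by simp
        also have "\<dots> \<le> (\<Sum>n. hs s * indicator {1 - d (n + m)..<1 - d (Suc (n + m))} s)"
          by (intro sum_le_suminf) auto
        finally show ?thesis using True s0 by (simp add: hs)
      qed auto
    qed
    also have "\<dots> = (\<Sum>n. \<integral>\<^sup>+ s. hs s * indicator {1 - d (n + m)..<1 - d (Suc (n + m))} s \<partial>lborel)"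
      by (rule nn_integral_suminf) measurable
    also have "\<dots> \<le> (\<Sum>n. ennreal K0 * (ennreal \<eta> * B (n + m) + ennreal (\<eta> powr (1 - q)) * ennreal (K1 * t (n + m))))"
    proof (intro suminf_le allI)
      fix n
      have "(\<integral>\<^sup>+ s. hs s * indicator {1 - d (n + m)..<1 - d (Suc (n + m))} s \<partial>lborel)
        = (\<integral>\<^sup>+ s. ennreal ((1 - s) * norm (h (of_real s))) * indicator {1 - d (n + m)..<1 - d (Suc (n + m))} s \<partial>lborel)"
      proof (rule nn_integral_cong)
        fix s :: real
        show "hs s * indicator {1 - d (n + m)..<1 - d (Suc (n + m))} s = ennreal ((1 - s) * norm (h (of_real s))) * indicator {1 - d (n + m)..<1 - d (Suc (n + m))} s"
          using hs[of s] d0(2)[of "n + m"] d0(1)[of "Suc (n + m)"]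
          by (cases "1 - d (n + m) \<le> s \<and> s < 1 - d (Suc (n + m))") auto
      qed
      then show "(\<integral>\<^sup>+ s. hs s * indicator {1 - d (n + m)..<1 - d (Suc (n + m))} s \<partial>lborel)
        \<le> ennreal K0 * (ennreal \<eta> * B (n + m) + ennreal (\<eta> powr (1 - q)) * ennreal (K1 * t (n + m)))"
        using blk[of "n + m"] by simp
    qed auto
    also have "\<dots> = ennreal K0 * (ennreal \<eta> * (\<Sum>n. B (n + m)) + ennreal (\<eta> powr (1 - q)) * (ennreal K1 * (\<Sum>n. ennreal (t (n + m)))))"
      using K1(1) by (simp add: ennreal_suminf_cmult suminf_add[symmetric] ennreal_mult')
    also have "\<dots> \<le> ennreal K0 * (ennreal \<eta> * (ennreal (max K1 K2) * A) + ennreal (\<eta> powr (1 - q)) * (ennreal (max K1 K2) * (\<Sum>n. ennreal (t (n + m)))))"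
    proof (intro mult_left_mono add_mono mult_right_mono ennreal_leI)
      have "(\<Sum>n. B (n + m)) = (\<integral>\<^sup>+ z. (\<Sum>n. W z * (ennreal (offdiag (n + m) z) * ennreal (norm (hb z) powr p))) \<partial>lborel)"
        unfolding B_def by (rule nn_integral_suminf[symmetric]) measurable
      also have "\<dots> \<le> (\<integral>\<^sup>+ z. ennreal (max K1 K2) * (W z * ennreal (norm (hb z) powr p)) \<partial>lborel)"
      proof (rule nn_integral_mono)
        fix z
        have "(\<Sum>n. W z * (ennreal (offdiag (n + m) z) * ennreal (norm (hb z) powr p))) = W z * ennreal (norm (hb z) powr p) * (\<Sum>n. ennreal (offdiag (n + m) z))"
          unfolding ennreal_suminf_cmult[symmetric] by (simp only: mult_ac)
        also have "\<dots> \<le> W z * ennreal (norm (hb z) powr p) * ennreal (max K1 K2)"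
        proof (cases "norm z < 1")
          case True
          have "(\<Sum>n. ennreal (offdiag (n + m) z)) \<le> ennreal (max K1 K2)"
            by (rule order_trans[OF K2(2)[OF True] ennreal_leI]) simp
          then show ?thesis by (intro mult_left_mono) auto
        qed (simp add: W_def)
        finally show "(\<Sum>n. W z * (ennreal (offdiag (n + m) z) * ennreal (norm (hb z) powr p))) \<le> ennreal (max K1 K2) * (W z * ennreal (norm (hb z) powr p))"
          by (simp only: mult_ac)
      qed
      also have "\<dots> = ennreal (max K1 K2) * A" unfolding A by (rule nn_integral_cmult) measurable
      finally show "(\<Sum>n. B (n + m)) \<le> ennreal (max K1 K2) * A" .
    qed auto
    also have "\<dots> = ennreal (K0 * max K1 K2) * (ennreal \<eta> * A + ennreal (\<eta> powr (1 - q)) * (\<Sum>n. ennreal (t (n + m))))"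
      unfolding ennreal_mult'[OF K0] by (simp only: distrib_left mult_ac)
    finally show "(\<integral>\<^sup>+ s. ennreal ((1 - s) * norm (h (of_real s))) * indicator {1 - (1/2)^m..<1} s \<partial>lborel)
      \<le> ennreal (K0 * max K1 K2) * (ennreal \<eta> * (\<integral>\<^sup>+ z. W z * ennreal (norm (h z) powr p) \<partial>lborel)
          + ennreal (\<eta> powr (1 - q)) * (\<Sum>n. ennreal (t (n + m))))"
      by (simp only: A_def)
  qed
qed

text \<open>Local boundedness for Montel's theorem. The averaged Cauchy formula is applied halfway
  between \<open>R\<close> and 1, where the kernel is at most 1 / (r - R), and |h| <= |h|^p + 1
  reduces the remaining integral to the norm and the total mass.\<close>

lemma norm_le_on_compact_disc:
  assumes R: "0 \<le> R" "R < 1" and A0: "0 \<le> A0"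
  obtains B where "\<And>h z. h holomorphic_on ball 0 1 \<Longrightarrow> (\<integral>\<^sup>+ z. W z * ennreal (norm (h z) powr p) \<partial>lborel) \<le> ennreal A0
    \<Longrightarrow> norm z \<le> R \<Longrightarrow> norm (h z) \<le> B"
proof -
  define r where "r = (1 + R) / 2"
  have r: "1/2 \<le> r" "r < 1" "R < r" using R by (auto simp: r_def)
  define c where "c = pi * omega_hat \<omega> r"
  have c: "0 < c" using omega_hat_pos[of r] r by (simp add: c_def)
  define V where "V = 1 / (r - R) * (A0 + 2 * pi * omega_hat \<omega> 0)"
  have V0: "0 \<le> V" using r A0 omega_hat_nonneg[of 0] by (simp add: V_def)
  show ?thesis
  proof (rule that[of "V / c"])
    fix h and z :: complex
    assume h: "h holomorphic_on ball 0 1" and A: "(\<integral>\<^sup>+ z. W z * ennreal (norm (h z) powr p) \<partial>lborel) \<le> ennreal A0" and z: "norm z \<le> R"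
    define hb where "hb = (\<lambda>z. indicator (ball 0 1) z *\<^sub>R h z)"
    have [measurable]: "hb \<in> borel_measurable borel"
      unfolding hb_def by (intro borel_measurable_continuous_on_indicator holomorphic_on_imp_continuous_on h) auto
    have A': "(\<integral>\<^sup>+ z. W z * ennreal (norm (hb z) powr p) \<partial>lborel) \<le> ennreal A0"
      using A unfolding hb_def by (subst nn_integral_cong[where v = "\<lambda>z. W z * ennreal (norm (h z) powr p)"]) (auto simp: W_def split: split_indicator)
    have "ennreal (pi * omega_hat \<omega> r * norm (h z))
      \<le> (\<integral>\<^sup>+ x. W x * indicator {z. r \<le> norm z} x * ennreal (norm (h x) * norm x / norm (x - z)) \<partial>lborel)"
      using z r by (intro norm_le_W_integral[OF h]) auto
    also have "\<dots> \<le> (\<integral>\<^sup>+ x. ennreal (1 / (r - R)) * (W x * ennreal (norm (hb x) powr p) + W x * indicator {z. 0 \<le> norm z} x) \<partial>lborel)"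
    (is "(\<integral>\<^sup>+ z. ?f z \<partial>_) \<le> (\<integral>\<^sup>+ z. ?g z \<partial>_)")
    proof (rule nn_integral_mono)
      fix x
      show "?f x \<le> ?g x"
      proof (cases "r \<le> norm x \<and> norm x < 1")
        case True
        have "r - R \<le> norm (x - z)" using norm_triangle_ineq2[of x z] True z by linarith
        then have "norm (h x) * norm x / norm (x - z) \<le> (norm (h x) powr p + 1) * 1 / (r - R)"
        proof (intro frac_le mult_mono)
          show "norm (h x) \<le> norm (h x) powr p + 1"
          proof (cases "norm (h x) \<le> 1")
            case False
            then have "norm (h x) powr 1 \<le> norm (h x) powr p" using p_gt_1 by (intro powr_mono) auto
            then show ?thesis using False by simp
          qed (simp add: add_increasing)
        qed (use True r in auto)
        then have "ennreal (norm (h x) * norm x / norm (x - z)) \<le> ennreal (1 / (r - R) * (norm (h x) powr p + 1))"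
          by (intro ennreal_leI) simp
        also have "\<dots> = ennreal (1 / (r - R)) * (ennreal (norm (h x) powr p) + 1)"
          using r by (subst ennreal_mult') (auto simp: ennreal_plus)
        finally have "W x * ennreal (norm (h x) * norm x / norm (x - z)) \<le> W x * (ennreal (1 / (r - R)) * (ennreal (norm (h x) powr p) + 1))"
          by (intro mult_left_mono) auto
        also have "\<dots> = ennreal (1 / (r - R)) * (W x * ennreal (norm (h x) powr p) + W x)"
          by (simp only: distrib_left mult_ac mult_1_right mult_1_left)
        finally show ?thesis using True by (simp add: hb_def)
      qed (auto simp: W_def)
    qed
    also have "\<dots> = ennreal (1 / (r - R)) * ((\<integral>\<^sup>+ z. W z * ennreal (norm (hb z) powr p) \<partial>lborel) + (\<integral>\<^sup>+ z. W z * indicator {z. 0 \<le> norm z} z \<partial>lborel))"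
      by (subst nn_integral_cmult) (measurable, simp add: nn_integral_add)
    also have "\<dots> \<le> ennreal (1 / (r - R)) * (ennreal A0 + ennreal (2 * pi * omega_hat \<omega> 0))"
      by (intro mult_left_mono add_mono A' W_annulus_le) auto
    also have "\<dots> = ennreal V"
      unfolding V_def using r A0 omega_hat_nonneg[of 0] by (subst ennreal_mult') (auto simp: ennreal_plus)
    finally have "c * norm (h z) \<le> V" using V0 by (simp add: c_def)
    then show "norm (h z) \<le> V / c" using c by (simp add: pos_le_divide_eq mult.commute)
  qed
qed

end

section \<open>The Volterra operator with symbol z\<close>

lemma T_op_cmult: "T_op g (\<lambda>z. c * f z) z = c * T_op g f z"
  unfolding T_op_eq_integral by (simp add: mult.assoc)

lemma T_op_diff:
  assumes f: "f1 holomorphic_on ball 0 1" "f2 holomorphic_on ball 0 1" "g holomorphic_on ball 0 1" and z: "norm z < 1"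
  shows "T_op g (\<lambda>z. f1 z - f2 z) z = T_op g f1 z - T_op g f2 z"
proof -
  have sz: "norm (of_real s * z) < 1" if "s \<in> {0..1}" for s
  proof -
    have "norm (of_real s * z) \<le> 1 * norm z" unfolding norm_mult using that by (intro mult_right_mono) auto
    then show ?thesis using z by simp
  qed
  have int: "(\<lambda>s. f (of_real s * z) * deriv g (of_real s * z) * z) integrable_on {0..1}" if "f holomorphic_on ball 0 1" for f
    by (intro integrable_continuous_interval continuous_intros
          continuous_on_compose2[OF holomorphic_on_imp_continuous_on[OF that]]
          continuous_on_compose2[OF holomorphic_on_imp_continuous_on[OF holomorphic_deriv[OF f(3) open_ball]]])
       (use sz in auto)
  show ?thesis
    unfolding T_op_eq_integral
    by (subst integral_diff[symmetric, OF int[OF f(1)] int[OF f(2)]]) (simp add: algebra_simps)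
qed

lemma T_op_const:
  assumes g: "\<And>z. z \<in> ball 0 1 \<Longrightarrow> g z = c" and z: "norm z < 1"
  shows "T_op g f z = 0"
proof -
  have "deriv g x = 0" if "norm x < 1" for x
  proof -
    have "((\<lambda>_. c) has_field_derivative 0) (at x)" by simp
    then have "(g has_field_derivative 0) (at x)"
      by (rule has_field_derivative_transform_within_open[of _ _ _ "ball 0 1"]) (use that g in auto)
    then show ?thesis by (rule DERIV_imp_deriv)
  qed
  moreover have "norm (of_real s * z) < 1" if "s \<in> {0..1}" for s
  proof -
    have "norm (of_real s * z) \<le> 1 * norm z" unfolding norm_mult using that by (intro mult_right_mono) auto
    then show ?thesis using z by simp
  qed
  ultimately show ?thesis
    unfolding T_op_eq_integral by (subst integral_cong[where g = "\<lambda>_. 0"]) auto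
qed

lemma const_on_disc_subset_Tc_set: "const_on_disc \<subseteq> Tc_set s \<nu>"
proof
  fix g assume "g \<in> const_on_disc"
  then obtain c where g: "g holomorphic_on ball 0 1" "\<And>z. z \<in> ball 0 1 \<Longrightarrow> g z = c"
    by (auto simp: const_on_disc_def)
  have T0: "T_op g f z = 0" if "z \<in> ball 0 1" for f z
    using T_op_const[of g c z f] g(2) that by auto
  have "uniform_limit (ball 0 1) (\<lambda>n. T_op g (F (id n))) (\<lambda>_. 0) sequentially" for F :: "nat \<Rightarrow> complex \<Rightarrow> complex"
    by (rule uniform_limitI) (simp add: T0[unfolded mem_ball_0])
  then have "T_compact_Hinf s \<nu> g"
    unfolding T_compact_Hinf_def T_bounded_Hinf_def
    by (intro conjI exI[of _ 0] allI impI exI[of _ id] exI[of _ "\<lambda>_. 0"]) (simp_all add: T0[unfolded mem_ball_0] strict_mono_id)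
  then show "g \<in> Tc_set s \<nu>" using g(1) by (simp add: Tc_set_def)
qed

lemma Tc_set_subset_T_set: "Tc_set s \<nu> \<subseteq> T_set s \<nu>"
  by (auto simp: Tc_set_def T_set_def T_compact_Hinf_def)

text \<open>For the symbol z the operator produces a primitive P of f, and integration by parts
  along the radius gives P(\<open>\<rho>\<close> \<open>\<zeta>\<close>) = \<open>\<rho>\<close>
  \<open>\<zeta>\<close> f(0) plus the integral of (\<open>\<rho>\<close> - s)
  \<open>\<zeta>\<close>^2 f'(s \<open>\<zeta>\<close>). Only the radial integral of (1 - s) |f'|
  remains to be controlled.\<close>

lemma norm_T_op_ident_le:
  assumes f: "f holomorphic_on ball 0 1" and \<zeta>: "norm \<zeta> = 1" and \<rho>: "0 \<le> \<rho>" "\<rho> < 1"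
  shows "ennreal (norm (T_op (\<lambda>z. z) f (of_real \<rho> * \<zeta>))) \<le> ennreal (norm (f 0))
    + (\<integral>\<^sup>+ s. ennreal ((1 - s) * norm (deriv f (of_real s * \<zeta>))) * indicator {0..<1} s \<partial>lborel)"
proof -
  obtain P where P: "P holomorphic_on ball 0 1" "P 0 = 0" "\<And>z. z \<in> ball 0 1 \<Longrightarrow> (P has_field_derivative f z) (at z)"
    using primitive_on_unit_ball[OF f] by blast
  define z where "z = of_real \<rho> * \<zeta>"
  have nz: "norm z < 1" using \<rho> \<zeta> by (simp add: z_def norm_mult)
  have "path_image (linepath 0 z) \<subseteq> ball 0 1"
    unfolding path_image_linepath using nz by (intro closed_segment_subset) auto
  then have "(f has_contour_integral (P (pathfinish (linepath 0 z)) - P (pathstart (linepath 0 z)))) (linepath 0 z)"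
    using P(3) by (intro contour_integral_primitive[of "ball 0 1", OF _ valid_path_linepath])
      (auto intro: has_field_derivative_at_within simp del: linepath_0)
  then have T: "T_op (\<lambda>z. z) f z = P z" unfolding T_op_def by (simp add: contour_integral_unique P(2))
  define k where "k = (\<lambda>s::real. of_real (\<rho> - s) * \<zeta>\<^sup>2 * deriv f (of_real s * \<zeta>))"
  have s1: "of_real s * \<zeta> \<in> ball 0 1" if "s \<in> {0..\<rho>}" for s using that \<rho> \<zeta> by (simp add: norm_mult)
  have "(k has_integral ((P (of_real \<rho> * \<zeta>) + of_real (\<rho> - \<rho>) * \<zeta> * f (of_real \<rho> * \<zeta>)) - (P (of_real 0 * \<zeta>) + of_real (\<rho> - 0) * \<zeta> * f (of_real 0 * \<zeta>)))) {0..\<rho>}"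
  proof (rule fundamental_theorem_of_calculus[OF \<rho>(1)])
    fix s assume s: "s \<in> {0..\<rho>}"
    have "((\<lambda>u. P (u * \<zeta>) + (of_real \<rho> - u) * \<zeta> * f (u * \<zeta>)) has_field_derivative
        f (of_real s * \<zeta>) * \<zeta> + ((of_real \<rho> - of_real s) * \<zeta> * (deriv f (of_real s * \<zeta>) * \<zeta>) + (0 - 1) * \<zeta> * f (of_real s * \<zeta>))) (at (of_real s))"
    proof (intro DERIV_add)
      show "((\<lambda>u. P (u * \<zeta>)) has_field_derivative f (of_real s * \<zeta>) * \<zeta>) (at (of_real s))"
        by (rule DERIV_chain2[of P _ "\<lambda>u. u * \<zeta>", OF P(3)[OF s1[OF s]]]) (auto intro!: derivative_eq_intros)
      have "(f has_field_derivative deriv f (of_real s * \<zeta>)) (at (of_real s * \<zeta>))"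
        using holomorphic_derivI[OF f open_ball s1[OF s], of UNIV] by simp
      then have "((\<lambda>u. f (u * \<zeta>)) has_field_derivative deriv f (of_real s * \<zeta>) * \<zeta>) (at (of_real s))"
        by (rule DERIV_chain2[of f _ "\<lambda>u. u * \<zeta>"]) (auto intro!: derivative_eq_intros)
      then show "((\<lambda>u. (of_real \<rho> - u) * \<zeta> * f (u * \<zeta>)) has_field_derivative
        (of_real \<rho> - of_real s) * \<zeta> * (deriv f (of_real s * \<zeta>) * \<zeta>) + (0 - 1) * \<zeta> * f (of_real s * \<zeta>)) (at (of_real s))"
        by (intro DERIV_mult' DERIV_cmult_right DERIV_diff DERIV_const DERIV_ident)
    qed
    also have "f (of_real s * \<zeta>) * \<zeta> + ((of_real \<rho> - of_real s) * \<zeta> * (deriv f (of_real s * \<zeta>) * \<zeta>) + (0 - 1) * \<zeta> * f (of_real s * \<zeta>)) = k s"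
      by (simp add: k_def power2_eq_square)
    finally have "((\<lambda>s. P (of_real s * \<zeta>) + (of_real \<rho> - of_real s) * \<zeta> * f (of_real s * \<zeta>)) has_vector_derivative k s) (at s)"
      by (rule has_vector_derivative_real_field)
    then show "((\<lambda>s. P (of_real s * \<zeta>) + of_real (\<rho> - s) * \<zeta> * f (of_real s * \<zeta>)) has_vector_derivative k s) (at s within {0..\<rho>})"
      by (simp add: has_vector_derivative_at_within)
  qed
  then have "P z = of_real \<rho> * \<zeta> * f 0 + integral {0..\<rho>} k" by (simp add: z_def P(2) integral_unique)
  then have "norm (P z) \<le> norm (of_real \<rho> * \<zeta> * f 0) + norm (integral {0..\<rho>} k)" using norm_triangle_ineq by metis
  also have "norm (of_real \<rho> * \<zeta> * f 0) \<le> norm (f 0)"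
    using \<zeta> \<rho> mult_right_mono[of \<rho> 1 "norm (f 0)"] by (simp add: norm_mult)
  finally have "ennreal (norm (P z)) \<le> ennreal (norm (f 0)) + ennreal (norm (integral {0..\<rho>} k))"
    by (simp add: ennreal_plus[symmetric] ennreal_leI del: ennreal_plus)
  also have "ennreal (norm (integral {0..\<rho>} k)) \<le> (\<integral>\<^sup>+ s. ennreal (norm (k s)) * indicator {0..\<rho>} s \<partial>lborel)"
  proof (rule norm_integral_le_nn_integral)
    show "continuous_on {0..\<rho>} k" unfolding k_def
      by (intro continuous_intros continuous_on_compose2[OF holomorphic_on_imp_continuous_on[OF holomorphic_deriv[OF f open_ball]]])
         (use s1 in auto)
  qed
  also have "\<dots> \<le> (\<integral>\<^sup>+ s. ennreal ((1 - s) * norm (deriv f (of_real s * \<zeta>))) * indicator {0..<1} s \<partial>lborel)"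
  proof (rule nn_integral_mono)
    fix s
    have "norm (k s) \<le> (1 - s) * norm (deriv f (of_real s * \<zeta>))" if "s \<in> {0..\<rho>}"
    proof -
      have "norm (complex_of_real (\<rho> - s)) = \<rho> - s" unfolding norm_of_real using that by simp
      then have "norm (k s) = (\<rho> - s) * norm (deriv f (of_real s * \<zeta>))"
        unfolding k_def norm_mult by (simp add: norm_power \<zeta>)
      also have "\<dots> \<le> (1 - s) * norm (deriv f (of_real s * \<zeta>))" using \<rho> by (intro mult_right_mono) auto
      finally show ?thesis .
    qed
    then show "ennreal (norm (k s)) * indicator {0..\<rho>} s \<le> ennreal ((1 - s) * norm (deriv f (of_real s * \<zeta>))) * indicator {0..<1} s"
      using \<rho> by (auto intro: ennreal_leI split: split_indicator)
  qed
  finally show ?thesis unfolding T[unfolded z_def, symmetric] z_def by simp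
qed

section \<open>Boundedness and compactness for the symbol z, and the resulting
  characterization\<close>

context upper_doubling_exponent
begin

abbreviation \<nu> :: "complex \<Rightarrow> real" where
  "\<nu> \<equiv> \<lambda>z. \<omega> (norm z)"

lemma W_integral_eq:
  "(\<integral>\<^sup>+ z. W z * ennreal (norm (deriv f z) powr p) \<partial>lborel)
    = ennreal pi * (\<integral>\<^sup>+ z. ennreal (norm (deriv f z) powr p * \<nu> z / pi) * indicator (ball 0 1) z \<partial>lborel)"
  if "f holomorphic_on ball 0 1"
proof -
  have "(\<integral>\<^sup>+ z. W z * ennreal (norm (deriv f z) powr p) \<partial>lborel)
    = (\<integral>\<^sup>+ z. ennreal pi * (ennreal (norm (deriv f z) powr p * \<nu> z / pi) * indicator (ball 0 1) z) \<partial>lborel)"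
  proof (rule nn_integral_cong)
    fix z :: complex
    have "ennreal pi * ennreal (norm (deriv f z) powr p * \<nu> z / pi) = ennreal (\<nu> z) * ennreal (norm (deriv f z) powr p)"
    proof -
      have "ennreal pi * ennreal (norm (deriv f z) powr p * \<nu> z / pi) = ennreal (pi * (norm (deriv f z) powr p * \<nu> z / pi))"
        by (rule ennreal_mult'[symmetric]) simp
      also have "pi * (norm (deriv f z) powr p * \<nu> z / pi) = \<nu> z * norm (deriv f z) powr p" by simp
      also have "ennreal \<dots> = ennreal (\<nu> z) * ennreal (norm (deriv f z) powr p)" by (rule ennreal_mult'') simp
      finally show ?thesis .
    qed
    then show "W z * ennreal (norm (deriv f z) powr p) = ennreal pi * (ennreal (norm (deriv f z) powr p * \<nu> z / pi) * indicator (ball 0 1) z)"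
      by (auto simp: W_def split: split_indicator)
  qed
  also have "\<dots> = ennreal pi * (\<integral>\<^sup>+ z. ennreal (norm (deriv f z) powr p * \<nu> z / pi) * indicator (ball 0 1) z \<partial>lborel)"
    using D_integrand_measurable[OF that weight_measurable, of p] by (intro nn_integral_cmult) simp
  finally show ?thesis .
qed

lemma D_normpow_unit:
  assumes f: "f holomorphic_on ball 0 1" and N: "D_normpow p \<nu> f \<le> 1"
  shows "(\<integral>\<^sup>+ z. W z * ennreal (norm (deriv f z) powr p) \<partial>lborel) \<le> ennreal pi" "norm (f 0) \<le> 1"
proof -
  define A where "A = (\<integral>\<^sup>+ z. ennreal (norm (deriv f z) powr p * \<nu> z / pi) * indicator (ball 0 1) z \<partial>lborel)"
  have N': "A + ennreal (norm (f 0) powr p) \<le> 1" using N by (simp only: D_normpow_def A_def)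
  have "A \<le> 1" by (rule order_trans[OF _ N']) simp
  then have "ennreal pi * A \<le> ennreal pi * 1" by (intro mult_left_mono) auto
  then show "(\<integral>\<^sup>+ z. W z * ennreal (norm (deriv f z) powr p) \<partial>lborel) \<le> ennreal pi"
    unfolding W_integral_eq[OF f] A_def by simp
  have "ennreal (norm (f 0) powr p) \<le> 1" by (rule order_trans[OF _ N']) simp
  then have "norm (f 0) powr p \<le> 1" by (simp add: ennreal_le_1)
  then have "(norm (f 0) powr p) powr (1 / p) \<le> 1" using p_gt_1 by (intro powr_le1) auto
  then show "norm (f 0) \<le> 1" using p_gt_1 by (simp add: powr_powr)
qed

text \<open>The radius to z is rotated onto the positive axis, which changes no norm since the
  weight is radial; the part up to 1 - 2^-m is estimated by the bound for f' there, the rest by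
  \<open>radial_tail_estimate\<close>. One statement serves two purposes: m = 0 gives boundedness,
  large m with small \<open>\<eta>\<close> gives compactness.\<close>

lemma norm_T_op_ident_split:
  obtains K where "0 \<le> K" "\<And>f z m \<epsilon> \<eta>. f holomorphic_on ball 0 1 \<Longrightarrow> norm z < 1 \<Longrightarrow> 0 < \<eta> \<Longrightarrow> 0 \<le> \<epsilon> \<Longrightarrow>
    (\<forall>u. norm u < 1 - (1/2)^m \<longrightarrow> norm (deriv f u) \<le> \<epsilon>) \<Longrightarrow>
    ennreal (norm (T_op (\<lambda>z. z) f z)) \<le> ennreal (norm (f 0) + \<epsilon>) + ennreal K *
      (ennreal \<eta> * (\<integral>\<^sup>+ z. W z * ennreal (norm (deriv f z) powr p) \<partial>lborel) + ennreal (\<eta> powr (1 - q)) * (\<Sum>n. ennreal (t (n + m))))"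
proof -
  obtain K where K: "0 \<le> K" "\<And>h \<eta> m. h holomorphic_on ball 0 1 \<Longrightarrow> 0 < \<eta> \<Longrightarrow>
    (\<integral>\<^sup>+ s. ennreal ((1 - s) * norm (h (of_real s))) * indicator {1 - (1/2)^m..<1} s \<partial>lborel)
      \<le> ennreal K * (ennreal \<eta> * (\<integral>\<^sup>+ z. W z * ennreal (norm (h z) powr p) \<partial>lborel)
          + ennreal (\<eta> powr (1 - q)) * (\<Sum>n. ennreal (t (n + m))))"
    by (rule radial_tail_estimate) (rule that)
  show ?thesis
  proof (rule that[of K])
    show "0 \<le> K" by (rule K(1))
    fix f :: "complex \<Rightarrow> complex" and z :: complex and m :: nat and \<epsilon> \<eta> :: real
    assume f: "f holomorphic_on ball 0 1" and z: "norm z < 1" and \<eta>: "0 < \<eta>" and \<epsilon>: "0 \<le> \<epsilon>"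
      and "\<forall>u. norm u < 1 - (1/2)^m \<longrightarrow> norm (deriv f u) \<le> \<epsilon>"
    then have small: "norm (deriv f u) \<le> \<epsilon>" if "norm u < 1 - (1/2)^m" for u using that by blast
    define \<rho> where "\<rho> = norm z"
    define \<zeta> where "\<zeta> = (if z = 0 then 1 else z / of_real (norm z))"
    have \<zeta>: "norm \<zeta> = 1" by (simp add: \<zeta>_def norm_divide)
    have z\<rho>: "z = of_real \<rho> * \<zeta>" by (simp add: \<rho>_def \<zeta>_def)
    have \<rho>: "0 \<le> \<rho>" "\<rho> < 1" using z by (auto simp: \<rho>_def)
    define h where "h = (\<lambda>u. deriv f (\<zeta> * u))"
    have dfh: "deriv f holomorphic_on ball 0 1" by (rule holomorphic_deriv[OF f open_ball])
    have h: "h holomorphic_on ball 0 1"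
      unfolding h_def
      by (rule holomorphic_on_compose_gen[of "\<lambda>u. \<zeta> * u" _ "deriv f" "ball 0 1", unfolded o_def])
         (use dfh \<zeta> in \<open>auto intro!: holomorphic_intros simp: norm_mult\<close>)
    define A where "A = (\<integral>\<^sup>+ z. W z * ennreal (norm (deriv f z) powr p) \<partial>lborel)"
    have Ah: "(\<integral>\<^sup>+ z. W z * ennreal (norm (h z) powr p) \<partial>lborel) = A"
    proof -
      have "(\<integral>\<^sup>+ z. W z * ennreal (norm (h z) powr p) \<partial>lborel) = (\<integral>\<^sup>+ z. W (\<zeta> * z) * ennreal (norm (deriv f (\<zeta> * z)) powr p) \<partial>lborel)"
        by (simp only: h_def W_rotation[OF \<zeta>])
      also have "\<dots> = A" unfolding A_def by (rule nn_integral_rotation[OF \<zeta> W_mult_powr_measurable[OF dfh]])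
      finally show ?thesis .
    qed
    define r where "r = 1 - (1/2::real)^m"
    have r: "0 \<le> r" "r < 1" by (auto simp: r_def power_le_one)
    have [measurable]: "(\<lambda>s. ennreal ((1 - s) * norm (h (of_real s))) * indicator {r..<1} s) \<in> borel_measurable borel"
    proof -
      have "continuous_on {r..<1} (\<lambda>s. (1 - s) * norm (h (complex_of_real s)))"
        by (intro continuous_intros continuous_on_compose2[OF holomorphic_on_imp_continuous_on[OF h]]) (use r in auto)
      then have "(\<lambda>s. indicator {r..<1} s *\<^sub>R ((1 - s) * norm (h (complex_of_real s)))) \<in> borel_measurable borel"
        by (intro borel_measurable_continuous_on_indicator) auto
      then have "(\<lambda>s. ennreal (indicator {r..<1} s *\<^sub>R ((1 - s) * norm (h (complex_of_real s))))) \<in> borel_measurable borel" by measurable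
      moreover have "(\<lambda>s. ennreal (indicator {r..<1} s *\<^sub>R ((1 - s) * norm (h (complex_of_real s))))) = (\<lambda>s. ennreal ((1 - s) * norm (h (of_real s))) * indicator {r..<1} s)"
        by (auto simp: fun_eq_iff split: split_indicator)
      ultimately show ?thesis by simp
    qed
    have "(\<integral>\<^sup>+ s. ennreal ((1 - s) * norm (deriv f (of_real s * \<zeta>))) * indicator {0..<1} s \<partial>lborel)
      \<le> (\<integral>\<^sup>+ s. ennreal \<epsilon> * indicator {0..1} s + ennreal ((1 - s) * norm (h (of_real s))) * indicator {r..<1} s \<partial>lborel)"
    (is "(\<integral>\<^sup>+ z. ?f z \<partial>_) \<le> (\<integral>\<^sup>+ z. ?g z \<partial>_)")
    proof (rule nn_integral_mono)
      fix s :: real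
      show "?f s \<le> ?g s"
      proof (cases "0 \<le> s \<and> s < 1")
        case s: True
        show ?thesis
        proof (cases "s < r")
          case True
          have "norm (deriv f (of_real s * \<zeta>)) \<le> \<epsilon>" using True s by (intro small) (simp add: norm_mult \<zeta> r_def)
          then have "(1 - s) * norm (deriv f (of_real s * \<zeta>)) \<le> 1 * \<epsilon>" using s by (intro mult_mono) auto
          then show ?thesis using s True by (simp add: ennreal_leI)
        next
          case False
          then show ?thesis using s by (simp add: h_def mult.commute add_increasing)
        qed
      qed auto
    qed
    also have "\<dots> = ennreal \<epsilon> + (\<integral>\<^sup>+ s. ennreal ((1 - s) * norm (h (of_real s))) * indicator {r..<1} s \<partial>lborel)"
      by (subst nn_integral_add) (auto simp: nn_integral_cmult_indicator)
    also have "\<dots> \<le> ennreal \<epsilon> + ennreal K * (ennreal \<eta> * A + ennreal (\<eta> powr (1 - q)) * (\<Sum>n. ennreal (t (n + m))))"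
      using K(2)[OF h \<eta>, of m] unfolding Ah r_def by (intro add_left_mono)
    finally have "ennreal (norm (T_op (\<lambda>z. z) f z)) \<le> ennreal (norm (f 0)) + (ennreal \<epsilon> + ennreal K * (ennreal \<eta> * A + ennreal (\<eta> powr (1 - q)) * (\<Sum>n. ennreal (t (n + m)))))"
      using norm_T_op_ident_le[OF f \<zeta> \<rho>] unfolding z\<rho>[symmetric] by (meson add_left_mono order_trans)
    also have "\<dots> = ennreal (norm (f 0) + \<epsilon>) + ennreal K * (ennreal \<eta> * A + ennreal (\<eta> powr (1 - q)) * (\<Sum>n. ennreal (t (n + m))))"
      using \<epsilon> by (simp add: add.assoc)
    finally show "ennreal (norm (T_op (\<lambda>z. z) f z)) \<le> ennreal (norm (f 0) + \<epsilon>) + ennreal K *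
      (ennreal \<eta> * (\<integral>\<^sup>+ z. W z * ennreal (norm (deriv f z) powr p) \<partial>lborel) + ennreal (\<eta> powr (1 - q)) * (\<Sum>n. ennreal (t (n + m))))"
      by (simp only: A_def)
  qed
qed

lemma suminf_ennreal_t:
  assumes "summable t"
  shows "(\<Sum>n. ennreal (t (n + m))) = ennreal (\<Sum>n. t (n + m))"
  using assms t_pos by (intro suminf_ennreal2) (auto simp: less_imp_le summable_ignore_initial_segment)

lemma T_bounded_ident:
  assumes S: "summable t"
  shows "T_bounded_Hinf p \<nu> (\<lambda>z. z)"
proof -
  obtain K where K: "0 \<le> K" "\<And>f z m \<epsilon> \<eta>. f holomorphic_on ball 0 1 \<Longrightarrow> norm z < 1 \<Longrightarrow> 0 < \<eta> \<Longrightarrow> 0 \<le> \<epsilon> \<Longrightarrow>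
    (\<forall>u. norm u < 1 - (1/2)^m \<longrightarrow> norm (deriv f u) \<le> \<epsilon>) \<Longrightarrow>
    ennreal (norm (T_op (\<lambda>z. z) f z)) \<le> ennreal (norm (f 0) + \<epsilon>) + ennreal K *
      (ennreal \<eta> * (\<integral>\<^sup>+ z. W z * ennreal (norm (deriv f z) powr p) \<partial>lborel) + ennreal (\<eta> powr (1 - q)) * (\<Sum>n. ennreal (t (n + m))))"
    by (rule norm_T_op_ident_split) (rule that)
  define \<tau> where "\<tau> = suminf t"
  have \<tau>: "0 \<le> \<tau>" unfolding \<tau>_def using S t_pos by (intro suminf_nonneg) (auto simp: less_imp_le)
  define B where "B = 1 + K * (pi + \<tau>)"
  have unit: "norm (T_op (\<lambda>z. z) f z) \<le> B" if f: "f holomorphic_on ball 0 1" "D_normpow p \<nu> f \<le> 1" and z: "norm z < 1" for f z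
  proof -
    \<comment> \<open>For m = 0 the inner disc has radius 0 and is empty, so its bound can be taken
      to be 0; \<open>\<eta>\<close> = 1.\<close>
    have "ennreal (norm (T_op (\<lambda>z. z) f z)) \<le> ennreal (norm (f 0) + 0) + ennreal K *
      (ennreal 1 * (\<integral>\<^sup>+ z. W z * ennreal (norm (deriv f z) powr p) \<partial>lborel) + ennreal (1 powr (1 - q)) * (\<Sum>n. ennreal (t (n + 0))))"
      by (rule K(2)[OF f(1) z]) (auto simp: not_less[symmetric])
    also have "\<dots> \<le> ennreal 1 + ennreal K * (ennreal 1 * ennreal pi + ennreal (1 powr (1 - q)) * (\<Sum>n. ennreal (t (n + 0))))"
      using D_normpow_unit[OF f] by (intro add_mono mult_left_mono ennreal_leI) auto
    also have "\<dots> = ennreal B"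
      unfolding suminf_ennreal_t[OF S] using K(1) \<tau> by (simp add: B_def \<tau>_def ennreal_plus ennreal_mult')
    finally show ?thesis
      by (subst (asm) ennreal_le_iff) (use K(1) \<tau> in \<open>auto simp: B_def\<close>)
  qed
  show ?thesis
    unfolding T_bounded_Hinf_def
  proof (intro exI allI impI ballI)
    fix f z assume f: "in_D p \<nu> f" and z: "z \<in> ball (0::complex) 1"
    have fh: "f holomorphic_on ball 0 1" using f by (simp add: in_D_def)
    show "norm (T_op (\<lambda>z. z) f z) \<le> B * D_norm p \<nu> f"
    proof (rule le_mult_if_le_mult_greater)
      fix l assume l: "D_norm p \<nu> f < l"
      have l0: "0 < l" using l D_norm_nonneg[of p \<nu> f] by linarith
      have "norm (T_op (\<lambda>z. z) (\<lambda>z. of_real (1 / l) * f z) z) \<le> B"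
        using D_normpow_normalized_le_1[OF _ f weight_measurable l] p_gt_1 z
        by (intro unit holomorphic_intros fh) auto
      then show "norm (T_op (\<lambda>z. z) f z) \<le> B * l"
        unfolding T_op_cmult norm_mult using l0 by (simp add: norm_divide pos_divide_le_eq)
    qed
  qed
qed

text \<open>A subsequence is chosen along which the derivatives converge locally uniformly and the
  values at 0 converge. The operator is linear, so uniform Cauchy convergence of the images follows
  from \<open>norm_T_op_ident_split\<close> for the differences: locally uniform convergence handles
  the inner disc, and the tail of \<open>t\<close> the rest.\<close>

lemma T_compact_ident:
  assumes S: "summable t"
  shows "T_compact_Hinf p \<nu> (\<lambda>z. z)"
  unfolding T_compact_Hinf_def
proof (intro conjI allI impI T_bounded_ident[OF S])
  fix F :: "nat \<Rightarrow> complex \<Rightarrow> complex"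
  assume "\<forall>n. in_D p \<nu> (F n) \<and> D_norm p \<nu> (F n) \<le> 1"
  then have FD: "\<And>n. in_D p \<nu> (F n)" and FN: "\<And>n. D_norm p \<nu> (F n) \<le> 1" by auto
  have Fh: "F n holomorphic_on ball 0 1" for n using FD[of n] by (simp add: in_D_def)
  have F1: "D_normpow p \<nu> (F n) \<le> 1" for n
  proof -
    define a where "a = enn2real (D_normpow p \<nu> (F n))"
    have a: "D_normpow p \<nu> (F n) = ennreal a" "0 \<le> a" using FD[of n] by (auto simp: in_D_def a_def)
    have "a powr (1 / p) \<le> 1" using FN[of n] by (simp add: D_norm_def a_def)
    then have "(a powr (1 / p)) powr p \<le> 1" using p_gt_1 by (intro powr_le1) auto
    then have "a \<le> 1" using p_gt_1 a by (simp add: powr_powr)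
    then show ?thesis unfolding a(1) by (simp add: ennreal_le_1)
  qed
  note FW = D_normpow_unit[OF Fh F1]
  \<comment> \<open>Montel's theorem is applied to the derivatives, which the norm integral controls
    directly; the values at 0 are treated separately.\<close>
  define \<H> where "\<H> = {h. h holomorphic_on ball 0 1 \<and> (\<integral>\<^sup>+ z. W z * ennreal (norm (h z) powr p) \<partial>lborel) \<le> ennreal pi}"
  have dFh: "deriv (F n) holomorphic_on ball 0 1" for n by (rule holomorphic_deriv[OF Fh open_ball])
  obtain h r1 where r1: "strict_mono r1" and
      ul: "\<And>K. compact K \<Longrightarrow> K \<subseteq> ball 0 1 \<Longrightarrow> uniform_limit K ((\<lambda>n. deriv (F n)) \<circ> r1) h sequentially"
  proof (rule Montel[of "ball 0 1" \<H> "\<lambda>n. deriv (F n)"])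
    show "\<exists>B. \<forall>h\<in>\<H>. \<forall>z\<in>K. norm (h z) \<le> B" if K: "compact K" "K \<subseteq> ball 0 1" for K
    proof (cases "K = {}")
      case False
      have "compact (norm ` K)" by (intro compact_continuous_image continuous_intros K)
      then obtain x where x: "x \<in> norm ` K" "\<forall>y\<in>norm ` K. y \<le> x" using compact_attains_sup[of "norm ` K"] False by auto
      have "0 \<le> x" "x < 1" using x(1) K(2) by auto
      then obtain B where "\<And>h z. h holomorphic_on ball 0 1 \<Longrightarrow> (\<integral>\<^sup>+ z. W z * ennreal (norm (h z) powr p) \<partial>lborel) \<le> ennreal pi
          \<Longrightarrow> norm z \<le> x \<Longrightarrow> norm (h z) \<le> B"
        using norm_le_on_compact_disc[of x pi] by (metis pi_ge_zero)
      then have "\<forall>h\<in>\<H>. \<forall>z\<in>K. norm (h z) \<le> B" using x(2) by (auto simp: \<H>_def)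
      then show ?thesis by blast
    qed auto
    show "range (\<lambda>n. deriv (F n)) \<subseteq> \<H>" using dFh FW(1) by (auto simp: \<H>_def)
  qed (auto simp: \<H>_def)
  have "bounded (range (\<lambda>n. F (r1 n) 0))" using FW(2) by (auto simp: bounded_iff)
  then obtain l r2 where r2: "strict_mono r2" "((\<lambda>n. F (r1 n) 0) \<circ> r2) \<longlonglongrightarrow> l"
    using bounded_imp_convergent_subsequence by blast
  define r where "r = r1 \<circ> r2"
  have r: "strict_mono r" unfolding r_def by (rule strict_mono_o[OF r1 r2(1)])
  have c0: "Cauchy (\<lambda>n. F (r n) 0)" using LIMSEQ_imp_Cauchy[OF r2(2)] by (simp add: r_def o_def)
  obtain K where K: "0 \<le> K" "\<And>f z m \<epsilon> \<eta>. f holomorphic_on ball 0 1 \<Longrightarrow> norm z < 1 \<Longrightarrow> 0 < \<eta> \<Longrightarrow> 0 \<le> \<epsilon> \<Longrightarrow>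
    (\<forall>u. norm u < 1 - (1/2)^m \<longrightarrow> norm (deriv f u) \<le> \<epsilon>) \<Longrightarrow>
    ennreal (norm (T_op (\<lambda>z. z) f z)) \<le> ennreal (norm (f 0) + \<epsilon>) + ennreal K *
      (ennreal \<eta> * (\<integral>\<^sup>+ z. W z * ennreal (norm (deriv f z) powr p) \<partial>lborel) + ennreal (\<eta> powr (1 - q)) * (\<Sum>n. ennreal (t (n + m))))"
    by (rule norm_T_op_ident_split) (rule that)
  have "uniformly_Cauchy_on (ball 0 1) (\<lambda>n. T_op (\<lambda>z. z) (F (r n)))"
  proof (rule uniformly_Cauchy_onI)
    fix e :: real assume e: "0 < e"
    \<comment> \<open>From |a - b|^p <= 2^p (|a|^p + |b|^p), each of the two norm integrals being at
      most pi.\<close>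
    define A where "A = 2 powr p * (2 * pi)"
    have A0: "0 < A" by (simp add: A_def)
    \<comment> \<open>The order of choices matters: \<open>\<eta>\<close> first, making the norm
      term at most e/4, and then m depending on \<open>\<eta>\<close>, making the tail term less
      than e/4. The inner disc and the value at 0 take e/8 each. The \<open>+ 1\<close> keeps the
      divisor positive when K = 0.\<close>
    define k where "k = K + 1"
    have k: "0 < k" "K \<le> k" using K(1) by (auto simp: k_def)
    define \<eta> where "\<eta> = e / (4 * k * A)"
    have \<eta>: "0 < \<eta>" using e k A0 by (simp add: \<eta>_def)
    have "K * (\<eta> * A) \<le> k * (\<eta> * A)" using \<eta> A0 k by (intro mult_right_mono) auto
    also have "\<dots> = e / 4" using k A0 by (simp add: \<eta>_def)
    finally have t1: "K * (\<eta> * A) \<le> e / 4" .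
    define c where "c = k * \<eta> powr (1 - q)"
    have c: "0 < c" using k \<eta> by (simp add: c_def)
    obtain m where m: "norm (\<Sum>n. t (n + m)) < e / 4 / c"
      using suminf_exist_split[OF _ S, of "e / 4 / c"] e c by auto
    define \<tau> where "\<tau> = (\<Sum>n. t (n + m))"
    have \<tau>: "0 \<le> \<tau>" unfolding \<tau>_def using S t_pos
      by (intro suminf_nonneg summable_ignore_initial_segment) (auto simp: less_imp_le)
    have "K * (\<eta> powr (1 - q) * \<tau>) \<le> c * \<tau>"
      unfolding c_def mult.assoc using \<tau> k by (intro mult_right_mono) auto
    also have "\<dots> < e / 4" using m \<tau> c by (simp add: \<tau>_def[symmetric] pos_less_divide_eq mult.commute)
    finally have t2: "K * (\<eta> powr (1 - q) * \<tau>) < e / 4" .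
    have "cball 0 (1 - (1/2)^m) \<subseteq> ball (0::complex) 1"
    proof
      fix u :: complex assume "u \<in> cball 0 (1 - (1/2)^m)"
      moreover have "0 < (1/2::real)^m" by simp
      ultimately have "norm u < 1" unfolding mem_cball_0 by linarith
      then show "u \<in> ball 0 1" by simp
    qed
    then have "uniform_limit (cball 0 (1 - (1/2)^m)) ((\<lambda>n. deriv (F n)) \<circ> r1) h sequentially"
      by (intro ul) auto
    from filterlim_compose[OF this filterlim_subseq[OF r2(1)]]
    have "uniform_limit (cball 0 (1 - (1/2)^m)) (\<lambda>n. deriv (F (r n))) h sequentially"
      by (simp add: r_def o_def)
    then have "\<forall>\<^sub>F n in sequentially. \<forall>u\<in>cball 0 (1 - (1/2)^m). dist (deriv (F (r n)) u) (h u) < e / 16"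
      unfolding uniform_limit_iff by (elim allE[of _ "e / 16"] impE) (use e in auto)
    then obtain N1 where N1: "\<And>n u. N1 \<le> n \<Longrightarrow> norm u \<le> 1 - (1/2)^m \<Longrightarrow> dist (deriv (F (r n)) u) (h u) < e / 16"
      unfolding eventually_sequentially mem_cball_0[symmetric] by blast
    obtain N2 where N2: "\<And>i j. N2 \<le> i \<Longrightarrow> N2 \<le> j \<Longrightarrow> dist (F (r i) 0) (F (r j) 0) < e / 8"
      using c0 e unfolding Cauchy_def by (metis zero_less_divide_iff zero_less_numeral)
    show "\<exists>M. \<forall>z\<in>ball 0 1. \<forall>i\<ge>M. \<forall>j\<ge>M. dist (T_op (\<lambda>z. z) (F (r i)) z) (T_op (\<lambda>z. z) (F (r j)) z) < e"
    proof (intro exI ballI allI impI)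
      fix z :: complex and i j assume z: "z \<in> ball 0 1" and ij: "max N1 N2 \<le> i" "max N1 N2 \<le> j"
      define f where "f = (\<lambda>z. F (r i) z - F (r j) z)"
      have fh: "f holomorphic_on ball 0 1" unfolding f_def by (intro holomorphic_intros Fh)
      have df: "deriv f u = deriv (F (r i)) u - deriv (F (r j)) u" if "norm u < 1" for u
        unfolding f_def using that by (intro deriv_diff holomorphic_on_imp_differentiable_at[OF Fh open_ball]) auto
      have f0: "norm (f 0) \<le> e / 8" using N2[of i j] ij by (simp add: f_def dist_norm)
      have small: "norm (deriv f u) \<le> e / 8" if u: "norm u < 1 - (1/2)^m" for u
      proof -
        have "norm u < 1" using u zero_less_power[of "1/2::real" m] by linarith
        then have "norm (deriv f u) = dist (deriv (F (r i)) u) (deriv (F (r j)) u)" by (simp add: df dist_norm)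
        also have "\<dots> \<le> dist (deriv (F (r i)) u) (h u) + dist (deriv (F (r j)) u) (h u)" by (rule dist_triangle2)
        also have "\<dots> \<le> e / 8" using N1[of i u] N1[of j u] u ij by simp
        finally show ?thesis .
      qed
      have WA: "(\<integral>\<^sup>+ z. W z * ennreal (norm (deriv f z) powr p) \<partial>lborel) \<le> ennreal A"
      proof -
        have "(\<integral>\<^sup>+ z. W z * ennreal (norm (deriv f z) powr p) \<partial>lborel)
          \<le> (\<integral>\<^sup>+ z. ennreal (2 powr p) * (W z * ennreal (norm (deriv (F (r i)) z) powr p) + W z * ennreal (norm (deriv (F (r j)) z) powr p)) \<partial>lborel)"
    (is "(\<integral>\<^sup>+ z. ?f z \<partial>_) \<le> (\<integral>\<^sup>+ z. ?g z \<partial>_)")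
        proof (rule nn_integral_mono)
          fix u
          show "?f u \<le> ?g u"
          proof (cases "norm u < 1")
            case True
            define a b where "a = norm (deriv (F (r i)) u)" and "b = norm (deriv (F (r j)) u)"
            have "norm (deriv f u) \<le> a + b" unfolding df[OF True] a_def b_def by (rule norm_triangle_ineq4)
            also have "\<dots> \<le> 2 * max a b" by simp
            finally have "norm (deriv f u) powr p \<le> (2 * max a b) powr p" using p_gt_1 by (intro powr_mono2) auto
            also have "\<dots> = 2 powr p * max a b powr p" by (simp add: powr_mult a_def b_def)
            also have "\<dots> \<le> 2 powr p * (a powr p + b powr p)" by (intro mult_left_mono) (auto simp: max_def)
            finally have "ennreal (norm (deriv f u) powr p) \<le> ennreal (2 powr p * (a powr p + b powr p))" by (rule ennreal_leI)
            also have "\<dots> = ennreal (2 powr p) * (ennreal (a powr p) + ennreal (b powr p))" by (simp add: ennreal_mult' ennreal_plus)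
            finally have "W u * ennreal (norm (deriv f u) powr p) \<le> W u * (ennreal (2 powr p) * (ennreal (a powr p) + ennreal (b powr p)))"
              by (intro mult_left_mono) auto
            then show ?thesis by (simp add: a_def b_def distrib_left mult_ac)
          qed (simp add: W_def)
        qed
        also have "\<dots> = ennreal (2 powr p) * ((\<integral>\<^sup>+ z. W z * ennreal (norm (deriv (F (r i)) z) powr p) \<partial>lborel) + (\<integral>\<^sup>+ z. W z * ennreal (norm (deriv (F (r j)) z) powr p) \<partial>lborel))"
          using W_mult_powr_measurable[OF dFh] by (subst nn_integral_cmult) (auto simp: nn_integral_add)
        also have "\<dots> \<le> ennreal (2 powr p) * (ennreal pi + ennreal pi)" by (intro mult_left_mono add_mono FW(1)) auto
        also have "\<dots> = ennreal A" by (simp add: A_def ennreal_mult' ennreal_plus[symmetric] del: ennreal_plus)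
        finally show ?thesis .
      qed
      have "ennreal (norm (T_op (\<lambda>z. z) f z)) \<le> ennreal (norm (f 0) + e / 8) + ennreal K *
        (ennreal \<eta> * (\<integral>\<^sup>+ z. W z * ennreal (norm (deriv f z) powr p) \<partial>lborel) + ennreal (\<eta> powr (1 - q)) * (\<Sum>n. ennreal (t (n + m))))"
        using z e by (intro K(2) fh \<eta> allI impI small) auto
      also have "\<dots> \<le> ennreal (e / 8 + e / 8) + ennreal K * (ennreal \<eta> * ennreal A + ennreal (\<eta> powr (1 - q)) * ennreal \<tau>)"
        unfolding suminf_ennreal_t[OF S] \<tau>_def[symmetric] using f0 WA by (intro add_mono mult_left_mono ennreal_leI) auto
      also have "\<dots> = ennreal (e / 8 + e / 8 + K * (\<eta> * A + \<eta> powr (1 - q) * \<tau>))"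
      proof -
        have "ennreal \<eta> * ennreal A + ennreal (\<eta> powr (1 - q)) * ennreal \<tau> = ennreal (\<eta> * A + \<eta> powr (1 - q) * \<tau>)"
          using \<eta> A0 \<tau> by (simp add: ennreal_mult' ennreal_plus)
        moreover have "0 \<le> \<eta> * A + \<eta> powr (1 - q) * \<tau>" using \<eta> A0 \<tau> by simp
        ultimately show ?thesis using K(1) e by (simp add: ennreal_mult'[symmetric] ennreal_plus[symmetric] del: ennreal_plus)
      qed
      finally have "norm (T_op (\<lambda>z. z) f z) \<le> e / 8 + e / 8 + K * (\<eta> * A + \<eta> powr (1 - q) * \<tau>)"
        using \<eta> A0 \<tau> K(1) e by (subst (asm) ennreal_le_iff) auto
      also have "\<dots> < e" using t1 t2 e by (simp add: distrib_left)
      finally have "norm (T_op (\<lambda>z. z) f z) < e" .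
      moreover have "T_op (\<lambda>z. z) f z = T_op (\<lambda>z. z) (F (r i)) z - T_op (\<lambda>z. z) (F (r j)) z"
        unfolding f_def using z by (intro T_op_diff Fh holomorphic_intros) auto
      ultimately show "dist (T_op (\<lambda>z. z) (F (r i)) z) (T_op (\<lambda>z. z) (F (r j)) z) < e" by (simp add: dist_norm)
    qed
  qed
  then have "uniformly_convergent_on (ball 0 1) (\<lambda>n. T_op (\<lambda>z. z) (F (r n)))"
    by (simp add: uniformly_convergent_eq_Cauchy)
  then show "\<exists>r h. strict_mono r \<and> uniform_limit (ball 0 1) (\<lambda>n. T_op (\<lambda>z. z) (F (r n))) h sequentially"
    using r unfolding uniformly_convergent_on_def by blast
qed

text \<open>Constants always belong to both sets. If the sum converges, the symbol z lies in the
  smaller set \<open>Tc_set\<close>, so one nonconstant witness refutes both equalities; if it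
  diverges, the larger set \<open>T_set\<close> is already reduced to constants.\<close>

lemma T_set_eq_const_iff: "T_set p \<nu> = const_on_disc \<longleftrightarrow> \<not> summable t"
  and Tc_set_eq_const_iff: "Tc_set p \<nu> = const_on_disc \<longleftrightarrow> \<not> summable t"
proof -
  have nc: "(\<lambda>z::complex. z) \<notin> const_on_disc"
  proof
    assume "(\<lambda>z::complex. z) \<in> const_on_disc"
    then obtain c where c: "\<forall>z\<in>ball 0 1. z = (c::complex)" by (auto simp: const_on_disc_def)
    have "(0::complex) = c" "(1/2::complex) = c" using bspec[OF c, of 0] bspec[OF c, of "1/2"] by (simp_all add: norm_divide)
    then show False by simp
  qed
  have 1: "T_set p \<nu> = const_on_disc \<and> Tc_set p \<nu> = const_on_disc" if "\<not> summable t"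
  proof -
    have "T_set p \<nu> \<subseteq> const_on_disc"
      using T_bounded_imp_constant[OF that] by (auto simp: T_set_def const_on_disc_def)
    then show ?thesis
      by (meson const_on_disc_subset_Tc_set Tc_set_subset_T_set order_trans subset_antisym)
  qed
  have 2: "T_set p \<nu> \<noteq> const_on_disc \<and> Tc_set p \<nu> \<noteq> const_on_disc" if "summable t"
  proof -
    have "(\<lambda>z. z) \<in> Tc_set p \<nu>" using T_compact_ident[OF that] by (simp add: Tc_set_def)
    moreover from this have "(\<lambda>z. z) \<in> T_set p \<nu>" using Tc_set_subset_T_set by (rule rev_subsetD)
    ultimately show ?thesis using nc by metis
  qed
  show "T_set p \<nu> = const_on_disc \<longleftrightarrow> \<not> summable t" "Tc_set p \<nu> = const_on_disc \<longleftrightarrow> \<not> summable t"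
    using 1 2 by metis+
qed

end

theorem theorem1p2:
  fixes p :: real and \<omega> :: "real \<Rightarrow> real"
  assumes "1 < p" and "radial_weight \<omega>" and "D_hat \<omega>"
  defines "p' \<equiv> p / (p - 1)"
  defines "\<nu> \<equiv> (\<lambda>z::complex. \<omega> (norm z))"
  shows "(T_set p \<nu> = const_on_disc \<longleftrightarrow>
           (\<integral>\<^sup>+ r. ennreal ((1 - r) powr p' / omega_hat \<omega> r powr (p' - 1)) * indicator {0..<1} r \<partial>lborel) = \<infinity>)
       \<and> (Tc_set p \<nu> = const_on_disc \<longleftrightarrow> T_set p \<nu> = const_on_disc)
       \<and> ((\<integral>\<^sup>+ r. ennreal ((1 - r) powr p' / omega_hat \<omega> r powr (p' - 1)) * indicator {0..<1} r \<partial>lborel) = \<infinity>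
           \<longleftrightarrow> \<not> summable (\<lambda>k::nat. 1 / ((real k + 1) powr (2 + p') * moment \<omega> (real k) powr (p' - 1))))
       \<and> (\<not> summable (\<lambda>k::nat. 1 / ((real k + 1) powr (2 + p') * moment \<omega> (real k) powr (p' - 1)))
           \<longleftrightarrow> (\<forall>y pstar. p' < y \<longrightarrow> 0 < pstar \<longrightarrow>
                  \<not> id_bounded pstar (\<lambda>z. omega_hat \<omega> (norm z) * (1 - norm z) powr (p * (y - 1)))
                                (pstar / p) (std_weight y)))"
proof -
  obtain C where C: "1 \<le> C" "\<forall>r\<in>{0..<1}. omega_hat \<omega> r \<le> C * omega_hat \<omega> ((1 + r) / 2)"
    using assms(3) unfolding D_hat_def by blast
  interpret upper_doubling_exponent \<omega> C p p'
    by unfold_locales (use assms(1,2) C in \<open>auto simp: p'_def\<close>)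
  have iv: "(\<forall>y pstar. p' < y \<longrightarrow> 0 < pstar \<longrightarrow>
      \<not> id_bounded pstar (\<lambda>z. omega_hat \<omega> (norm z) * (1 - norm z) powr (p * (y - 1))) (pstar / p) (std_weight y))
      \<longleftrightarrow> \<not> summable t"
  proof (cases "summable t")
    case True
    \<comment> \<open>One instance refutes the universal statement: y = p' + 1 with source exponent
      1.\<close>
    then have "id_bounded 1 (\<lambda>z. omega_hat \<omega> (norm z) * (1 - norm z) powr (p * ((p' + 1) - 1))) (1 / p) (std_weight (p' + 1))"
      by (intro id_bounded_if_summable) auto
    with True show ?thesis by (meson less_add_one zero_less_one)
  next
    case False
    then show ?thesis using not_id_bounded_if_not_summable by blast
  qed
  show ?thesis
    unfolding \<nu>_def T_set_eq_const_iff Tc_set_eq_const_iff integral_condition_iff moment_condition_iff iv by simp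
qed

end
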